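(* In the setting described in the context, let $\beta_t=1/t$ (so that $\beta=-1$ and $\tilde\beta=1$), let $\chi_t=o(\beta_t^{1.5})$, and let $\tau$ be such that $\rho^\tau<1/3$. Let $\Xi^\star$ be the limiting covariance defined in the context. Then: (a) for the exact QP solver (the Newton system is solved exactly, i.e. $C^\star=\tilde C^\star=0$), $\Xi^\star=\Omega^\star$; (b) for the sketching solver, $\Xi^\star\succeq\Omega^\star$, but $\|\Xi^\star-\Omega^\star\|\le3\rho^\tau\|\Omega^\star\|$.
   Context: **Problem.** Minimize $f(x)=\mathbb{E}_{\xi\sim\mathcal P}[F(x;\xi)]$ over $x\in\mathbb{R}^d$ subject to $c(x)=0$, where $c:\mathbb{R}^d\to\mathbb{R}^m$ is deterministic. $G(x)=\nabla c(x)\in\mathbb{R}^{m\times d}$; $\mathcal L(x,\lambda)=f(x)+\lambda^Tc(x)$; $\nabla\mathcal L=(\nabla f+G^T\lambda,\,c)$; $\nabla^2\mathcal L$ is the Hessian in $(x,\lambda)$ and $\nabla_x^2\mathcal L$ the Hessian in $x$. A subscript $t$ means evaluation at $(x_t,\lambda_t)$, a superscript $\star$ evaluation at $(x^\star,\lambda^\star)$. $\|\cdot\|$ is the spectral norm (Euclidean norm for vectors), $\dagger$ the Moore–Penrose pseudoinverse. **Algorithm (AI-StoSQP).** Input: $(x_0,\lambda_0)$, positive sequences $\beta_t,\chi_t$ with $\eta_t=\beta_t+\chi_t$, an integer $\tau\ge1$, $B_0=I$. At iteration $t$: draw a fresh sample $\xi_t\sim\mathcal P$; set $\bar g_t=\nabla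 F(x_t;\xi_t)$, $\bar H_t=\nabla^2F(x_t;\xi_t)$, $\bar\nabla\mathcal L_t=(\bar g_t+G_t^T\lambda_t,c_t)$, $\bar\nabla_x^2\mathcal L_t=\bar H_t+\sum_i(\lambda_t)_i\nabla^2c_i(x_t)$, $B_t=\frac1t\sum_{i=0}^{t-1}\bar\nabla_x^2\mathcal L_i+\Delta_t$ (regularization $\Delta_t$ determined before $\xi_t$ is drawn), $K_t=\begin{pmatrix}B_t & G_t^T \\ G_t & 0\end{pmatrix}$; from $z_{t,0}=0$ perform $\tau$ steps $z_{t,j+1}=z_{t,j}-K_tS_{t,j}(S_{t,j}^TK_t^2S_{t,j})^\dagger S_{t,j}^T(K_tz_{t,j}+\bar\nabla\mathcal L_t)$ with $S_{t,j}\in\mathbb{R}^{(d+m)\times s}$ i.i.d. copies of a random sketching matrix $S$ independent of the samples; choose any stepsize $\bar\alpha_t\in[\beta_t,\eta_t]$ and set $(x_{t+1},\lambda_{t+1})=(x_t,\lambda_t)+\bar\alpha_tz_{t,\tau}$. $\mathcal F_t=\sigma(\{\xi_i,\{S_{i,j}\}_j,\bar\alpha_i\}_{i=0}^t)$. **Standing assumptions.** (i) There is a closed, bounded, convex set $\mathcal X\times\Lambda$ containing all iterates such that $f,c$ are twice continuously differentiable over $\mathcal X$ and $\nabla^2\mathcal L$ is Lipschitz there; $G_tG_t^T\succeq\gamma_GI$, $\|B_t\|\le\Upsilon_B$, $x^TB_tx\ge\gamma_{RH}\|x\|^2$ on $\ker G_t$, with positive constants. (ii) $\mathbb{E}[\bar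 g_t\mid\mathcal F_{t-1}]=\nabla f_t$, $\mathbb{E}[\bar H_t\mid\mathcal F_{t-1}]=\nabla^2f_t$, $\mathbb{E}[\|\bar g_t-\nabla f_t\|^3\mid\mathcal F_{t-1}]\le\Upsilon_m$, $\mathbb{E}[\sup_{x\in\mathcal X}\|\nabla^2F(x;\xi)\|^2]\le\Upsilon_m$. (iii) For all $t$, $\mathbb{E}[K_tS(S^TK_t^2S)^\dagger S^TK_t\mid\mathcal F_{t-1}]\succeq\gamma_SI$ (expectation over $S$ only) with $\gamma_S>0$; $\rho=1-\gamma_S$. (iv) $\mathbb{E}[\|S\|\|S^\dagger\|]\le\Upsilon_S$. (v) $(x_t,\lambda_t)\to(x^\star,\lambda^\star)$ almost surely, where $(x^\star,\lambda^\star)$ is a local solution with $\nabla\mathcal L^\star=0$, $G^\star$ of full row rank and $\nabla_x^2\mathcal L^\star$ positive definite on $\ker G^\star$ (so $K^\star=\nabla^2\mathcal L^\star$ is nonsingular); $\gamma_{RH}$ is small enough, $\Upsilon_B$ large enough relative to $\nabla_x^2\mathcal L^\star$, and $\Delta_t=0$ whenever the unregularized average already satisfies the bounds required of $B_t$ (so that $K_t\to K^\star$). **Limiting matrices.** With $S_1,\dots,S_\tau$ i.i.d. copies of $S$ and $\prod_{j=1}^\tau A_j=A_\tau\cdots A_1$, $$\tilde C^\star=-\prod_{j=1}^\tau\big(I-K^\star S_j(S_j^T(K^\star)^2S_j)^\dagger S_j^TK^\star\big),\qquad C^\star=\mathbb{E}[\tilde C^\star],$$ $$\Omega^\star=(K^\star)^{-1}\begin{pmatrix}\mathrm{Cov}(\nabla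 F(x^\star;\xi)) & 0 \\ 0 & 0\end{pmatrix}(K^\star)^{-1},\qquad K^\star=\begin{pmatrix}\nabla_x^2\mathcal L^\star & (G^\star)^T \\ G^\star & 0\end{pmatrix}.$$ With $\beta=\lim_t t(1-\beta_{t-1}/\beta_t)$ and $\tilde\beta=\lim_t t\beta_t$, $\Xi^\star$ is the solution of $$\Big(\big\{1+\tfrac{\beta}{2\tilde\beta}\big\}I+C^\star\Big)\Xi^\star+\Xi^\star\Big(\big\{1+\tfrac{\beta}{2\tilde\beta}\big\}I+C^\star\Big)=\mathbb{E}\big[(I+\tilde C^\star)\Omega^\star(I+\tilde C^\star)^T\big];$$ it is the covariance of the limiting normal distribution of $\sqrt{1/\bar\alpha_t}\,(x_t-x^\star,\lambda_t-\lambda^\star)$. *)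

theory Defs
  imports "HOL-Probability.Probability" "HOL-Library.Landau_Symbols"
begin

section \<open>Matrices\<close>

text \<open>The type-class norm on matrices is the Frobenius norm, hence the separate spectral norm.\<close>

definition spec_norm :: "real^'n^'m \<Rightarrow> real" where
  "spec_norm A = onorm (\<lambda>v. A *v v)"

definition loewner_le :: "real^'n^'n \<Rightarrow> real^'n^'n \<Rightarrow> bool" (infix "\<preceq>" 50) where
  "A \<preceq> B \<longleftrightarrow> transpose (B - A) = B - A \<and> (\<forall>v. 0 \<le> v \<bullet> ((B - A) *v v))"

definition is_pinv :: "real^'n^'m \<Rightarrow> real^'m^'n \<Rightarrow> bool" where
  "is_pinv A X \<longleftrightarrow> A ** X ** A = A \<and> X ** A ** X = X \<and>
     transpose (A ** X) = A ** X \<and> transpose (X ** A) = X ** A"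

definition pinv :: "real^'n^'m \<Rightarrow> real^'m^'n" where
  "pinv A = (THE X. is_pinv A X)"

definition joint :: "real^'d \<Rightarrow> real^'m \<Rightarrow> real^('d::finite + 'm::finite)" where
  "joint x l = (\<chi> k. case k of Inl i \<Rightarrow> x $ i | Inr j \<Rightarrow> l $ j)"

definition primal :: "real^('d::finite + 'm::finite) \<Rightarrow> real^'d" where
  "primal v = (\<chi> i. v $ Inl i)"

definition dual :: "real^('d::finite + 'm::finite) \<Rightarrow> real^'m" where
  "dual v = (\<chi> j. v $ Inr j)"

definition block_diag0 :: "real^'d^'d \<Rightarrow> real^('d::finite + 'm::finite)^('d + 'm)" where
  "block_diag0 A = (\<chi> k l. case (k, l) of (Inl i, Inl j) \<Rightarrow> A $ i $ j | _ \<Rightarrow> 0)"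

definition kkt :: "real^'d^'d \<Rightarrow> real^'d^'m \<Rightarrow> real^('d::finite + 'm::finite)^('d + 'm)" where
  "kkt B G = (\<chi> k l. case (k, l) of
       (Inl i, Inl j) \<Rightarrow> B $ i $ j
     | (Inl i, Inr j) \<Rightarrow> G $ j $ i
     | (Inr i, Inl j) \<Rightarrow> G $ i $ j
     | (Inr i, Inr j) \<Rightarrow> 0)"


section \<open>Derivatives\<close>

definition gradient :: "(real^'n \<Rightarrow> real) \<Rightarrow> real^'n \<Rightarrow> real^'n" where
  "gradient f x = (\<chi> i. frechet_derivative f (at x) (axis i 1))"

definition hessian :: "(real^'n \<Rightarrow> real) \<Rightarrow> real^'n \<Rightarrow> real^'n^'n" where
  "hessian f x = jacobian (gradient f) (at x)"

text \<open>The set need not be open; as usual, smoothness on it means smoothness on an open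
  neighbourhood of it.\<close>

definition C2_on :: "(real^'n \<Rightarrow> real) \<Rightarrow> (real^'n) set \<Rightarrow> bool" where
  "C2_on f X \<longleftrightarrow> (\<exists>U. open U \<and> X \<subseteq> U \<and> f differentiable_on U \<and>
     gradient f differentiable_on U \<and> continuous_on U (hessian f))"


section \<open>The constrained stochastic problem\<close>

definition objective :: "'p measure \<Rightarrow> (real^'d \<Rightarrow> 'p \<Rightarrow> real) \<Rightarrow> real^'d \<Rightarrow> real" where
  "objective P F x = (\<integral>p. F x p \<partial>P)"

definition lagrangian ::
    "(real^'d \<Rightarrow> real) \<Rightarrow> (real^'d \<Rightarrow> real^'m) \<Rightarrow> real^'d \<Rightarrow> real^'m \<Rightarrow> real" where
  "lagrangian f c x l = f x + l \<bullet> c x"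

text \<open>The gradient of the Lagrangian in both arguments, with \<open>g\<close> in place of the gradient
  of the objective (either the true gradient or a stochastic estimate).\<close>

definition lagrangian_grad ::
    "real^'d \<Rightarrow> (real^'d \<Rightarrow> real^'m) \<Rightarrow> real^'d \<Rightarrow> real^'m \<Rightarrow> real^('d::finite + 'm::finite)" where
  "lagrangian_grad g c x l = joint (g + transpose (jacobian c (at x)) *v l) (c x)"

definition lagrangian_hess_x ::
    "(real^'d \<Rightarrow> real) \<Rightarrow> (real^'d \<Rightarrow> real^'m) \<Rightarrow> real^'d \<Rightarrow> real^'m \<Rightarrow> real^'d^'d" where
  "lagrangian_hess_x f c x l = hessian (\<lambda>y. lagrangian f c y l) x"

definition local_solution ::
    "(real^'d \<Rightarrow> real) \<Rightarrow> (real^'d \<Rightarrow> real^'m) \<Rightarrow> real^'d \<Rightarrow> bool" where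
  "local_solution f c x \<longleftrightarrow> c x = 0 \<and> (\<exists>e>0. \<forall>y\<in>ball x e. c y = 0 \<longrightarrow> f x \<le> f y)"


section \<open>Sketching\<close>

definition sketch_proj :: "real^'n^'n \<Rightarrow> real^'s^'n \<Rightarrow> real^'n^'n" where
  "sketch_proj K S = K ** S ** pinv (transpose S ** (K ** K) ** S) ** transpose S ** K"

text \<open>\<open>\<tau>\<close> sketch-and-project steps for \<open>K z = - g\<close>, started at \<open>0\<close>.\<close>

primrec sketch_iter ::
    "real^'n^'n \<Rightarrow> real^'n \<Rightarrow> (nat \<Rightarrow> real^'s^'n) \<Rightarrow> nat \<Rightarrow> real^'n" where
  "sketch_iter K g S 0 = 0"
| "sketch_iter K g S (Suc j) = sketch_iter K g S j -
     (K ** S j ** pinv (transpose (S j) ** (K ** K) ** S j) ** transpose (S j))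
       *v (K *v sketch_iter K g S j + g)"

primrec residual_prod :: "real^'n^'n \<Rightarrow> (nat \<Rightarrow> real^'s^'n) \<Rightarrow> nat \<Rightarrow> real^'n^'n" where
  "residual_prod K S 0 = mat 1"
| "residual_prod K S (Suc j) = (mat 1 - sketch_proj K (S j)) ** residual_prod K S j"

definition C_tilde :: "real^'n^'n \<Rightarrow> nat \<Rightarrow> (nat \<Rightarrow> real^'s^'n) \<Rightarrow> real^'n^'n" where
  "C_tilde K \<tau> S = - residual_prod K S \<tau>"

text \<open>The law of \<open>\<tau>\<close> independent copies of a sketching matrix with law \<open>D\<close>.\<close>

definition sketch_law :: "(real^'s^'n) measure \<Rightarrow> nat \<Rightarrow> (nat \<Rightarrow> real^'s^'n) measure" where
  "sketch_law D \<tau> = PiM {..<\<tau>} (\<lambda>_. D)"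


section \<open>Limiting matrices\<close>

definition covariance :: "'p measure \<Rightarrow> ('p \<Rightarrow> real^'n) \<Rightarrow> real^'n^'n" where
  "covariance P X =
     (\<integral>p. (\<chi> i j. (X p - (\<integral>q. X q \<partial>P)) $ i * (X p - (\<integral>q. X q \<partial>P)) $ j) \<partial>P)"

definition K_star ::
    "'p measure \<Rightarrow> (real^'d \<Rightarrow> 'p \<Rightarrow> real) \<Rightarrow> (real^'d \<Rightarrow> real^'m) \<Rightarrow> real^'d \<Rightarrow> real^'m
      \<Rightarrow> real^('d::finite + 'm::finite)^('d + 'm)" where
  "K_star P F c xs ls = kkt (lagrangian_hess_x (objective P F) c xs ls) (jacobian c (at xs))"

definition Omega_star ::
    "'p measure \<Rightarrow> (real^'d \<Rightarrow> 'p \<Rightarrow> real) \<Rightarrow> (real^'d \<Rightarrow> real^'m) \<Rightarrow> real^'d \<Rightarrow> real^'m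
      \<Rightarrow> real^('d::finite + 'm::finite)^('d + 'm)" where
  "Omega_star P F c xs ls = matrix_inv (K_star P F c xs ls) **
     block_diag0 (covariance P (\<lambda>p. gradient (\<lambda>y. F y p) xs)) **
     matrix_inv (K_star P F c xs ls)"

text \<open>\<open>Ct\<close> is the random matrix \<open>C\<close>-tilde, defined on the probability space \<open>N\<close>. The
  Lyapunov equation involves \<open>1 + b / (2 * b')\<close>, where \<open>b\<close> and \<open>b'\<close> are the limits of
  \<open>t (1 - \<beta>\<^sub>t\<^sub>-\<^sub>1 / \<beta>\<^sub>t)\<close> and of \<open>t \<beta>\<^sub>t\<close>.\<close>

definition Xi_star ::
    "(nat \<Rightarrow> real) \<Rightarrow> 'w measure \<Rightarrow> ('w \<Rightarrow> real^'n^'n) \<Rightarrow> real^'n^'n \<Rightarrow> real^'n^'n" where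
  "Xi_star \<beta> N Ct Om =
     (let b = lim (\<lambda>t. real t * (1 - \<beta> (t - 1) / \<beta> t));
          b' = lim (\<lambda>t. real t * \<beta> t);
          C = (\<integral>w. Ct w \<partial>N);
          A = (1 + b / (2 * b')) *\<^sub>R mat 1 + C
      in THE X. A ** X + X ** A =
           (\<integral>w. (mat 1 + Ct w) ** Om ** transpose (mat 1 + Ct w) \<partial>N))"


section \<open>The adaptive inexact stochastic SQP method\<close>

text \<open>\<open>R i\<close> is the collection of events generated by the internal randomness of the solver
  at iteration \<open>i\<close>. The \<open>\<sigma>\<close>-algebra \<open>past t\<close> is the one generated by
  everything drawn before iteration \<open>t\<close>; it is usually denoted by \<open>F\<close> with index
  \<open>t - 1\<close>, and is trivial for \<open>t = 0\<close>.\<close>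

locale stosqp_run =
  fixes M :: "'w measure" and P :: "'p measure"
    and F :: "real^'d \<Rightarrow> 'p \<Rightarrow> real" and c :: "real^'d \<Rightarrow> real^'m"
    and \<xi> :: "nat \<Rightarrow> 'w \<Rightarrow> 'p" and R :: "nat \<Rightarrow> 'w set set"
    and \<alpha> :: "nat \<Rightarrow> 'w \<Rightarrow> real" and \<Delta> :: "nat \<Rightarrow> 'w \<Rightarrow> real^'d^'d"
    and x :: "nat \<Rightarrow> 'w \<Rightarrow> real^'d" and lam :: "nat \<Rightarrow> 'w \<Rightarrow> real^'m"
begin

definition past :: "nat \<Rightarrow> 'w measure" where
  "past t = sigma (space M) (\<Union>i<t. sets (vimage_algebra (space M) (\<xi> i) P) \<union> R i \<union>
     sets (vimage_algebra (space M) (\<alpha> i) borel))"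

definition g_est :: "nat \<Rightarrow> 'w \<Rightarrow> real^'d" where
  "g_est t \<omega> = gradient (\<lambda>y. F y (\<xi> t \<omega>)) (x t \<omega>)"

definition H_est :: "nat \<Rightarrow> 'w \<Rightarrow> real^'d^'d" where
  "H_est t \<omega> = hessian (\<lambda>y. F y (\<xi> t \<omega>)) (x t \<omega>)"

definition G :: "nat \<Rightarrow> 'w \<Rightarrow> real^'d^'m" where
  "G t \<omega> = jacobian c (at (x t \<omega>))"

definition grad_L_est :: "nat \<Rightarrow> 'w \<Rightarrow> real^('d + 'm)" where
  "grad_L_est t \<omega> = lagrangian_grad (g_est t \<omega>) c (x t \<omega>) (lam t \<omega>)"

definition hess_L_est :: "nat \<Rightarrow> 'w \<Rightarrow> real^'d^'d" where
  "hess_L_est t \<omega> =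
     H_est t \<omega> + (\<Sum>i\<in>UNIV. (lam t \<omega> $ i) *\<^sub>R hessian (\<lambda>y. c y $ i) (x t \<omega>))"

definition hess_avg :: "nat \<Rightarrow> 'w \<Rightarrow> real^'d^'d" where
  "hess_avg t \<omega> = (1 / real t) *\<^sub>R (\<Sum>i<t. hess_L_est i \<omega>)"

definition B :: "nat \<Rightarrow> 'w \<Rightarrow> real^'d^'d" where
  "B t \<omega> = (if t = 0 then mat 1 else hess_avg t \<omega> + \<Delta> t \<omega>)"

definition K :: "nat \<Rightarrow> 'w \<Rightarrow> real^('d + 'm)^('d + 'm)" where
  "K t \<omega> = kkt (B t \<omega>) (G t \<omega>)"

end

text \<open>What is common to the exact and the inexact method: \<open>z t\<close> is whatever direction the
  solver returns.\<close>

locale stosqp = stosqp_run M P F c \<xi> R \<alpha> \<Delta> x lam + prob_space M + sampling: prob_space P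
  for M :: "'w measure" and P :: "'p measure"
    and F :: "real^'d \<Rightarrow> 'p \<Rightarrow> real" and c :: "real^'d \<Rightarrow> real^'m"
    and \<xi> :: "nat \<Rightarrow> 'w \<Rightarrow> 'p" and R :: "nat \<Rightarrow> 'w set set"
    and \<alpha> :: "nat \<Rightarrow> 'w \<Rightarrow> real" and \<Delta> :: "nat \<Rightarrow> 'w \<Rightarrow> real^'d^'d"
    and x :: "nat \<Rightarrow> 'w \<Rightarrow> real^'d" and lam :: "nat \<Rightarrow> 'w \<Rightarrow> real^'m" +
  fixes z :: "nat \<Rightarrow> 'w \<Rightarrow> real^('d + 'm)"
    and \<beta> chi :: "nat \<Rightarrow> real"
    and x0 :: "real^'d" and lam0 :: "real^'m"
    and X :: "(real^'d) set" and \<Lambda> :: "(real^'m) set"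
    and \<gamma>\<^sub>G \<gamma>\<^sub>R\<^sub>H \<Upsilon>\<^sub>B \<Upsilon>\<^sub>m :: real
    and xs :: "real^'d" and ls :: "real^'m"
  assumes beta_pos: "\<And>t. \<beta> t > 0" and chi_pos: "\<And>t. chi t > 0"
    and F_integrable: "\<And>y. integrable P (F y)"
    \<comment> \<open>joint measurability of the derivatives on \<open>X\<close> is no restriction, since by
        \<open>F_C2\<close> below they are limits of difference quotients and continuous on \<open>X\<close>\<close>
    and grad_F_measurable:
      "(\<lambda>(y, p). gradient (\<lambda>u. F u p) y) \<in> borel_measurable (restrict_space borel X \<Otimes>\<^sub>M P)"
    and hess_F_measurable:
      "(\<lambda>(y, p). hessian (\<lambda>u. F u p) y) \<in> borel_measurable (restrict_space borel X \<Otimes>\<^sub>M P)"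
    and sample_measurable: "\<And>t. \<xi> t \<in> measurable M P"
    and sample_law: "\<And>t. distr M P (\<xi> t) = P"
    and sample_fresh: "\<And>t. indep_set (sets (past t)) (sets (vimage_algebra (space M) (\<xi> t) P))"
    and regularization_measurable: "\<And>t. \<Delta> t \<in> borel_measurable (past t)"
    and stepsize_measurable: "\<And>t. \<alpha> t \<in> borel_measurable M"
    and stepsize: "\<And>t \<omega>. \<omega> \<in> space M \<Longrightarrow> \<alpha> t \<omega> \<in> {\<beta> t..\<beta> t + chi t}"
    and init: "\<And>\<omega>. \<omega> \<in> space M \<Longrightarrow> x 0 \<omega> = x0 \<and> lam 0 \<omega> = lam0"
    and step: "\<And>t \<omega>. \<omega> \<in> space M \<Longrightarrow>
      joint (x (Suc t) \<omega>) (lam (Suc t) \<omega>) = joint (x t \<omega>) (lam t \<omega>) + \<alpha> t \<omega> *\<^sub>R z t \<omega>"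
    and constants_pos: "\<gamma>\<^sub>G > 0" "\<gamma>\<^sub>R\<^sub>H > 0" "\<Upsilon>\<^sub>B > 0" "\<Upsilon>\<^sub>m > 0"
    and region: "closed (X \<times> \<Lambda>)" "bounded (X \<times> \<Lambda>)" "convex (X \<times> \<Lambda>)"
    and iterates_in: "\<And>t \<omega>. \<omega> \<in> space M \<Longrightarrow> (x t \<omega>, lam t \<omega>) \<in> X \<times> \<Lambda>"
    and f_C2: "C2_on (objective P F) X"
    and c_C2: "\<And>i. C2_on (\<lambda>y. c y $ i) X"
    and F_C2: "\<And>p. p \<in> space P \<Longrightarrow> C2_on (\<lambda>y. F y p) X"
    and hess_L_lipschitz: "\<exists>L. L-lipschitz_on {joint y l | y l. (y, l) \<in> X \<times> \<Lambda>}
      (hessian (\<lambda>v. lagrangian (objective P F) c (primal v) (dual v)))"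
    and G_bound: "\<And>t \<omega>. \<omega> \<in> space M \<Longrightarrow> \<gamma>\<^sub>G *\<^sub>R mat 1 \<preceq> G t \<omega> ** transpose (G t \<omega>)"
    and B_bound: "\<And>t \<omega>. \<omega> \<in> space M \<Longrightarrow> spec_norm (B t \<omega>) \<le> \<Upsilon>\<^sub>B"
    and B_posdef: "\<And>t \<omega> v. \<omega> \<in> space M \<Longrightarrow> G t \<omega> *v v = 0 \<Longrightarrow>
      v \<bullet> (B t \<omega> *v v) \<ge> \<gamma>\<^sub>R\<^sub>H * (norm v)\<^sup>2"
    \<comment> \<open>conditional expectations of vectors and matrices are taken entrywise\<close>
    and g_integrable: "\<And>t i. integrable M (\<lambda>\<omega>. g_est t \<omega> $ i)"
    and g_unbiased: "\<And>t i. AE \<omega> in M.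
      real_cond_exp M (past t) (\<lambda>\<omega>'. g_est t \<omega>' $ i) \<omega> = gradient (objective P F) (x t \<omega>) $ i"
    and H_integrable: "\<And>t i j. integrable M (\<lambda>\<omega>. H_est t \<omega> $ i $ j)"
    and H_unbiased: "\<And>t i j. AE \<omega> in M.
      real_cond_exp M (past t) (\<lambda>\<omega>'. H_est t \<omega>' $ i $ j) \<omega> =
        hessian (objective P F) (x t \<omega>) $ i $ j"
    and g_moment: "\<And>t. AE \<omega> in M. nn_cond_exp M (past t)
      (\<lambda>\<omega>'. ennreal (norm (g_est t \<omega>' - gradient (objective P F) (x t \<omega>')) ^ 3)) \<omega> \<le> ennreal \<Upsilon>\<^sub>m"
    and H_moment:
      "(\<integral>\<^sup>+p. (SUP y\<in>X. ennreal ((spec_norm (hessian (\<lambda>u. F u p) y))\<^sup>2)) \<partial>P) \<le> ennreal \<Upsilon>\<^sub>m"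
    and converges: "AE \<omega> in M. (\<lambda>t. x t \<omega>) \<longlonglongrightarrow> xs \<and> (\<lambda>t. lam t \<omega>) \<longlonglongrightarrow> ls"
    and solution: "local_solution (objective P F) c xs"
    and stationary: "lagrangian_grad (gradient (objective P F) xs) c xs ls = 0"
    and licq: "rank (jacobian c (at xs)) = CARD('m)"
    and sosc: "\<And>v. v \<noteq> 0 \<Longrightarrow> jacobian c (at xs) *v v = 0 \<Longrightarrow>
      v \<bullet> (lagrangian_hess_x (objective P F) c xs ls *v v) > 0"
    \<comment> \<open>strict at the solution, so that the plain averages eventually satisfy both bounds and
        \<open>K t\<close> tends to \<open>K_star\<close>\<close>
    and gamma_RH_small: "\<And>v. v \<noteq> 0 \<Longrightarrow> jacobian c (at xs) *v v = 0 \<Longrightarrow>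
      \<gamma>\<^sub>R\<^sub>H * (norm v)\<^sup>2 < v \<bullet> (lagrangian_hess_x (objective P F) c xs ls *v v)"
    and Upsilon_B_large: "spec_norm (lagrangian_hess_x (objective P F) c xs ls) < \<Upsilon>\<^sub>B"
    and no_regularization: "\<And>t \<omega>. t \<ge> 1 \<Longrightarrow> \<omega> \<in> space M \<Longrightarrow>
      spec_norm (hess_avg t \<omega>) \<le> \<Upsilon>\<^sub>B \<Longrightarrow>
      (\<And>v. G t \<omega> *v v = 0 \<Longrightarrow> v \<bullet> (hess_avg t \<omega> *v v) \<ge> \<gamma>\<^sub>R\<^sub>H * (norm v)\<^sup>2) \<Longrightarrow>
      \<Delta> t \<omega> = 0"

locale exact_stosqp =
  stosqp M P F c \<xi> "\<lambda>_. {}" \<alpha> \<Delta> x lam z \<beta> chi x0 lam0 X \<Lambda> \<gamma>\<^sub>G \<gamma>\<^sub>R\<^sub>H \<Upsilon>\<^sub>B \<Upsilon>\<^sub>m xs ls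
  for M :: "'w measure" and P :: "'p measure"
    and F :: "real^'d \<Rightarrow> 'p \<Rightarrow> real" and c :: "real^'d \<Rightarrow> real^'m"
    and \<xi> \<alpha> \<Delta> x lam z \<beta> chi x0 lam0 X \<Lambda> \<gamma>\<^sub>G \<gamma>\<^sub>R\<^sub>H \<Upsilon>\<^sub>B \<Upsilon>\<^sub>m xs ls +
  assumes newton: "\<And>t \<omega>. \<omega> \<in> space M \<Longrightarrow> K t \<omega> *v z t \<omega> = - grad_L_est t \<omega>"

text \<open>The sketching matrices of iteration \<open>t\<close> have law \<open>D\<close> and are independent of each
  other and of everything drawn earlier, including the sample \<open>\<xi> t\<close>.\<close>

locale sketched_stosqp =
  stosqp M P F c \<xi> "\<lambda>i. \<Union>j<\<tau>. sets (vimage_algebra (space M) (S i j) borel)" \<alpha> \<Delta> x lam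
    z \<beta> chi x0 lam0 X \<Lambda> \<gamma>\<^sub>G \<gamma>\<^sub>R\<^sub>H \<Upsilon>\<^sub>B \<Upsilon>\<^sub>m xs ls
  for M :: "'w measure" and P :: "'p measure"
    and F :: "real^'d \<Rightarrow> 'p \<Rightarrow> real" and c :: "real^'d \<Rightarrow> real^'m"
    and \<xi> \<alpha> \<Delta> x lam z \<beta> chi x0 lam0 X \<Lambda> \<gamma>\<^sub>G \<gamma>\<^sub>R\<^sub>H \<Upsilon>\<^sub>B \<Upsilon>\<^sub>m xs ls
    and \<tau> :: nat and S :: "nat \<Rightarrow> nat \<Rightarrow> 'w \<Rightarrow> real^'s^('d + 'm)" +
  fixes D :: "(real^'s^('d + 'm)) measure" and \<gamma>\<^sub>S \<Upsilon>\<^sub>S :: real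
  assumes tau_pos: "\<tau> \<ge> 1"
    and D_prob: "prob_space D" and D_sets: "sets D = sets borel"
    and sketch_measurable: "\<And>t j. j < \<tau> \<Longrightarrow> S t j \<in> borel_measurable M"
    and sketch_distr: "\<And>t j. j < \<tau> \<Longrightarrow> distr M borel (S t j) = D"
    and sketch_indep: "\<And>t. indep_sets
      (\<lambda>k. case k of
          None \<Rightarrow> sigma_sets (space M) (sets (past t) \<union> sets (vimage_algebra (space M) (\<xi> t) P))
        | Some j \<Rightarrow> sets (vimage_algebra (space M) (S t j) borel))
      (insert None (Some ` {..<\<tau>}))"
    and sketched_newton:
      "\<And>t \<omega>. \<omega> \<in> space M \<Longrightarrow> z t \<omega> = sketch_iter (K t \<omega>) (grad_L_est t \<omega>) (\<lambda>j. S t j \<omega>) \<tau>"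
    and gamma_S_pos: "\<gamma>\<^sub>S > 0"
    \<comment> \<open>\<open>K t\<close> is determined by the past, so the conditional expectation integrates out
        the sketching matrix only\<close>
    and sketch_contraction:
      "\<And>t. AE \<omega> in M. \<gamma>\<^sub>S *\<^sub>R mat 1 \<preceq> (\<integral>s. sketch_proj (K t \<omega>) s \<partial>D)"
    and Upsilon_S_pos: "\<Upsilon>\<^sub>S > 0"
    and sketch_condition: "(\<integral>\<^sup>+s. ennreal (spec_norm s * spec_norm (pinv s)) \<partial>D) \<le> ennreal \<Upsilon>\<^sub>S"

end

theory Submission
  imports Defs
begin

text \<open>
  With \<open>\<beta>\<^sub>t = 1 / t\<close> the coefficient of the identity in the Lyapunov equation is one half. For the exact
  solver the equation is therefore \<open>\<Xi> / 2 + \<Xi> / 2 = \<Omega>\<close>, which settles (a).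

  For the sketching solver let \<open>P\<^sub>j\<close> be the \<open>j\<close>-th sketch-and-project matrix at the KKT matrix \<open>K\<close> of
  the solution. It is the orthogonal projection onto the range of \<open>K S\<^sub>j\<close>. Let \<open>\<Pi>\<close> be the product of
  the factors \<open>I - P\<^sub>j\<close> and \<open>N\<close> its expectation. By independence \<open>N\<close> is the \<open>\<tau>\<close>-th power of
  the symmetric matrix \<open>I - E P\<close>, whose norm is at most \<open>\<rho>\<close>; so \<open>N\<close> is symmetric with norm at most
  \<open>\<rho>\<^sup>\<tau> < 1/3\<close>. Subtracting \<open>\<Omega>\<close> from the solution leaves for \<open>Y = \<Xi> - \<Omega>\<close> the equation
  \<open>Y - N Y - Y N = W\<close>, where \<open>W\<close> is the expectation of \<open>\<Pi> \<Omega> \<Pi>\<^sup>T\<close>. It determines \<open>Y\<close>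
  (\<open>lyapunov_ex1\<close>), \<open>Y\<close> inherits positive semidefiniteness from \<open>W\<close> (\<open>lyapunov_psd\<close>), and
  its norm is at most three times that of \<open>W\<close> (\<open>lyapunov_norm_le\<close>). Finally the factor
  \<open>I - P\<^sub>j\<close> lowers the squared norm of a vector by exactly the quadratic form of \<open>P\<^sub>j\<close>, so \<open>\<Pi>\<^sup>T u\<close> has second moment at most
  \<open>\<rho>\<^sup>\<tau>\<close> times the square of the norm of \<open>u\<close> (\<open>second_moment\<close>), and the norm of \<open>W\<close> is at
  most \<open>\<rho>\<^sup>\<tau>\<close> times that of \<open>\<Omega>\<close>. The lemma \<open>limiting_covariance_bounds\<close> combines these steps.

  This uses the contraction \<open>E P \<succeq> (1 - \<rho>) I\<close> at the limit \<open>K\<close>, whereas the algorithm provides it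
  at the random matrices \<open>K\<^sub>t\<close>. It therefore has to be shown that some sample path has \<open>K\<^sub>t\<close> arbitrarily
  close to \<open>K\<close>. The errors of the Hessian estimates are square-integrable martingale differences,
  so their averages vanish in the mean (\<open>noise_average_tendsto_0\<close>), while the true Hessians
  converge along the iterates; as the bounds that trigger the regularization are strict at the
  solution, no regularization takes place in the limit and \<open>K\<^sub>t\<close> tends to \<open>K\<close> along a subsequence
  (\<open>K_tendsto\<close>). The projection is upper semicontinuous in the KKT matrix, uniformly in the
  sketching matrix (\<open>sketch_proj_stable\<close>), because \<open>K\<close> is invertible; so the contraction passes to
  the limit (\<open>sketch_contraction_limit\<close>). The expectations involved are meaningful because the
  pseudoinverse is a Borel function (\<open>borel_measurable_pinv\<close>), and the KKT matrices are symmetric because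
  Hessians are (\<open>transpose_hessian\<close>).
\<close>

section \<open>Matrix products and the spectral norm\<close>

text \<open>By default \<open>transpose A *v x\<close> is rewritten to \<open>x v* A\<close>, which hides the transposes that
  the symmetry arguments below are about.\<close>

declare transpose_matrix_vector [simp del]

lemma inner_matrix_vector: "x \<bullet> (A *v y) = (transpose A *v x) \<bullet> y"
  for A :: "real^'n^'m"
  by (metis dot_lmul_matrix transpose_matrix_vector)

lemma matrix_eqI_inner:
  fixes A B :: "real^'n^'m"
  assumes "\<And>x y. x \<bullet> (A *v y) = x \<bullet> (B *v y)"
  shows "A = B"
  by (simp add: matrix_eq) (metis assms vector_eq_ldot)

lemma transpose_diff: "transpose (A - B) = transpose A - transpose (B :: real^'n^'m)"
  by (simp add: transpose_def vec_eq_iff)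

lemma transpose_add: "transpose (A + B) = transpose A + transpose (B :: real^'n^'m)"
  by (simp add: transpose_def vec_eq_iff)

lemma transpose_zero [simp]: "transpose (0 :: real^'n^'m) = 0"
  by (simp add: transpose_def vec_eq_iff)

lemma bounded_bilinear_matrix_mult:
  "bounded_bilinear ((**) :: real^'n^'m \<Rightarrow> real^'k^'n \<Rightarrow> real^'k^'m)"
  unfolding bilinear_conv_bounded_bilinear[symmetric] bilinear_def
  by (auto intro!: linearI simp: matrix_matrix_mult_def vec_eq_iff distrib_left distrib_right
      sum.distrib sum_distrib_left mult.assoc mult.left_commute)

lemma bounded_bilinear_matrix_vector_mult:
  "bounded_bilinear ((*v) :: real^'n^'m \<Rightarrow> real^'n \<Rightarrow> real^'m)"
  unfolding bilinear_conv_bounded_bilinear[symmetric] bilinear_def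
  by (auto intro!: linearI simp: matrix_vector_mult_def vec_eq_iff distrib_left distrib_right
      sum.distrib sum_distrib_left mult.assoc mult.left_commute)

lemma bounded_linear_transpose: "bounded_linear (transpose :: real^'n^'m \<Rightarrow> real^'m^'n)"
  unfolding linear_conv_bounded_linear[symmetric]
  by (auto intro!: linearI simp: transpose_def vec_eq_iff)

lemmas tendsto_matrix_vector_mult = bounded_bilinear.tendsto[OF bounded_bilinear_matrix_vector_mult]
  and tendsto_transpose = bounded_linear.tendsto[OF bounded_linear_transpose]
  and continuous_on_matrix_mult = bounded_bilinear.continuous_on[OF bounded_bilinear_matrix_mult]
  and continuous_on_matrix_vector_mult = bounded_bilinear.continuous_on[OF bounded_bilinear_matrix_vector_mult]
  and continuous_on_transpose = bounded_linear.continuous_on[OF bounded_linear_transpose]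

lemma borel_measurable_matrix_mult [measurable (raw)]:
  fixes f :: "'a \<Rightarrow> real^'n^'m" and g :: "'a \<Rightarrow> real^'k^'n"
  assumes "f \<in> borel_measurable M" "g \<in> borel_measurable M"
  shows "(\<lambda>w. f w ** g w) \<in> borel_measurable M"
  using assms by (rule borel_measurable_continuous_Pair)
    (intro continuous_on_matrix_mult continuous_intros)

lemma borel_measurable_matrix_vector_mult [measurable (raw)]:
  fixes f :: "'a \<Rightarrow> real^'n^'m" and g :: "'a \<Rightarrow> real^'n"
  assumes "f \<in> borel_measurable M" "g \<in> borel_measurable M"
  shows "(\<lambda>w. f w *v g w) \<in> borel_measurable M"
  using assms by (rule borel_measurable_continuous_Pair)
    (intro continuous_on_matrix_vector_mult continuous_intros)

lemma borel_measurable_transpose [measurable (raw)]: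
  fixes f :: "'a \<Rightarrow> real^'n^'m"
  assumes "f \<in> borel_measurable M"
  shows "(\<lambda>w. transpose (f w)) \<in> borel_measurable M"
  by (rule measurable_compose[OF assms]) 
    (intro borel_measurable_continuous_onI continuous_on_transpose continuous_intros)

lemma borel_measurable_vec_nth_comp [measurable (raw)]:
  fixes f :: "'a \<Rightarrow> 'b::euclidean_space^'i"
  assumes "f \<in> borel_measurable M"
  shows "(\<lambda>w. f w $ i) \<in> borel_measurable M"
  by (rule measurable_compose[OF assms])
     (intro borel_measurable_continuous_onI continuous_intros)

lemma norm_matrix_vector_mult_le: "norm (A *v v) \<le> norm A * norm v" for A :: "real^'n^'m"
proof -
  have "norm (A *v v) = L2_set (\<lambda>i. norm (A $ i \<bullet> v)) UNIV"
    by (simp add: norm_vec_def matrix_vector_mult_def inner_vec_def)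
  also have "\<dots> \<le> L2_set (\<lambda>i. norm (A $ i) * norm v) UNIV"
    by (intro L2_set_mono) (auto simp: Cauchy_Schwarz_ineq2)
  also have "\<dots> = norm A * norm v"
    by (simp add: L2_set_left_distrib norm_vec_def)
  finally show ?thesis .
qed

lemma spec_norm_bound: "norm (A *v v) \<le> spec_norm A * norm v"
  unfolding spec_norm_def by (intro onorm matrix_vector_mul_bounded_linear)

lemma spec_norm_nonneg: "0 \<le> spec_norm A"
  unfolding spec_norm_def by (intro onorm_pos_le matrix_vector_mul_bounded_linear)

lemma spec_norm_le: "(\<And>v. norm (A *v v) \<le> r * norm v) \<Longrightarrow> spec_norm A \<le> r"
  unfolding spec_norm_def by (rule onorm_le)

lemma spec_norm_le_norm: "spec_norm A \<le> norm A"
  by (rule spec_norm_le[OF norm_matrix_vector_mult_le])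

lemma spec_norm_triangle: "spec_norm (A + B) \<le> spec_norm A + spec_norm B"
  unfolding spec_norm_def matrix_vector_mult_add_rdistrib
  by (intro onorm_triangle matrix_vector_mul_bounded_linear)

lemma spec_norm_mult: "spec_norm (A ** B) \<le> spec_norm A * spec_norm B"
proof -
  have "(\<lambda>v. (A ** B) *v v) = ((*v) A) \<circ> ((*v) B)" by (auto simp: matrix_vector_mul_assoc)
  then show ?thesis
    unfolding spec_norm_def by (simp add: onorm_compose)
qed

lemma spec_norm_eq_0: "spec_norm A = 0 \<Longrightarrow> A = 0"
  using spec_norm_bound[of A] by (auto simp: matrix_eq)

lemma abs_component_le_spec_norm: "\<bar>A $ i $ j\<bar> \<le> spec_norm A"
  unfolding spec_norm_def by (rule matrix_component_le_onorm)

lemma spec_norm_le_bilinear: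
  fixes A :: "real^'n^'m"
  assumes "\<And>x y. \<bar>x \<bullet> (A *v y)\<bar> \<le> r * norm x * norm y"
  shows "spec_norm A \<le> r"
proof (rule spec_norm_le)
  fix v
  have "norm (A *v v) * norm (A *v v) \<le> (r * norm v) * norm (A *v v)"
    using assms[of "A *v v" v] by (simp add: dot_square_norm power2_eq_square algebra_simps)
  moreover have "0 \<le> r * norm v"
    using assms[of "axis undefined 1" v] by (simp add: norm_axis_1 order_trans[OF abs_ge_zero])
  ultimately show "norm (A *v v) \<le> r * norm v"
    by (cases "norm (A *v v) = 0") auto
qed

section \<open>The Moore-Penrose pseudoinverse\<close>

text \<open>Because \<open>v \<bullet> (A\<^sup>T A v)\<close> is the square of the norm of \<open>A v\<close>.\<close>

lemma matrix_gram_cancel: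
  fixes A :: "real^'n^'m"
  assumes "transpose A *v (A *v v) = 0" shows "A *v v = 0"
  by (metis assms inner_eq_zero_iff inner_matrix_vector inner_zero_left inner_commute)

text \<open>Both \<open>A X\<close> and \<open>A Y\<close> are the orthogonal projection onto the range of \<open>A\<close>, and both \<open>X A\<close>
  and \<open>Y A\<close> the one onto the row space; hence \<open>X = X A X = Y A Y = Y\<close>.\<close>

lemma is_pinv_unique:
  assumes "is_pinv A X" "is_pinv A Y" shows "X = Y"
proof -
  note x = assms(1)[unfolded is_pinv_def] and y = assms(2)[unfolded is_pinv_def]
  have AXY: "A ** X = A ** Y"
  proof -
    have "A ** X = transpose (A ** X)" using x by simp
    also have "\<dots> = transpose (A ** Y ** A ** X)" using y by simp
    also have "\<dots> = transpose (A ** X) ** transpose (A ** Y)"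
      by (simp add: matrix_transpose_mul matrix_mul_assoc)
    also have "\<dots> = A ** X ** A ** Y" using x y by (simp add: matrix_mul_assoc)
    finally show ?thesis using x by simp
  qed
  have XAY: "X ** A = Y ** A"
  proof -
    have "X ** A = transpose (X ** A)" using x by simp
    also have "\<dots> = transpose (X ** (A ** Y ** A))" using y by simp
    also have "\<dots> = transpose (Y ** A) ** transpose (X ** A)"
      by (simp add: matrix_transpose_mul matrix_mul_assoc)
    also have "\<dots> = (Y ** A) ** (X ** A)" using x y by simp
    also have "\<dots> = Y ** (A ** X ** A)" by (simp add: matrix_mul_assoc)
    finally show ?thesis using x by simp
  qed
  have "X = X ** A ** X" using x by simp
  also have "\<dots> = Y ** A ** Y" using AXY XAY by (metis matrix_mul_assoc)
  finally show ?thesis using y by simp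
qed

text \<open>Send \<open>y\<close> to the one vector \<open>w\<close> of the row space that solves the normal equations
  \<open>A\<^sup>T A w = A\<^sup>T y\<close>. Uniqueness of \<open>w\<close> makes this map linear, and the four Penrose identities are
  consequences of the normal equations for its matrix \<open>X\<close>, which read \<open>A\<^sup>T A X = A\<^sup>T\<close>.\<close>

lemma is_pinv_exists:
  fixes A :: "real^'n^'m"
  shows "\<exists>X. is_pinv A X"
proof -
  let ?W = "range ((*v) (transpose A))" and ?R = "range ((*v) A)"
  have subW: "subspace ?W" and subR: "subspace ?R"
    by (auto intro: subspace_UNIV linear_subspace_image)
  have cancel: "w = 0" if "w \<in> ?W" "A *v w = 0" for w
  proof -
    from that obtain u where "w = transpose A *v u" by auto
    then have "transpose A *v u = 0" using matrix_gram_cancel[of "transpose A" u] that by simp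
    then show ?thesis using \<open>w = _\<close> by simp
  qed
  have ex: "\<exists>w\<in>?W. transpose A *v (A *v w) = transpose A *v y" for y
  proof -
    obtain p q where p: "p \<in> span ?R" "\<And>w. w \<in> span ?R \<Longrightarrow> orthogonal q w" "y = p + q"
      using orthogonal_subspace_decomp_exists by blast
    then obtain u where u: "p = A *v u" using subR by (metis span_eq_iff imageE)
    have "v \<bullet> (transpose A *v q) = 0" for v
      using p(2)[of "A *v v"] inner_matrix_vector[of v "transpose A" q]
      by (simp add: span_base orthogonal_def inner_commute)
    then have q: "transpose A *v q = 0" by (metis inner_eq_zero_iff)
    obtain w k where w: "w \<in> span ?W" "\<And>v. v \<in> span ?W \<Longrightarrow> orthogonal k v" "u = w + k"
      using orthogonal_subspace_decomp_exists by blast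
    have "(A *v k) \<bullet> v = 0" for v
      using w(2)[of "transpose A *v v"] inner_matrix_vector[of k "transpose A" v]
      by (simp add: span_base orthogonal_def)
    then have "A *v k = 0" by (metis inner_eq_zero_iff)
    then have "transpose A *v (A *v w) = transpose A *v y"
      using w(3) u p(3) q by (simp add: matrix_vector_right_distrib)
    with w(1) subW show ?thesis by (metis span_eq_iff)
  qed
  have uniq: "w = w'" if "w \<in> ?W" "w' \<in> ?W" "transpose A *v (A *v w) = transpose A *v (A *v w')" for w w'
  proof -
    have "A *v (w - w') = 0"
      by (rule matrix_gram_cancel) (use that in \<open>simp add: matrix_vector_mult_diff_distrib\<close>)
    with cancel[of "w - w'"] subspace_diff[OF subW that(1,2)] show ?thesis by simp
  qed
  obtain g where g: "\<And>y. g y \<in> ?W" "\<And>y. transpose A *v (A *v g y) = transpose A *v y"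
    using ex by metis
  have "linear g"
  proof (rule linearI)
    show "g (a + b) = g a + g b" for a b
      by (rule uniq) (use g subspace_add[OF subW] in \<open>simp_all add: matrix_vector_right_distrib\<close>)
    show "g (r *\<^sub>R a) = r *\<^sub>R g a" for r a
      by (rule uniq) (use g subspace_scale[OF subW] in \<open>simp_all add: matrix_vector_mult_scaleR\<close>)
  qed
  define X where "X = matrix g"
  have X: "X *v y = g y" for y unfolding X_def by (simp add: \<open>linear g\<close> matrix_works)
  have normal: "transpose A ** A ** X = transpose A"
    by (simp add: matrix_eq matrix_vector_mul_assoc[symmetric] X g)
  have AX: "transpose (A ** X) = A ** X"
  proof -
    have "transpose (A ** X) = transpose X ** transpose A" by (simp add: matrix_transpose_mul)
    also have "\<dots> = transpose X ** (transpose A ** A ** X)" by (simp add: normal)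
    also have "\<dots> = transpose (A ** X) ** (A ** X)" by (simp add: matrix_transpose_mul matrix_mul_assoc)
    finally have "transpose (A ** X) = transpose (A ** X) ** (A ** X)" .
    then show ?thesis by (metis matrix_transpose_mul transpose_transpose)
  qed
  have "A ** X ** A = transpose (transpose A ** A ** X)"
    by (metis AX matrix_mul_assoc matrix_transpose_mul transpose_transpose)
  then have AXA: "A ** X ** A = A" by (simp add: normal)
  have XAX: "X ** A ** X = X"
    unfolding matrix_eq
  proof
    fix y
    show "X ** A ** X *v y = X *v y"
      by (rule uniq) (use g in \<open>simp_all add: matrix_vector_mul_assoc[symmetric] X\<close>)
  qed
  have XA: "transpose (X ** A) = X ** A"
  proof -
    have ker: "A *v ((X ** A) *v u - u) = 0" for u
      by (rule matrix_gram_cancel)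
         (simp add: matrix_vector_mult_diff_distrib matrix_vector_mul_assoc[symmetric] X g)
    have orth: "((X ** A) *v v) \<bullet> ((X ** A) *v u) = ((X ** A) *v v) \<bullet> u" for u v
    proof -
      obtain s where "(X ** A) *v v = transpose A *v s"
        using g(1)[of "A *v v"] by (auto simp: matrix_vector_mul_assoc[symmetric] X)
      then have "((X ** A) *v v) \<bullet> ((X ** A) *v u - u) = s \<bullet> (A *v ((X ** A) *v u - u))"
        using inner_matrix_vector[of s A] by simp
      then show ?thesis using ker[of u] by (simp add: inner_diff_right)
    qed
    show ?thesis
    proof (rule matrix_eqI_inner)
      fix x y
      show "x \<bullet> (transpose (X ** A) *v y) = x \<bullet> (X ** A *v y)"
        using orth[of x y] orth[of y x] inner_matrix_vector[of x "transpose (X ** A)" y]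
        by (simp add: inner_commute)
    qed
  qed
  show ?thesis using AXA XAX AX XA by (auto simp: is_pinv_def)
qed

lemma is_pinv_pinv: "is_pinv A (pinv A)"
  unfolding pinv_def by (rule theI') (use is_pinv_exists is_pinv_unique in blast)

lemma pinv_eqI: "is_pinv A X \<Longrightarrow> pinv A = X"
  using is_pinv_pinv is_pinv_unique by blast

lemma transpose_pinv_symmetric:
  assumes "transpose A = A" shows "transpose (pinv A) = pinv A"
proof -
  let ?X = "pinv A"
  note x = is_pinv_pinv[of A, unfolded is_pinv_def]
  have "is_pinv A (transpose ?X)"
    unfolding is_pinv_def using x assms
    by (metis matrix_transpose_mul matrix_mul_assoc)
  then show ?thesis using pinv_eqI by metis
qed

lemma closed_graph_is_pinv: "closed {(A :: real^'n^'m, X). is_pinv A X}"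
  unfolding is_pinv_def case_prod_beta
  by (intro closed_Collect_conj closed_Collect_eq continuous_on_matrix_mult
      continuous_on_transpose continuous_intros)

text \<open>The pseudoinverse is discontinuous wherever the rank drops. Its graph is closed, however, so the
  preimage of a closed set is the projection of a closed set of pairs, that is, a countable union of
  projections of compact sets.\<close>

lemma borel_measurable_pinv: "(pinv :: real^'n^'m \<Rightarrow> _) \<in> borel_measurable borel"
proof (rule borel_measurableI)
  have pre: "pinv -` C \<in> sets borel" if C: "closed C" for C :: "(real^'m^'n) set"
  proof -
    let ?T = "\<lambda>n::nat. {(A :: real^'n^'m, X). is_pinv A X} \<inter> (UNIV \<times> C) \<inter> cball 0 (real n)"
    have "compact (fst ` ?T n)" for n
      by (intro compact_continuous_image closed_Int_compact closed_Int closed_Times C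
          closed_graph_is_pinv compact_cball continuous_intros)
    then have "fst ` ?T n \<in> sets borel" for n by (intro borel_closed compact_imp_closed)
    then have "(\<Union>n. fst ` ?T n) \<in> sets borel" by auto
    also have "(\<Union>n. fst ` ?T n) = pinv -` C"
    proof (intro set_eqI iffI)
      fix A assume "A \<in> pinv -` C"
      moreover obtain n :: nat where "norm (A, pinv A) \<le> real n" using real_arch_simple by blast
      ultimately have "(A, pinv A) \<in> ?T n" by (auto simp: is_pinv_pinv)
      then show "A \<in> (\<Union>n. fst ` ?T n)" by force
    qed (auto dest: pinv_eqI)
    finally show ?thesis .
  qed
  fix U :: "(real^'m^'n) set" assume "open U"
  then have "pinv -` (- U) \<in> sets borel" by (intro pre) (simp add: closed_Compl)
  then have "- (pinv -` (- U)) \<in> sets borel" by (rule borel_comp)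
  then show "pinv -` U \<inter> space borel \<in> sets borel" by (simp add: vimage_Compl)
qed

lemma borel_measurable_pinv_comp [measurable (raw)]:
  fixes f :: "'a \<Rightarrow> real^'n^'m"
  shows "f \<in> borel_measurable M \<Longrightarrow> (\<lambda>w. pinv (f w)) \<in> borel_measurable M"
  by (rule measurable_compose[OF _ borel_measurable_pinv])

lemma borel_measurable_sketch_proj [measurable (raw)]:
  assumes "f \<in> borel_measurable M" "g \<in> borel_measurable M"
  shows "(\<lambda>w. sketch_proj (f w) (g w)) \<in> borel_measurable M"
  using assms unfolding sketch_proj_def by measurable

section \<open>Sketch-and-project as an orthogonal projection\<close>

text \<open>With \<open>Y = K S\<close> this is the projection \<open>Y (Y\<^sup>T Y)\<^sup>\<dagger> Y\<^sup>T\<close> of least squares onto the range of \<open>Y\<close>.\<close>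

lemma sketch_proj_gram:
  assumes "transpose K = K"
  shows "sketch_proj K S =
    (K ** S) ** pinv (transpose (K ** S) ** (K ** S)) ** transpose (K ** S)"
  using assms by (simp add: sketch_proj_def matrix_transpose_mul matrix_mul_assoc)

lemma transpose_sketch_proj:
  assumes "transpose K = K"
  shows "transpose (sketch_proj K S) = sketch_proj K S"
proof -
  define Y where "Y = K ** S"
  have "transpose (pinv (transpose Y ** Y)) = pinv (transpose Y ** Y)"
    by (rule transpose_pinv_symmetric) (simp add: matrix_transpose_mul)
  then have "transpose (Y ** pinv (transpose Y ** Y) ** transpose Y) = Y ** pinv (transpose Y ** Y) ** transpose Y"
    by (simp add: matrix_transpose_mul matrix_mul_assoc)
  then show ?thesis by (simp only: sketch_proj_gram[OF assms] Y_def)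
qed

lemma sketch_proj_idem:
  assumes "transpose K = K"
  shows "sketch_proj K S ** sketch_proj K S = sketch_proj K S"
proof -
  let ?Y = "K ** S" and ?Q = "pinv (transpose (K ** S) ** (K ** S))"
  have "?Q ** (transpose ?Y ** ?Y) ** ?Q = ?Q"
    using is_pinv_pinv by (auto simp: is_pinv_def)
  moreover have "sketch_proj K S ** sketch_proj K S
      = ?Y ** (?Q ** (transpose ?Y ** ?Y) ** ?Q) ** transpose ?Y"
    by (simp only: sketch_proj_gram[OF assms] matrix_mul_assoc)
  ultimately show ?thesis by (simp add: sketch_proj_gram[OF assms])
qed

text \<open>The Penrose identity for the Gram matrix gives \<open>Y\<^sup>T P Y = Y\<^sup>T Y\<close>, and then the Gram matrix of
  \<open>P Y - Y\<close> vanishes.\<close>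

lemma sketch_proj_fixes_range:
  assumes "transpose K = K"
  shows "sketch_proj K S ** (K ** S) = K ** S"
proof -
  define Y where "Y = K ** S"
  define P where "P = sketch_proj K S"
  define Q where "Q = pinv (transpose Y ** Y)"
  have sym: "transpose P = P" and idem: "P ** P = P"
    by (simp_all add: P_def transpose_sketch_proj assms sketch_proj_idem)
  have P: "P = Y ** Q ** transpose Y"
    by (simp add: P_def Q_def Y_def sketch_proj_gram[OF assms])
  have "(transpose Y ** Y) ** Q ** (transpose Y ** Y) = transpose Y ** Y"
    unfolding Q_def using is_pinv_pinv by (auto simp: is_pinv_def)
  then have YPY: "transpose Y ** P ** Y = transpose Y ** Y"
    by (simp add: P matrix_mul_assoc)
  have "transpose (P ** Y - Y) ** (P ** Y - Y)
      = transpose Y ** (P ** P) ** Y - transpose Y ** P ** Y - transpose Y ** P ** Y + transpose Y ** Y"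
    by (simp add: transpose_diff matrix_transpose_mul sym matrix_mul_assoc
        bounded_bilinear.diff_left[OF bounded_bilinear_matrix_mult]
        bounded_bilinear.diff_right[OF bounded_bilinear_matrix_mult])
  then have gram: "transpose (P ** Y - Y) ** (P ** Y - Y) = 0" by (simp add: idem YPY)
  have "(P ** Y - Y) *v u = 0" for u
    by (rule matrix_gram_cancel) (simp only: matrix_vector_mul_assoc gram matrix_vector_mult_0)
  then have "P ** Y - Y = 0" by (simp add: matrix_eq)
  then show ?thesis by (simp add: P_def Y_def)
qed

lemma inner_sketch_proj:
  assumes "transpose K = K"
  shows "u \<bullet> (sketch_proj K S *v v) = (sketch_proj K S *v u) \<bullet> v"
  using inner_matrix_vector[of u "sketch_proj K S" v] by (simp only: transpose_sketch_proj[OF assms])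

lemma inner_sketch_proj_self:
  assumes "transpose K = K"
  shows "v \<bullet> (sketch_proj K S *v v) = (norm (sketch_proj K S *v v))\<^sup>2"
proof -
  have "v \<bullet> (sketch_proj K S *v v) = v \<bullet> (sketch_proj K S *v (sketch_proj K S *v v))"
    by (simp add: matrix_vector_mul_assoc sketch_proj_idem[OF assms])
  then show ?thesis
    using inner_sketch_proj[OF assms, of v S "sketch_proj K S *v v"] by (simp add: dot_square_norm)
qed

lemma norm_sketch_residual:
  assumes "transpose K = K"
  shows "(norm ((mat 1 - sketch_proj K S) *v v))\<^sup>2 = (norm v)\<^sup>2 - v \<bullet> (sketch_proj K S *v v)"
proof -
  let ?p = "sketch_proj K S *v v"
  have "(norm ((mat 1 - sketch_proj K S) *v v))\<^sup>2 = (v - ?p) \<bullet> (v - ?p)"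
    by (simp add: matrix_vector_mult_diff_rdistrib power2_norm_eq_inner)
  also have "\<dots> = (norm v)\<^sup>2 - 2 * (v \<bullet> ?p) + (norm ?p)\<^sup>2"
    by (simp add: inner_diff_left inner_diff_right inner_commute power2_norm_eq_inner)
  finally show ?thesis by (simp add: inner_sketch_proj_self[OF assms])
qed

lemma norm_sketch_residual_le:
  assumes "transpose K = K"
  shows "norm ((mat 1 - sketch_proj K S) *v v) \<le> norm v"
proof (rule power2_le_imp_le)
  show "(norm ((mat 1 - sketch_proj K S) *v v))\<^sup>2 \<le> (norm v)\<^sup>2"
    unfolding norm_sketch_residual[OF assms] inner_sketch_proj_self[OF assms] by simp
qed simp

lemma norm_sketch_proj_le:
  assumes "transpose K = K"
  shows "norm (sketch_proj K S *v v) \<le> norm v"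
proof (rule power2_le_imp_le)
  have "0 \<le> (norm v)\<^sup>2 - (norm (sketch_proj K S *v v))\<^sup>2"
    unfolding inner_sketch_proj_self[OF assms, symmetric] norm_sketch_residual[OF assms, symmetric]
    by simp
  then show "(norm (sketch_proj K S *v v))\<^sup>2 \<le> (norm v)\<^sup>2" by simp
qed simp

text \<open>A one-sided continuity of the projection in \<open>K\<close>, uniform in \<open>S\<close>. A vector \<open>w\<close> in the range of
  \<open>K' S\<close> is \<open>K' s\<close> with \<open>s\<close> in the range of \<open>S\<close>. As \<open>K\<close> has the left inverse \<open>L\<close> and \<open>K'\<close> is close to
  \<open>K\<close>, the vector \<open>s\<close> is at most \<open>2 * norm L\<close> times as long as \<open>w\<close>. So \<open>w\<close> is close to \<open>K s\<close>, which the
  projection onto the range of \<open>K S\<close> fixes. Uniformity in \<open>S\<close> is what lets the estimate pass through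
  the expectation over the sketching matrix.\<close>

lemma sketch_proj_stable:
  assumes K: "transpose K = K" and K': "transpose K' = K'"
    and L: "L ** K = mat 1" and small: "norm L * norm (K' - K) \<le> 1 / 2"
  shows "v \<bullet> (sketch_proj K' S *v v)
    \<le> v \<bullet> (sketch_proj K S *v v) + 4 * norm L * norm (K' - K) * (norm v)\<^sup>2"
proof -
  define e where "e = norm (K' - K)"
  let ?P = "sketch_proj K S" and ?P' = "sketch_proj K' S"
  define w where "w = ?P' *v v"
  define u where "u = (pinv (transpose S ** (K' ** K') ** S) ** transpose S ** K') *v v"
  define s where "s = S *v u"
  have w: "w = K' *v s"
    by (simp add: w_def s_def u_def sketch_proj_def matrix_vector_mul_assoc matrix_mul_assoc)
  have wKs: "norm (w - K *v s) \<le> e * norm s"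
    unfolding w e_def matrix_vector_mult_diff_rdistrib[symmetric] by (rule norm_matrix_vector_mult_le)
  have "norm s = norm (L *v (K *v s))" by (simp add: matrix_vector_mul_assoc L)
  also have "\<dots> \<le> norm L * norm (K *v s)" by (rule norm_matrix_vector_mult_le)
  also have "\<dots> \<le> norm L * (norm w + e * norm s)"
    using wKs norm_triangle_ineq[of w "K *v s - w"]
    by (intro mult_left_mono) (auto simp: norm_minus_commute)
  also have "\<dots> \<le> norm L * norm w + 1 / 2 * norm s"
    using mult_right_mono[OF small[folded e_def], of "norm s"] by (simp add: algebra_simps)
  finally have s: "norm s \<le> 2 * norm L * norm w" by simp
  have PKs: "?P *v (K *v s) = K *v s"
    using sketch_proj_fixes_range[OF K, of S]
    by (simp add: s_def matrix_vector_mul_assoc matrix_mul_assoc)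
  define r where "r = w - ?P *v w"
  have "r = (mat 1 - ?P) *v (w - K *v s)"
    by (simp add: r_def matrix_vector_mult_diff_rdistrib matrix_vector_mult_diff_distrib PKs)
  then have "norm r \<le> norm (w - K *v s)" using norm_sketch_residual_le[OF K] by simp
  also have "\<dots> \<le> e * (2 * norm L * norm w)"
    using wKs mult_left_mono[OF s, of e] by (simp add: e_def)
  also have "\<dots> \<le> e * (2 * norm L * norm v)"
    unfolding w_def e_def by (intro mult_left_mono norm_sketch_proj_le[OF K']) auto
  finally have r: "norm r \<le> 2 * norm L * e * norm v" by (simp add: mult_ac)
  have "(norm w)\<^sup>2 = v \<bullet> w" by (simp add: w_def inner_sketch_proj_self[OF K'])
  also have "\<dots> = v \<bullet> (?P *v w) + v \<bullet> r" by (simp add: r_def inner_diff_right)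
  also have "\<dots> = (?P *v v) \<bullet> w + v \<bullet> r" by (simp add: inner_sketch_proj[OF K])
  also have "\<dots> \<le> norm (?P *v v) * norm w + norm v * norm r"
    by (intro add_mono norm_cauchy_schwarz)
  finally have split: "(norm w)\<^sup>2 \<le> norm (?P *v v) * norm w + norm v * norm r" .
  have young: "norm (?P *v v) * norm w \<le> ((norm (?P *v v))\<^sup>2 + (norm w)\<^sup>2) / 2"
    using sum_squares_bound[of "norm (?P *v v)" "norm w"] by simp
  have rest: "norm v * norm r \<le> 2 * (norm L * e * (norm v)\<^sup>2)"
    using mult_left_mono[OF r, of "norm v"] by (simp add: power2_eq_square mult_ac)
  have "a \<le> b + 4 * z" if "a \<le> x + y" "x \<le> (b + a) / 2" "y \<le> 2 * z" for a b x y z :: real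
    using that by simp
  from this[OF split young rest]
  have "(norm w)\<^sup>2 \<le> (norm (?P *v v))\<^sup>2 + 4 * norm L * e * (norm v)\<^sup>2"
    by (simp only: mult.assoc)
  then show ?thesis
    unfolding w_def e_def inner_sketch_proj_self[OF K] inner_sketch_proj_self[OF K'] .
qed

section \<open>The Lyapunov equation\<close>

text \<open>The arithmetic mean of the squares, in place of the product of the norms, is the form in which
  second moments of random vectors appear.\<close>

lemma spec_norm_le_quadratic:
  fixes A :: "real^'n^'m"
  assumes "\<And>x y. \<bar>x \<bullet> (A *v y)\<bar> \<le> r * (((norm x)\<^sup>2 + (norm y)\<^sup>2) / 2)"
  shows "spec_norm A \<le> r"
proof (rule spec_norm_le_bilinear)
  fix x :: "real^'m" and y :: "real^'n"
  show "\<bar>x \<bullet> (A *v y)\<bar> \<le> r * norm x * norm y"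
  proof (cases "x = 0 \<or> y = 0")
    case False
    then have "\<bar>(x /\<^sub>R norm x) \<bullet> (A *v (y /\<^sub>R norm y))\<bar> \<le> r"
      using assms[of "x /\<^sub>R norm x" "y /\<^sub>R norm y"] by simp
    then have "\<bar>x \<bullet> (A *v y)\<bar> / (norm x * norm y) \<le> r"
      by (simp add: matrix_vector_mult_scaleR abs_mult divide_inverse mult_ac)
    with False show ?thesis by (simp add: pos_divide_le_eq mult_ac)
  qed auto
qed

lemma spec_norm_lyapunov_term:
  "spec_norm (N ** X + X ** N) \<le> 2 * spec_norm N * spec_norm X"
  using spec_norm_triangle[of "N ** X" "X ** N"] spec_norm_mult[of N X] spec_norm_mult[of X N]
  by (simp add: mult_ac)

text \<open>The map \<open>X \<mapsto> N X + X N\<close> is a strict contraction of the spectral norm, so the linear map on the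
  left-hand side is injective, hence bijective in finite dimension.\<close>

lemma lyapunov_ex1:
  fixes N R :: "real^'n^'n"
  assumes "spec_norm N < 1 / 2"
  shows "\<exists>!X. X - N ** X - X ** N = R"
proof -
  let ?f = "\<lambda>X :: real^'n^'n. X - N ** X - X ** N"
  have lin: "linear ?f"
    using bounded_bilinear.bounded_linear_right[OF bounded_bilinear_matrix_mult, of N]
      bounded_bilinear.bounded_linear_left[OF bounded_bilinear_matrix_mult, of N]
    by (intro linear_compose_sub bounded_linear.linear[of "\<lambda>X. N ** X"]
        bounded_linear.linear[of "\<lambda>X. X ** N"] linear_ident) auto
  have "X = 0" if "?f X = 0" for X
  proof -
    have "X = N ** X + X ** N" using that by (simp add: algebra_simps)
    then have "spec_norm X \<le> 2 * spec_norm N * spec_norm X"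
      using spec_norm_lyapunov_term[of N X] by simp
    then have "(1 - 2 * spec_norm N) * spec_norm X \<le> 0" by (simp add: algebra_simps)
    then have "spec_norm X \<le> 0" using assms by (simp add: mult_le_0_iff)
    then show ?thesis using spec_norm_nonneg[of X] by (intro spec_norm_eq_0) simp
  qed
  then have inj: "inj ?f" using lin by (simp add: linear_injective_0)
  then have "surj ?f" using lin by (simp add: linear_injective_imp_surjective)
  then have "\<exists>X. R = ?f X" by (rule surjD)
  then obtain X where X: "R = ?f X" ..
  show ?thesis
  proof (rule ex1I[of _ X])
    show "?f X = R" using X by simp
    show "Y = X" if "?f Y = R" for Y using injD[OF inj, of Y X] that X by simp
  qed
qed

text \<open>From \<open>X = W + N X + X N\<close> the norm of \<open>X\<close> is at most that of \<open>W\<close> plus two thirds of itself.\<close>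

lemma lyapunov_norm_le:
  fixes N X W :: "real^'n^'n"
  assumes "spec_norm N \<le> 1 / 3" "X - N ** X - X ** N = W"
  shows "spec_norm X \<le> 3 * spec_norm W"
proof -
  have "X = W + (N ** X + X ** N)" by (simp add: assms(2)[symmetric])
  then have "spec_norm X \<le> spec_norm W + 2 * spec_norm N * spec_norm X"
    using spec_norm_triangle[of W "N ** X + X ** N"] spec_norm_lyapunov_term[of N X] by simp
  moreover have "spec_norm N * spec_norm X \<le> 1 / 3 * spec_norm X"
    using assms(1) by (intro mult_right_mono spec_norm_nonneg)
  ultimately show ?thesis by (simp add: mult_ac)
qed

text \<open>The vector \<open>v\<close> minimizes the quadratic form on the unit sphere. If \<open>p = E v - \<mu> v\<close> were nonzero,
  moving \<open>v\<close> a little in the direction of \<open>- p\<close> would lower the Rayleigh quotient.\<close>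

lemma symmetric_min_eigenvector:
  fixes E :: "real^'n^'n"
  assumes sym: "transpose E = E"
  obtains v \<mu> where "norm v = 1" "E *v v = \<mu> *\<^sub>R v" "\<And>u. \<mu> * (norm u)\<^sup>2 \<le> u \<bullet> (E *v u)"
proof -
  have "sphere 0 1 \<noteq> ({} :: (real^'n) set)" by simp
  moreover have "continuous_on (sphere 0 1) (\<lambda>u. u \<bullet> (E *v u))"
    by (intro continuous_intros)
  ultimately obtain v where v: "norm v = 1" "\<And>u. norm u = 1 \<Longrightarrow> v \<bullet> (E *v v) \<le> u \<bullet> (E *v u)"
    using continuous_attains_inf[OF compact_sphere, of "0::real^'n" 1 "\<lambda>u. u \<bullet> (E *v u)"]
    by (auto simp: dist_norm)
  define \<mu> where "\<mu> = v \<bullet> (E *v v)"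
  have low: "\<mu> * (norm u)\<^sup>2 \<le> u \<bullet> (E *v u)" for u
  proof (cases "u = 0")
    case False
    then have "\<mu> \<le> (u /\<^sub>R norm u) \<bullet> (E *v (u /\<^sub>R norm u))"
      unfolding \<mu>_def by (intro v) simp
    then have "\<mu> \<le> (u \<bullet> (E *v u)) / (norm u)\<^sup>2"
      by (simp add: matrix_vector_mult_scaleR divide_inverse power2_eq_square mult_ac)
    with False show ?thesis by (simp add: pos_le_divide_eq)
  qed auto
  define p where "p = E *v v - \<mu> *\<^sub>R v"
  define a where "a = p \<bullet> (E *v p) - \<mu> * (norm p)\<^sup>2"
  have vp: "v \<bullet> p = 0"
    using v(1) by (simp add: p_def inner_diff_right \<mu>_def dot_square_norm)
  have quad: "0 \<le> 2 * t * (norm p)\<^sup>2 + t\<^sup>2 * a" for t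
  proof -
    have Ev: "E *v v = p + \<mu> *\<^sub>R v" by (simp add: p_def)
    have pv: "p \<bullet> v = 0" using vp by (simp add: inner_commute)
    have 1: "p \<bullet> (E *v v) = (norm p)\<^sup>2"
      by (simp add: Ev inner_add_right pv dot_square_norm)
    have 2: "v \<bullet> (E *v p) = (norm p)\<^sup>2"
      using inner_matrix_vector[of v E p] vp by (simp add: sym Ev inner_add_left dot_square_norm)
    have "(norm (v + t *\<^sub>R p))\<^sup>2 = v \<bullet> v + t * t * (p \<bullet> p)"
      unfolding power2_norm_eq_inner by (simp add: inner_add_left inner_add_right vp pv)
    then have 3: "(norm (v + t *\<^sub>R p))\<^sup>2 = 1 + t\<^sup>2 * (norm p)\<^sup>2"
      using v(1) by (simp add: dot_square_norm power2_eq_square)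
    have "(v + t *\<^sub>R p) \<bullet> (E *v (v + t *\<^sub>R p))
        = \<mu> + t * (norm p)\<^sup>2 + t * ((norm p)\<^sup>2 + t * (p \<bullet> (E *v p)))"
      unfolding matrix_vector_right_distrib matrix_vector_mult_scaleR inner_add_left inner_add_right
        inner_scaleR_left inner_scaleR_right 1 2 \<mu>_def by (simp only: add_ac)
    with low[of "v + t *\<^sub>R p"]
    have "\<mu> * (1 + t\<^sup>2 * (norm p)\<^sup>2) \<le> \<mu> + t * (norm p)\<^sup>2 + t * ((norm p)\<^sup>2 + t * (p \<bullet> (E *v p)))"
      unfolding 3 by simp
    then show ?thesis unfolding a_def by (simp add: power2_eq_square algebra_simps)
  qed
  have a0: "0 \<le> a" using low[of p] by (simp add: a_def)
  have "p = 0"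
  proof (rule ccontr)
    assume "p \<noteq> 0"
    let ?q = "(norm p)\<^sup>2"
    have q: "?q > 0" using \<open>p \<noteq> 0\<close> by simp
    \<comment> \<open>for \<open>a > 0\<close> the quadratic in \<open>t\<close> is negative between \<open>- 2 * ?q / a\<close> and \<open>0\<close>; \<open>a + 1\<close> also covers \<open>a = 0\<close>\<close>
    define t where "t = - ?q / (a + 1)"
    have "t * a \<ge> - ?q"
      using a0 q by (simp add: t_def field_simps)
    have "2 * t * ?q + t\<^sup>2 * a = t * (2 * ?q + t * a)" by (simp add: power2_eq_square algebra_simps)
    also have "\<dots> < 0"
    proof (rule mult_neg_pos)
      show "t < 0" unfolding t_def using q a0 by (intro divide_neg_pos) auto
      show "0 < 2 * ?q + t * a" using \<open>t * a \<ge> - ?q\<close> q by linarith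
    qed
    finally show False using quad[of t] by simp
  qed
  then show thesis using that[of v \<mu>] v(1) low by (simp add: p_def)
qed

text \<open>Symmetry holds because the transpose of \<open>X\<close> solves the same equation. For positivity, pair the
  equation with an eigenvector \<open>v\<close> of the least eigenvalue \<open>\<mu>\<close> of \<open>X\<close>: this gives
  \<open>v \<bullet> (W v) = \<mu> (1 - 2 v \<bullet> (N v))\<close>, and the second factor is positive.\<close>

lemma lyapunov_psd:
  fixes N X W :: "real^'n^'n"
  assumes N: "transpose N = N" "spec_norm N < 1 / 2" and eq: "X - N ** X - X ** N = W"
    and W: "transpose W = W" "\<And>u. 0 \<le> u \<bullet> (W *v u)"
  shows "transpose X = X" "0 \<le> u \<bullet> (X *v u)"
proof -
  have "transpose X - N ** transpose X - transpose X ** N = W"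
  proof -
    have "transpose (X - N ** X - X ** N) = transpose X - transpose X ** N - N ** transpose X"
      by (simp add: transpose_diff matrix_transpose_mul N(1))
    then show ?thesis using eq W(1) by (simp add: diff_right_commute)
  qed
  with lyapunov_ex1[OF N(2), of W] eq show sym: "transpose X = X" by metis
  obtain v \<mu> where v: "norm v = 1" "X *v v = \<mu> *\<^sub>R v" "\<And>u. \<mu> * (norm u)\<^sup>2 \<le> u \<bullet> (X *v u)"
    using symmetric_min_eigenvector[OF sym] by metis
  have "v \<bullet> (W *v v) = \<mu> * (1 - 2 * (v \<bullet> (N *v v)))"
  proof -
    have "v \<bullet> (W *v v) = v \<bullet> (X *v v) - v \<bullet> (N *v (X *v v)) - v \<bullet> (X *v (N *v v))"
      by (simp add: eq[symmetric] matrix_vector_mult_diff_rdistrib inner_diff_right matrix_vector_mul_assoc)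
    also have "v \<bullet> (X *v (N *v v)) = (X *v v) \<bullet> (N *v v)"
      by (metis inner_matrix_vector sym)
    finally show ?thesis
      using v(1) by (simp add: v(2) matrix_vector_mult_scaleR dot_square_norm algebra_simps)
  qed
  moreover have "v \<bullet> (N *v v) < 1 / 2"
    using norm_cauchy_schwarz[of v "N *v v"] spec_norm_bound[of N v] N(2) v(1) by simp
  ultimately have "0 \<le> \<mu>" using W(2)[of v] by (simp add: zero_le_mult_iff)
  then have "0 \<le> \<mu> * (norm u)\<^sup>2" by simp
  then show "0 \<le> u \<bullet> (X *v u)" using v(3)[of u] by linarith
qed

section \<open>Moments of the random residual matrices\<close>

text \<open>A crude comparison of the two matrix norms, used only to derive integrability from boundedness.\<close>

lemma norm_le_spec_norm:
  fixes A :: "real^'n^'m"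
  shows "norm A \<le> real CARD('m) * (real CARD('n) * spec_norm A)"
proof -
  have "norm A \<le> (\<Sum>i\<in>UNIV. norm (A $ i))" unfolding norm_vec_def by (rule L2_set_le_sum) simp
  also have "\<dots> \<le> (\<Sum>i\<in>(UNIV :: 'm set). \<Sum>j\<in>(UNIV :: 'n set). spec_norm A)"
    by (intro sum_mono order_trans[OF norm_le_l1_cart] abs_component_le_spec_norm)
  finally show ?thesis by simp
qed

lemma integrable_bounded_matrix:
  fixes f :: "'a \<Rightarrow> real^'n^'m"
  assumes "finite_measure M" "f \<in> borel_measurable M" "\<And>w v. norm (f w *v v) \<le> norm v"
  shows "integrable M f"
proof -
  interpret finite_measure M by fact
  have "spec_norm (f w) \<le> 1" for w by (rule spec_norm_le) (simp add: assms(3))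
  then have "norm (f w) \<le> real CARD('m) * (real CARD('n) * 1)" for w
    by (intro order_trans[OF norm_le_spec_norm] mult_left_mono) auto
  then show ?thesis using assms(2) by (intro integrable_const_bound) auto
qed

lemma integral_matrix_mult_left:
  fixes f :: "'a \<Rightarrow> real^'n^'m"
  assumes "integrable M f"
  shows "(\<integral>w. A ** f w \<partial>M) = A ** (\<integral>w. f w \<partial>M)" "integrable M (\<lambda>w. A ** f w)"
  using integral_bounded_linear[OF bounded_bilinear.bounded_linear_right[OF bounded_bilinear_matrix_mult] assms]
    integrable_bounded_linear[OF bounded_bilinear.bounded_linear_right[OF bounded_bilinear_matrix_mult] assms]
  by auto

lemma integral_matrix_mult_right:
  fixes f :: "'a \<Rightarrow> real^'n^'m"
  assumes "integrable M f"
  shows "(\<integral>w. f w ** A \<partial>M) = (\<integral>w. f w \<partial>M) ** A" "integrable M (\<lambda>w. f w ** A)"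
  using integral_bounded_linear[OF bounded_bilinear.bounded_linear_left[OF bounded_bilinear_matrix_mult] assms]
    integrable_bounded_linear[OF bounded_bilinear.bounded_linear_left[OF bounded_bilinear_matrix_mult] assms]
  by auto

lemma integral_transpose:
  fixes f :: "'a \<Rightarrow> real^'n^'m"
  assumes "integrable M f"
  shows "(\<integral>w. transpose (f w) \<partial>M) = transpose (\<integral>w. f w \<partial>M)" "integrable M (\<lambda>w. transpose (f w))"
  using integral_bounded_linear[OF bounded_linear_transpose assms]
    integrable_bounded_linear[OF bounded_linear_transpose assms] by auto

lemma integral_quadratic:
  fixes f :: "'a \<Rightarrow> real^'n^'m"
  assumes "integrable M f"
  shows "(\<integral>w. x \<bullet> (f w *v y) \<partial>M) = x \<bullet> ((\<integral>w. f w \<partial>M) *v y)" "integrable M (\<lambda>w. x \<bullet> (f w *v y))"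
proof -
  have "bounded_linear (\<lambda>A :: real^'n^'m. x \<bullet> (A *v y))"
    by (intro bounded_linear_compose[OF bounded_linear_inner_right]
        bounded_bilinear.bounded_linear_left[OF bounded_bilinear_matrix_vector_mult])
  from integral_bounded_linear[OF this assms] integrable_bounded_linear[OF this assms]
  show "(\<integral>w. x \<bullet> (f w *v y) \<partial>M) = x \<bullet> ((\<integral>w. f w \<partial>M) *v y)" "integrable M (\<lambda>w. x \<bullet> (f w *v y))"
    by auto
qed

lemma integrable_sketch_proj_of_law:
  assumes "prob_space D" "sets D = sets borel" "transpose K = K"
  shows "integrable D (sketch_proj K)"
proof (rule integrable_bounded_matrix)
  show "finite_measure D" using assms(1) by (rule prob_space.finite_measure)
  have [measurable_cong]: "sets D = sets borel" by fact
  show "sketch_proj K \<in> borel_measurable D" by measurable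
qed (rule norm_sketch_proj_le[OF assms(3)])

lemma norm_residual_prod_le:
  assumes "transpose K = K"
  shows "norm (residual_prod K S j *v v) \<le> norm v"
    "norm (transpose (residual_prod K S j) *v v) \<le> norm v"
proof (induction j arbitrary: v)
  case (Suc j)
  have sym: "transpose (mat 1 - sketch_proj K (S j)) = mat 1 - sketch_proj K (S j)"
    by (simp add: transpose_diff transpose_sketch_proj[OF assms] transpose_mat)
  { case 1
    show ?case
      using order_trans[OF norm_sketch_residual_le[OF assms] Suc(1)]
      by (simp add: matrix_vector_mul_assoc[symmetric])
  next
    case 2
    show ?case
      using order_trans[OF Suc(2) norm_sketch_residual_le[OF assms]]
      by (simp add: matrix_transpose_mul sym matrix_vector_mul_assoc[symmetric]) }
qed (simp_all add: transpose_mat)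

lemma residual_prod_cong:
  "(\<And>i. i < j \<Longrightarrow> S i = S' i) \<Longrightarrow> residual_prod K S j = residual_prod K S' j"
  by (induction j) auto

text \<open>One fixed symmetric matrix \<open>K\<close> and a law of sketching matrices for which the expected projection
  is at least \<open>1 - \<rho>\<close>. It will be used at the KKT matrix of the solution.\<close>

locale sketch_distribution = prob_space D for D :: "(real^'s^'n) measure" +
  fixes K :: "real^'n^'n" and \<rho> :: real
  assumes sets_D: "sets D = sets borel"
    and K_sym: "transpose K = K"
    and proj_lower: "\<And>v. (1 - \<rho>) * (norm v)\<^sup>2 \<le> v \<bullet> ((\<integral>s. sketch_proj K s \<partial>D) *v v)"
begin

abbreviation law where "law \<equiv> sketch_law D"

definition mean_residual :: "real^'n^'n" where
  "mean_residual = mat 1 - (\<integral>s. sketch_proj K s \<partial>D)"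

lemma measurable_D [measurable_cong]: "sets D = sets borel" by (rule sets_D)

lemma integrable_sketch_proj: "integrable D (sketch_proj K)"
  by (intro integrable_sketch_proj_of_law prob_space_axioms sets_D K_sym)

lemma integrable_sketch_residual: "integrable D (\<lambda>s. mat 1 - sketch_proj K s)"
  using integrable_sketch_proj by simp

lemma integral_sketch_residual: "(\<integral>s. mat 1 - sketch_proj K s \<partial>D) = mean_residual"
  using integrable_sketch_proj by (simp add: mean_residual_def prob_space)

lemma transpose_sketch_residual: "transpose (mat 1 - sketch_proj K s) = mat 1 - sketch_proj K s"
  by (simp add: transpose_diff transpose_sketch_proj[OF K_sym] transpose_mat)

lemma transpose_mean_residual: "transpose mean_residual = mean_residual"
  using integral_transpose(1)[OF integrable_sketch_residual]
  by (simp add: transpose_sketch_residual integral_sketch_residual)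

text \<open>The complement of an orthogonal projection lowers the squared norm by exactly the quadratic form of
  the projection.\<close>

lemma expected_norm_sketch_residual:
  "integrable D (\<lambda>s. (norm ((mat 1 - sketch_proj K s) *v v))\<^sup>2)"
  "(\<integral>s. (norm ((mat 1 - sketch_proj K s) *v v))\<^sup>2 \<partial>D) \<le> \<rho> * (norm v)\<^sup>2"
proof -
  note q = integral_quadratic[OF integrable_sketch_proj, of v v]
  show "integrable D (\<lambda>s. (norm ((mat 1 - sketch_proj K s) *v v))\<^sup>2)"
    unfolding norm_sketch_residual[OF K_sym] using q(2) by simp
  have "(\<integral>s. (norm ((mat 1 - sketch_proj K s) *v v))\<^sup>2 \<partial>D)
      = (norm v)\<^sup>2 - v \<bullet> ((\<integral>s. sketch_proj K s \<partial>D) *v v)"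
    unfolding norm_sketch_residual[OF K_sym] using q by (simp add: prob_space)
  then show "(\<integral>s. (norm ((mat 1 - sketch_proj K s) *v v))\<^sup>2 \<partial>D) \<le> \<rho> * (norm v)\<^sup>2"
    using proj_lower[of v] by (simp add: algebra_simps)
qed

lemma rho_nonneg: "0 \<le> \<rho>"
proof -
  have "0 \<le> (\<integral>s. (norm ((mat 1 - sketch_proj K s) *v axis undefined 1))\<^sup>2 \<partial>D)"
    by simp
  also have "\<dots> \<le> \<rho>" using expected_norm_sketch_residual(2)[of "axis undefined 1"] by simp
  finally show ?thesis .
qed

text \<open>As \<open>I - P\<close> is a projection, \<open>x \<bullet> ((I - P) y)\<close> is the inner product of \<open>(I - P) x\<close> and \<open>(I - P) y\<close>,
  whose second moments are at most \<open>\<rho>\<close>. Applying Jensen's inequality to the norm of \<open>(I - P) v\<close>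
  would only give the square root of \<open>\<rho>\<close>.\<close>

lemma spec_norm_mean_residual: "spec_norm mean_residual \<le> \<rho>"
proof (rule spec_norm_le_quadratic)
  fix x y
  let ?r = "\<lambda>s v. (mat 1 - sketch_proj K s) *v v"
  note sq = expected_norm_sketch_residual
  have idem: "(mat 1 - sketch_proj K s) ** (mat 1 - sketch_proj K s) = mat 1 - sketch_proj K s" for s
    by (simp add: bounded_bilinear.diff_left[OF bounded_bilinear_matrix_mult]
        bounded_bilinear.diff_right[OF bounded_bilinear_matrix_mult] sketch_proj_idem[OF K_sym])
  have pt: "\<bar>x \<bullet> ?r s y\<bar> \<le> ((norm (?r s x))\<^sup>2 + (norm (?r s y))\<^sup>2) / 2" for s
  proof -
    have "x \<bullet> ?r s y = x \<bullet> ?r s (?r s y)" by (simp only: matrix_vector_mul_assoc idem)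
    also have "\<dots> = ?r s x \<bullet> ?r s y"
      using inner_matrix_vector[of x "mat 1 - sketch_proj K s" "?r s y"]
      by (simp only: transpose_sketch_residual)
    finally have "\<bar>x \<bullet> ?r s y\<bar> \<le> norm (?r s x) * norm (?r s y)"
      by (simp only: Cauchy_Schwarz_ineq2)
    then show ?thesis using sum_squares_bound[of "norm (?r s x)" "norm (?r s y)"] by simp
  qed
  have "\<bar>x \<bullet> (mean_residual *v y)\<bar> = \<bar>\<integral>s. x \<bullet> ?r s y \<partial>D\<bar>"
    by (simp only: integral_quadratic(1)[OF integrable_sketch_residual] integral_sketch_residual)
  also have "\<dots> \<le> (\<integral>s. \<bar>x \<bullet> ?r s y\<bar> \<partial>D)" by (rule integral_abs_bound)
  also have "\<dots> \<le> (\<integral>s. ((norm (?r s x))\<^sup>2 + (norm (?r s y))\<^sup>2) / 2 \<partial>D)"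
    using sq(1) integral_quadratic(2)[OF integrable_sketch_residual, of x y] pt
    by (intro integral_mono) (auto simp del: divide_const_simps)
  also have "\<dots> = ((\<integral>s. (norm (?r s x))\<^sup>2 \<partial>D) + (\<integral>s. (norm (?r s y))\<^sup>2 \<partial>D)) / 2"
    using sq(1) by simp
  also have "\<dots> \<le> \<rho> * (((norm x)\<^sup>2 + (norm y)\<^sup>2) / 2)"
    using sq(2)[of x] sq(2)[of y] by (simp add: algebra_simps)
  finally show "\<bar>x \<bullet> (mean_residual *v y)\<bar> \<le> \<rho> * (((norm x)\<^sup>2 + (norm y)\<^sup>2) / 2)" .
qed

lemma prob_space_law: "prob_space (law j)"
  unfolding sketch_law_def by (intro prob_space_PiM prob_space_axioms)

sublocale product_prob_space "\<lambda>_::nat. D" by standard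

lemma measurable_residual_prod [measurable]: "(\<lambda>S. residual_prod K S j) \<in> borel_measurable (law j)"
proof -
  have "(\<lambda>S. residual_prod K S i) \<in> borel_measurable (law j)" if "i \<le> j" for i
    using that
  proof (induction i)
    case (Suc i)
    then have [measurable]: "(\<lambda>S. residual_prod K S i) \<in> borel_measurable (law j)" by simp
    have "(\<lambda>S. S i) \<in> measurable (law j) D"
      unfolding sketch_law_def using Suc by (intro measurable_component_singleton) simp
    then have [measurable]: "(\<lambda>S. S i) \<in> borel_measurable (law j)"
      using measurable_cong_sets[OF refl sets_D] by blast
    show ?case by simp measurable
  qed simp
  then show ?thesis by simp
qed

lemma integrable_residual_prod: "integrable (law j) (\<lambda>S. residual_prod K S j)"
  by (intro integrable_bounded_matrix norm_residual_prod_le K_sym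
      prob_space.finite_measure[OF prob_space_law]) measurable

text \<open>The newest factor depends on the last sketching matrix alone, so Fubini splits it off.\<close>

lemma expected_residual_prod_Suc:
  "(\<integral>S. residual_prod K S (Suc j) \<partial>law (Suc j)) = mean_residual ** (\<integral>S. residual_prod K S j \<partial>law j)"
proof -
  have eq: "residual_prod K (S(j := s)) (Suc j) = (mat 1 - sketch_proj K s) ** residual_prod K S j" for S s
    using residual_prod_cong[of j "S(j := s)" S K] by simp
  have "(\<integral>S. residual_prod K S (Suc j) \<partial>law (Suc j))
      = (\<integral>S. (\<integral>s. residual_prod K (S(j := s)) (Suc j) \<partial>D) \<partial>law j)"
    using integrable_residual_prod[of "Suc j"] unfolding sketch_law_def lessThan_Suc
    by (intro product_integral_insert) auto
  also have "\<dots> = (\<integral>S. mean_residual ** residual_prod K S j \<partial>law j)"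
    by (simp only: eq integral_matrix_mult_right[OF integrable_sketch_residual] integral_sketch_residual)
  finally show ?thesis by (simp only: integral_matrix_mult_left[OF integrable_residual_prod])
qed

lemma expected_residual_prod_0: "(\<integral>S. residual_prod K S 0 \<partial>law 0) = mat 1"
  using prob_space.prob_space[OF prob_space_law[of 0]] by simp

text \<open>The expectation is the \<open>j\<close>-th power of the symmetric matrix \<open>mean_residual\<close>; it is symmetric because
  it commutes with that matrix.\<close>

lemma expected_residual_prod:
  "transpose (\<integral>S. residual_prod K S j \<partial>law j) = (\<integral>S. residual_prod K S j \<partial>law j)"
  "spec_norm (\<integral>S. residual_prod K S j \<partial>law j) \<le> \<rho> ^ j"
proof -
  let ?N = "\<lambda>j. \<integral>S. residual_prod K S j \<partial>law j"
  have comm: "?N j ** mean_residual = mean_residual ** ?N j" for j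
    by (induction j) (simp_all only: expected_residual_prod_0 expected_residual_prod_Suc
        matrix_mul_lid matrix_mul_rid matrix_mul_assoc[symmetric])
  show "transpose (?N j) = ?N j"
    by (induction j) (simp_all only: expected_residual_prod_0 expected_residual_prod_Suc
        matrix_transpose_mul transpose_mean_residual comm transpose_mat)
  show "spec_norm (?N j) \<le> \<rho> ^ j"
  proof (induction j)
    case 0
    have "spec_norm (mat 1 :: real^'n^'n) \<le> 1" by (rule spec_norm_le) simp
    then show ?case by (simp only: expected_residual_prod_0 power_0)
  next
    case (Suc j)
    have "spec_norm (?N (Suc j)) \<le> spec_norm mean_residual * spec_norm (?N j)"
      unfolding expected_residual_prod_Suc by (rule spec_norm_mult)
    also have "\<dots> \<le> \<rho> * \<rho> ^ j"
      by (intro mult_mono spec_norm_mean_residual Suc spec_norm_nonneg rho_nonneg)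
    finally show ?case by simp
  qed
qed

text \<open>The transposed product applies the newest factor first. So the earlier sketching matrices are
  integrated out first, by the induction hypothesis at the vector \<open>(I - P) u\<close>, and the newest one
  afterwards; each contributes a factor \<open>\<rho>\<close>.\<close>

lemma nn_second_moment:
  "(\<integral>\<^sup>+S. ennreal ((norm (transpose (residual_prod K S j) *v u))\<^sup>2) \<partial>law j) \<le> ennreal (\<rho> ^ j * (norm u)\<^sup>2)"
proof (induction j arbitrary: u)
  case 0
  show ?case using prob_space.emeasure_space_1[OF prob_space_law[of 0]] by (simp add: transpose_mat)
next
  case (Suc j)
  have eq: "transpose (residual_prod K (S(j := s)) (Suc j)) *v u
      = transpose (residual_prod K S j) *v ((mat 1 - sketch_proj K s) *v u)" for S s
    using residual_prod_cong[of j "S(j := s)" S K]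
    by (simp add: matrix_transpose_mul transpose_sketch_residual matrix_vector_mul_assoc)
  have "(\<lambda>S. ennreal ((norm (transpose (residual_prod K S (Suc j)) *v u))\<^sup>2)) \<in> borel_measurable (law (Suc j))"
    by measurable
  then have "(\<integral>\<^sup>+S. ennreal ((norm (transpose (residual_prod K S (Suc j)) *v u))\<^sup>2) \<partial>law (Suc j))
      = (\<integral>\<^sup>+s. (\<integral>\<^sup>+S. ennreal ((norm (transpose (residual_prod K (S(j := s)) (Suc j)) *v u))\<^sup>2) \<partial>law j) \<partial>D)"
    unfolding sketch_law_def lessThan_Suc by (intro product_nn_integral_insert_rev) auto
  also have "\<dots> \<le> (\<integral>\<^sup>+s. ennreal (\<rho> ^ j * (norm ((mat 1 - sketch_proj K s) *v u))\<^sup>2) \<partial>D)"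
    unfolding eq by (intro nn_integral_mono Suc)
  also have "\<dots> = ennreal (\<rho> ^ j * (\<integral>s. (norm ((mat 1 - sketch_proj K s) *v u))\<^sup>2 \<partial>D))"
    using expected_norm_sketch_residual(1)[of u] rho_nonneg
    by (subst nn_integral_eq_integral) auto
  also have "\<dots> \<le> ennreal (\<rho> ^ Suc j * (norm u)\<^sup>2)"
    using mult_left_mono[OF expected_norm_sketch_residual(2)[of u], of "\<rho> ^ j"] rho_nonneg
    by (intro ennreal_leI) (simp add: mult_ac)
  finally show ?case .
qed

lemma second_moment:
  "integrable (law j) (\<lambda>S. (norm (transpose (residual_prod K S j) *v u))\<^sup>2)"
  "(\<integral>S. (norm (transpose (residual_prod K S j) *v u))\<^sup>2 \<partial>law j) \<le> \<rho> ^ j * (norm u)\<^sup>2"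
proof -
  show *: "integrable (law j) (\<lambda>S. (norm (transpose (residual_prod K S j) *v u))\<^sup>2)"
    using nn_second_moment[of j u]
    by (intro integrableI_bounded) (auto intro: le_less_trans)
  show "(\<integral>S. (norm (transpose (residual_prod K S j) *v u))\<^sup>2 \<partial>law j) \<le> \<rho> ^ j * (norm u)\<^sup>2"
    using nn_second_moment[of j u] rho_nonneg by (subst (asm) nn_integral_eq_integral[OF *]) auto
qed

text \<open>With \<open>\<Pi>\<close> the residual product and \<open>N\<close> its expectation, \<open>A = I / 2 - N\<close>, so the equation for \<open>X\<close> reads
  \<open>X - N X - X N = \<Omega> - N \<Omega> - \<Omega> N + W\<close> with \<open>W\<close> the expectation of \<open>\<Pi> \<Omega> \<Pi>\<^sup>T\<close>. Subtracting \<open>\<Omega>\<close> leaves the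
  Lyapunov equation with right-hand side \<open>W\<close> for \<open>X - \<Omega>\<close>. Here \<open>W\<close> is positive semidefinite, and its
  norm is at most \<open>\<rho> ^ j\<close> times that of \<open>\<Omega>\<close> by the second moments of \<open>\<Pi>\<^sup>T u\<close>.\<close>

lemma limiting_covariance_bounds:
  fixes \<Omega> :: "real^'n^'n"
  assumes \<Omega>: "transpose \<Omega> = \<Omega>" "\<And>v. 0 \<le> v \<bullet> (\<Omega> *v v)" and small: "\<rho> ^ j < 1 / 3"
    and A: "A = (1 / 2) *\<^sub>R mat 1 + (\<integral>S. C_tilde K j S \<partial>law j)"
  shows "\<exists>!X. A ** X + X ** A = (\<integral>S. (mat 1 + C_tilde K j S) ** \<Omega> ** transpose (mat 1 + C_tilde K j S) \<partial>law j)"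
      (is "\<exists>!X. _ = ?R")
    and "A ** X + X ** A = (\<integral>S. (mat 1 + C_tilde K j S) ** \<Omega> ** transpose (mat 1 + C_tilde K j S) \<partial>law j)
      \<Longrightarrow> \<Omega> \<preceq> X \<and> spec_norm (X - \<Omega>) \<le> 3 * \<rho> ^ j * spec_norm \<Omega>"
proof -
  interpret L: prob_space "law j" by (rule prob_space_law)
  let ?\<Pi> = "\<lambda>S. residual_prod K S j"
  define N where "N = (\<integral>S. ?\<Pi> S \<partial>law j)"
  define W where "W = (\<integral>S. ?\<Pi> S ** \<Omega> ** transpose (?\<Pi> S) \<partial>law j)"
  note N = expected_residual_prod[of j, folded N_def]
  have N_small: "spec_norm N < 1 / 2" "spec_norm N \<le> 1 / 3" using N(2) small by auto
  have intW: "integrable (law j) (\<lambda>S. ?\<Pi> S ** \<Omega> ** transpose (?\<Pi> S))"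
  proof (rule L.integrable_const_bound)
    have "spec_norm (?\<Pi> S ** \<Omega> ** transpose (?\<Pi> S)) \<le> spec_norm \<Omega>" for S
    proof (rule spec_norm_le)
      fix v
      have "norm (?\<Pi> S ** \<Omega> ** transpose (?\<Pi> S) *v v) \<le> norm (\<Omega> *v (transpose (?\<Pi> S) *v v))"
        using norm_residual_prod_le(1)[OF K_sym] by (simp only: matrix_vector_mul_assoc[symmetric])
      also have "\<dots> \<le> spec_norm \<Omega> * norm (transpose (?\<Pi> S) *v v)" by (rule spec_norm_bound)
      also have "\<dots> \<le> spec_norm \<Omega> * norm v"
        by (intro mult_left_mono norm_residual_prod_le(2) K_sym spec_norm_nonneg)
      finally show "norm (?\<Pi> S ** \<Omega> ** transpose (?\<Pi> S) *v v) \<le> spec_norm \<Omega> * norm v" .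
    qed
    then show "AE S in law j. norm (?\<Pi> S ** \<Omega> ** transpose (?\<Pi> S)) \<le> real CARD('n) * (real CARD('n) * spec_norm \<Omega>)"
      by (intro AE_I2 order_trans[OF norm_le_spec_norm] mult_left_mono) auto
  qed measurable
  have AX: "A ** X + X ** A = X - N ** X - X ** N" for X
  proof -
    have "A = (1 / 2) *\<^sub>R mat 1 - N" by (simp add: A C_tilde_def N_def)
    then show ?thesis
      by (simp add: bounded_bilinear.diff_left[OF bounded_bilinear_matrix_mult]
        bounded_bilinear.diff_right[OF bounded_bilinear_matrix_mult]
        bounded_bilinear.scaleR_left[OF bounded_bilinear_matrix_mult]
        bounded_bilinear.scaleR_right[OF bounded_bilinear_matrix_mult] scaleR_2[symmetric])
  qed
  have R: "?R = \<Omega> - N ** \<Omega> - \<Omega> ** N + W"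
  proof -
    have exp: "(mat 1 + C_tilde K j S) ** \<Omega> ** transpose (mat 1 + C_tilde K j S)
        = \<Omega> - ?\<Pi> S ** \<Omega> - \<Omega> ** transpose (?\<Pi> S) + ?\<Pi> S ** \<Omega> ** transpose (?\<Pi> S)" for S
      by (simp add: C_tilde_def transpose_diff transpose_mat
        bounded_bilinear.diff_left[OF bounded_bilinear_matrix_mult]
        bounded_bilinear.diff_right[OF bounded_bilinear_matrix_mult])
    have i1: "integrable (law j) (\<lambda>S. ?\<Pi> S ** \<Omega>)"
      by (rule integral_matrix_mult_right[OF integrable_residual_prod])
    have i2: "integrable (law j) (\<lambda>S. \<Omega> ** transpose (?\<Pi> S))"
      by (rule integral_matrix_mult_left[OF integral_transpose(2)[OF integrable_residual_prod]])
    have e1: "(\<integral>S. ?\<Pi> S ** \<Omega> \<partial>law j) = N ** \<Omega>"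
      unfolding N_def by (rule integral_matrix_mult_right[OF integrable_residual_prod])
    have e2: "(\<integral>S. \<Omega> ** transpose (?\<Pi> S) \<partial>law j) = \<Omega> ** N"
      by (simp only: integral_matrix_mult_left[OF integral_transpose(2)[OF integrable_residual_prod]]
          integral_transpose(1)[OF integrable_residual_prod] N_def[symmetric] N(1))
    show ?thesis
      unfolding exp using i1 i2 intW by (simp add: e1 e2 W_def L.prob_space)
  qed
  show "\<exists>!X. A ** X + X ** A = ?R" unfolding AX by (rule lyapunov_ex1[OF N_small(1)])
  assume "A ** X + X ** A = ?R"
  then have eq: "(X - \<Omega>) - N ** (X - \<Omega>) - (X - \<Omega>) ** N = W"
    unfolding AX R by (simp add: bounded_bilinear.diff_left[OF bounded_bilinear_matrix_mult]
        bounded_bilinear.diff_right[OF bounded_bilinear_matrix_mult] algebra_simps)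
  have quad: "x \<bullet> (?\<Pi> S ** \<Omega> ** transpose (?\<Pi> S) *v y)
      = (transpose (?\<Pi> S) *v x) \<bullet> (\<Omega> *v (transpose (?\<Pi> S) *v y))" for x y S
    using inner_matrix_vector[of x "?\<Pi> S"] by (simp only: matrix_vector_mul_assoc[symmetric])
  have "transpose W = W"
    using integral_transpose(1)[OF intW]
    by (simp add: W_def matrix_transpose_mul \<Omega>(1) matrix_mul_assoc)
  moreover have "0 \<le> u \<bullet> (W *v u)" for u
    unfolding W_def integral_quadratic(1)[OF intW, symmetric] quad
    by (intro integral_nonneg_AE AE_I2 \<Omega>)
  ultimately have "\<Omega> \<preceq> X"
    using lyapunov_psd[OF N(1) N_small(1) eq] by (simp add: loewner_le_def)
  moreover have "spec_norm W \<le> spec_norm \<Omega> * \<rho> ^ j"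
  proof (rule spec_norm_le_quadratic)
    fix x y
    let ?n = "\<lambda>S v. norm (transpose (?\<Pi> S) *v v)"
    have pt: "\<bar>x \<bullet> (?\<Pi> S ** \<Omega> ** transpose (?\<Pi> S) *v y)\<bar> \<le> spec_norm \<Omega> * (((?n S x)\<^sup>2 + (?n S y)\<^sup>2) / 2)" for S
    proof -
      have "\<bar>x \<bullet> (?\<Pi> S ** \<Omega> ** transpose (?\<Pi> S) *v y)\<bar> \<le> ?n S x * (spec_norm \<Omega> * ?n S y)"
        unfolding quad by (intro order_trans[OF Cauchy_Schwarz_ineq2] mult_left_mono spec_norm_bound) simp
      also have "\<dots> = spec_norm \<Omega> * (?n S x * ?n S y)" by simp
      also have "\<dots> \<le> spec_norm \<Omega> * (((?n S x)\<^sup>2 + (?n S y)\<^sup>2) / 2)"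
        using sum_squares_bound[of "?n S x" "?n S y"] by (intro mult_left_mono spec_norm_nonneg) simp
      finally show ?thesis .
    qed
    have int: "integrable (law j) (\<lambda>S. spec_norm \<Omega> * (((?n S x)\<^sup>2 + (?n S y)\<^sup>2) / 2))"
      using second_moment(1)[of j x] second_moment(1)[of j y] by simp
    have "\<bar>x \<bullet> (W *v y)\<bar> \<le> (\<integral>S. \<bar>x \<bullet> (?\<Pi> S ** \<Omega> ** transpose (?\<Pi> S) *v y)\<bar> \<partial>law j)"
      unfolding W_def integral_quadratic(1)[OF intW, symmetric] by (rule integral_abs_bound)
    also have "\<dots> \<le> (\<integral>S. spec_norm \<Omega> * (((?n S x)\<^sup>2 + (?n S y)\<^sup>2) / 2) \<partial>law j)"
      by (intro integral_mono pt int integrable_abs integral_quadratic(2)[OF intW])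
    also have "\<dots> = spec_norm \<Omega> * (((\<integral>S. (?n S x)\<^sup>2 \<partial>law j) + (\<integral>S. (?n S y)\<^sup>2 \<partial>law j)) / 2)"
      using second_moment(1)[of j x] second_moment(1)[of j y] by simp
    also have "\<dots> \<le> spec_norm \<Omega> * ((\<rho> ^ j * (norm x)\<^sup>2 + \<rho> ^ j * (norm y)\<^sup>2) / 2)"
      by (intro mult_left_mono divide_right_mono add_mono second_moment(2) spec_norm_nonneg) simp
    finally show "\<bar>x \<bullet> (W *v y)\<bar> \<le> spec_norm \<Omega> * \<rho> ^ j * (((norm x)\<^sup>2 + (norm y)\<^sup>2) / 2)"
      by (simp add: distrib_left mult.assoc)
  qed
  then have "spec_norm (X - \<Omega>) \<le> 3 * \<rho> ^ j * spec_norm \<Omega>"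
    using lyapunov_norm_le[OF N_small(2) eq] by (simp add: mult_ac)
  ultimately show "\<Omega> \<preceq> X \<and> spec_norm (X - \<Omega>) \<le> 3 * \<rho> ^ j * spec_norm \<Omega>" by simp
qed

end

section \<open>Gradients and Hessians\<close>

lemma gradientI:
  assumes "(f has_derivative (\<lambda>h. g \<bullet> h)) (at x)" shows "gradient f x = g"
  using frechet_derivative_at[OF assms, symmetric]
  by (simp add: gradient_def vec_eq_iff inner_axis)

lemma has_derivative_gradient:
  assumes "f differentiable (at x)" shows "(f has_derivative (\<lambda>h. gradient f x \<bullet> h)) (at x)"
proof -
  obtain f' where f': "(f has_derivative f') (at x)" using assms by (auto simp: differentiable_def)
  have lin: "linear f'" using f' by (rule has_derivative_linear)
  have "f' h = gradient f x \<bullet> h" for h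
  proof -
    have "f' h = f' (\<Sum>i\<in>UNIV. h $ i *\<^sub>R axis i 1)"
      using basis_expansion[of h] by (simp add: scalar_mult_eq_scaleR)
    also have "\<dots> = (\<Sum>i\<in>UNIV. h $ i * f' (axis i 1))"
      by (simp add: linear_sum[OF lin] linear_cmul[OF lin])
    also have "\<dots> = gradient f x \<bullet> h"
      by (simp add: gradient_def frechet_derivative_at[OF f', symmetric] inner_vec_def mult.commute)
    finally show ?thesis .
  qed
  then show ?thesis using f' by (metis (no_types, lifting) ext)
qed

lemma hessianI:
  assumes "(gradient f has_derivative (\<lambda>h. H *v h)) (at x)" shows "hessian f x = H"
  unfolding hessian_def jacobian_def frechet_derivative_at[OF assms, symmetric]
  by (rule matrix_of_matrix_vector_mul)

lemma has_derivative_hessian: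
  assumes "gradient f differentiable (at x)"
  shows "(gradient f has_derivative (\<lambda>h. hessian f x *v h)) (at x)"
  using assms jacobian_works unfolding hessian_def by blast

lemma C2_onE:
  assumes "C2_on f X"
  obtains U where "open U" "X \<subseteq> U"
    "\<And>y. y \<in> U \<Longrightarrow> (f has_derivative (\<lambda>h. gradient f y \<bullet> h)) (at y)"
    "\<And>y. y \<in> U \<Longrightarrow> (gradient f has_derivative (\<lambda>h. hessian f y *v h)) (at y)"
    "continuous_on U (hessian f)"
proof -
  obtain U where U: "open U" "X \<subseteq> U" "f differentiable_on U" "gradient f differentiable_on U"
    "continuous_on U (hessian f)"
    using assms by (auto simp: C2_on_def)
  then show thesis
    by (intro that[of U] has_derivative_gradient has_derivative_hessian)
       (auto simp: differentiable_on_eq_differentiable_at)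
qed

lemma C2_on_continuous_gradient: "C2_on f X \<Longrightarrow> continuous_on X (gradient f)"
  by (elim C2_onE) (meson continuous_at_imp_continuous_on has_derivative_continuous subsetD)

lemma C2_on_continuous: "C2_on f X \<Longrightarrow> continuous_on X f"
  by (elim C2_onE) (meson continuous_at_imp_continuous_on has_derivative_continuous subsetD)

lemma C2_on_continuous_hessian: "C2_on f X \<Longrightarrow> continuous_on X (hessian f)"
  by (elim C2_onE) (meson continuous_on_subset)

text \<open>The mean value theorem in the direction \<open>u\<close> turns the second difference into \<open>t\<close> times the change of
  \<open>g \<bullet> u\<close> under a shift by \<open>t v\<close>; the first-order expansion of \<open>g\<close> at \<open>a\<close> evaluates that change.\<close>

lemma second_difference_expansion:
  fixes f :: "real^'n \<Rightarrow> real"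
  assumes U: "open U" "a \<in> U" and f: "\<And>y. y \<in> U \<Longrightarrow> (f has_derivative (\<lambda>h. g y \<bullet> h)) (at y)"
    and g: "(g has_derivative (\<lambda>h. H *v h)) (at a)" and "e > 0"
  shows "\<exists>\<delta>>0. \<forall>t. 0 < t \<and> t < \<delta> \<longrightarrow>
    \<bar>(f (a + t *\<^sub>R u + t *\<^sub>R v) - f (a + t *\<^sub>R u) - f (a + t *\<^sub>R v) + f a) - t\<^sup>2 * (u \<bullet> (H *v v))\<bar>
      \<le> 2 * e * t\<^sup>2 * (norm u + norm v)\<^sup>2"
proof -
  obtain r where r: "r > 0" "ball a r \<subseteq> U" using U by (meson openE)
  obtain d where d: "d > 0" "\<And>y. norm (y - a) < d \<Longrightarrow> norm (g y - g a - H *v (y - a)) \<le> e * norm (y - a)"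
    using g \<open>e > 0\<close> unfolding has_derivative_at_alt by blast
  define s where "s = norm u + norm v"
  \<comment> \<open>the \<open>+ 1\<close> avoids a division by zero when \<open>u\<close> and \<open>v\<close> both vanish\<close>
  define \<delta> where "\<delta> = min r d / (s + 1)"
  have s0: "0 \<le> s" by (simp add: s_def)
  have "\<delta> > 0" using r d s0 by (simp add: \<delta>_def)
  moreover have "\<bar>(f (a + t *\<^sub>R u + t *\<^sub>R v) - f (a + t *\<^sub>R u) - f (a + t *\<^sub>R v) + f a) - t\<^sup>2 * (u \<bullet> (H *v v))\<bar>
      \<le> 2 * e * t\<^sup>2 * s\<^sup>2" if t: "0 < t" "t < \<delta>" for t
  proof -
    have small: "t * s < min r d"
    proof -
      have "t * s \<le> t * (s + 1)" using t by simp
      also have "\<dots> < \<delta> * (s + 1)" using t s0 by (intro mult_strict_right_mono) auto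
      also have "\<dots> = min r d" using s0 by (simp add: \<delta>_def)
      finally show ?thesis .
    qed
    have n: "norm (\<sigma> *\<^sub>R u + \<theta> *\<^sub>R v) \<le> t * s" if "0 \<le> \<sigma>" "\<sigma> \<le> t" "0 \<le> \<theta>" "\<theta> \<le> t" for \<sigma> \<theta>
    proof -
      have "norm (\<sigma> *\<^sub>R u + \<theta> *\<^sub>R v) \<le> \<sigma> * norm u + \<theta> * norm v"
        using norm_triangle_ineq[of "\<sigma> *\<^sub>R u" "\<theta> *\<^sub>R v"] that by simp
      also have "\<dots> \<le> t * norm u + t * norm v" using that by (intro add_mono mult_right_mono) auto
      finally show ?thesis by (simp add: s_def algebra_simps)
    qed
    have inU: "a + \<sigma> *\<^sub>R u + \<theta> *\<^sub>R v \<in> U" if "0 \<le> \<sigma>" "\<sigma> \<le> t" "0 \<le> \<theta>" "\<theta> \<le> t" for \<sigma> \<theta>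
      using n[OF that] small r(2) by (auto simp: subset_iff dist_norm norm_minus_commute add.assoc)
    have gr: "norm (g (a + \<sigma> *\<^sub>R u + \<theta> *\<^sub>R v) - g a - H *v (\<sigma> *\<^sub>R u + \<theta> *\<^sub>R v)) \<le> e * (t * s)"
      if "0 \<le> \<sigma>" "\<sigma> \<le> t" "0 \<le> \<theta>" "\<theta> \<le> t" for \<sigma> \<theta>
    proof -
      have "norm (g (a + \<sigma> *\<^sub>R u + \<theta> *\<^sub>R v) - g a - H *v (\<sigma> *\<^sub>R u + \<theta> *\<^sub>R v))
          \<le> e * norm (\<sigma> *\<^sub>R u + \<theta> *\<^sub>R v)"
        using d(2)[of "a + \<sigma> *\<^sub>R u + \<theta> *\<^sub>R v"] n[OF that] small by (simp add: add.assoc)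
      also have "\<dots> \<le> e * (t * s)" using n[OF that] \<open>e > 0\<close> by (intro mult_left_mono) auto
      finally show ?thesis .
    qed
    have der: "((\<lambda>\<sigma>. f (a + \<sigma> *\<^sub>R u + \<theta> *\<^sub>R v)) has_field_derivative g (a + \<sigma> *\<^sub>R u + \<theta> *\<^sub>R v) \<bullet> u) (at \<sigma>)"
      if "0 \<le> \<sigma>" "\<sigma> \<le> t" "0 \<le> \<theta>" "\<theta> \<le> t" for \<sigma> \<theta>
    proof -
      have "((\<lambda>\<sigma>. a + \<sigma> *\<^sub>R u + \<theta> *\<^sub>R v) has_derivative (\<lambda>h. h *\<^sub>R u)) (at \<sigma>)"
        by (auto intro!: derivative_eq_intros)
      from has_derivative_compose[OF this f[OF inU[OF that]]]
      show ?thesis by (simp add: has_field_derivative_def mult.commute fun_eq_iff[symmetric])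
          (simp add: mult.commute[of _ "g _ \<bullet> u"])
    qed
    let ?\<phi> = "\<lambda>\<sigma>. f (a + \<sigma> *\<^sub>R u + t *\<^sub>R v) - f (a + \<sigma> *\<^sub>R u + 0 *\<^sub>R v)"
    have "\<exists>z>0. z < t \<and> ?\<phi> t - ?\<phi> 0 = (t - 0) * (g (a + z *\<^sub>R u + t *\<^sub>R v) \<bullet> u - g (a + z *\<^sub>R u + 0 *\<^sub>R v) \<bullet> u)"
      using t by (intro MVT2 DERIV_diff der) auto
    then obtain z where z: "0 < z" "z < t"
      "?\<phi> t - ?\<phi> 0 = t * (g (a + z *\<^sub>R u + t *\<^sub>R v) \<bullet> u - g (a + z *\<^sub>R u + 0 *\<^sub>R v) \<bullet> u)" by auto
    define p where "p = g (a + z *\<^sub>R u + t *\<^sub>R v) - g a - H *v (z *\<^sub>R u + t *\<^sub>R v)"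
    define q where "q = g (a + z *\<^sub>R u + 0 *\<^sub>R v) - g a - H *v (z *\<^sub>R u + 0 *\<^sub>R v)"
    have pq: "norm p \<le> e * (t * s)" "norm q \<le> e * (t * s)"
      unfolding p_def q_def using z t by (intro gr; simp)+
    have "p - q = g (a + z *\<^sub>R u + t *\<^sub>R v) - g (a + z *\<^sub>R u + 0 *\<^sub>R v) - t *\<^sub>R (H *v v)"
      by (simp add: p_def q_def matrix_vector_right_distrib matrix_vector_mult_scaleR)
    then have incr: "g (a + z *\<^sub>R u + t *\<^sub>R v) \<bullet> u - g (a + z *\<^sub>R u + 0 *\<^sub>R v) \<bullet> u = t * (u \<bullet> (H *v v)) + (p - q) \<bullet> u"
      by (simp add: inner_diff_left inner_commute[of u])
    have "?\<phi> t - ?\<phi> 0 - t\<^sup>2 * (u \<bullet> (H *v v)) = t * ((p - q) \<bullet> u)"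
      unfolding z(3) incr by (simp add: power2_eq_square distrib_left)
    then have "\<bar>?\<phi> t - ?\<phi> 0 - t\<^sup>2 * (u \<bullet> (H *v v))\<bar> = t * \<bar>(p - q) \<bullet> u\<bar>" using t by (simp add: abs_mult)
    also have "\<dots> \<le> t * ((norm p + norm q) * norm u)"
      using t by (intro mult_left_mono order_trans[OF Cauchy_Schwarz_ineq2] mult_right_mono norm_triangle_ineq4) auto
    also have "\<dots> \<le> t * ((e * (t * s) + e * (t * s)) * s)"
      using t pq \<open>e > 0\<close> s0 by (intro mult_left_mono mult_mono add_mono) (auto simp: s_def)
    also have "\<dots> = 2 * e * t\<^sup>2 * s\<^sup>2" by (simp add: power2_eq_square algebra_simps)
    finally show ?thesis by simp
  qed
  ultimately show ?thesis unfolding s_def by blast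
qed

text \<open>Schwarz's theorem: the second difference is symmetric in the two directions, so its two expansions
  agree.\<close>

lemma transpose_hessian:
  fixes f :: "real^'n \<Rightarrow> real"
  assumes "C2_on f X" "a \<in> X"
  shows "transpose (hessian f a) = hessian f a"
proof -
  let ?H = "hessian f a"
  obtain U where U: "open U" "X \<subseteq> U"
    "\<And>y. y \<in> U \<Longrightarrow> (f has_derivative (\<lambda>h. gradient f y \<bullet> h)) (at y)"
    "\<And>y. y \<in> U \<Longrightarrow> (gradient f has_derivative (\<lambda>h. hessian f y *v h)) (at y)"
    using assms(1) by (rule C2_onE) blast
  have a: "a \<in> U" using assms U by auto
  have sym: "u \<bullet> (?H *v v) = v \<bullet> (?H *v u)" for u v
  proof -
    have "\<bar>u \<bullet> (?H *v v) - v \<bullet> (?H *v u)\<bar> \<le> 0 + \<epsilon>" if "\<epsilon> > 0" for \<epsilon>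
    proof -
      define s where "s = (norm u + norm v)\<^sup>2"
      define e where "e = \<epsilon> / (4 * (s + 1))"
      have s: "0 \<le> s" by (simp add: s_def)
      have e: "e > 0" using that s by (simp add: e_def)
      let ?D = "\<lambda>t. f (a + t *\<^sub>R u + t *\<^sub>R v) - f (a + t *\<^sub>R u) - f (a + t *\<^sub>R v) + f a"
      obtain d1 where d1: "d1 > 0" "\<And>t. 0 < t \<Longrightarrow> t < d1 \<Longrightarrow> \<bar>?D t - t\<^sup>2 * (u \<bullet> (?H *v v))\<bar> \<le> 2 * e * t\<^sup>2 * s"
        using second_difference_expansion[OF U(1) a U(3) U(4)[OF a] e, of u v] unfolding s_def by blast
      obtain d2 where d2: "d2 > 0" "\<And>t. 0 < t \<Longrightarrow> t < d2 \<Longrightarrow>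
          \<bar>(f (a + t *\<^sub>R v + t *\<^sub>R u) - f (a + t *\<^sub>R v) - f (a + t *\<^sub>R u) + f a) - t\<^sup>2 * (v \<bullet> (?H *v u))\<bar>
            \<le> 2 * e * t\<^sup>2 * (norm v + norm u)\<^sup>2"
        using second_difference_expansion[OF U(1) a U(3) U(4)[OF a] e, of v u] by blast
      define t where "t = min d1 d2 / 2"
      have t: "0 < t" "t < d1" "t < d2" using d1(1) d2(1) by (auto simp: t_def)
      have swap: "f (a + t *\<^sub>R v + t *\<^sub>R u) - f (a + t *\<^sub>R v) - f (a + t *\<^sub>R u) + f a = ?D t"
        by (simp add: algebra_simps)
      have "(norm v + norm u)\<^sup>2 = s" by (simp add: s_def add.commute)
      then have "\<bar>?D t - t\<^sup>2 * (v \<bullet> (?H *v u))\<bar> \<le> 2 * e * t\<^sup>2 * s"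
        using d2(2)[OF t(1,3)] unfolding swap by simp
      with d1(2)[OF t(1,2)]
      have "\<bar>t\<^sup>2 * (u \<bullet> (?H *v v)) - t\<^sup>2 * (v \<bullet> (?H *v u))\<bar> \<le> 4 * e * t\<^sup>2 * s" by linarith
      then have "t\<^sup>2 * \<bar>u \<bullet> (?H *v v) - v \<bullet> (?H *v u)\<bar> \<le> t\<^sup>2 * (4 * e * s)"
        by (simp add: right_diff_distrib[symmetric] abs_mult mult_ac)
      then have "\<bar>u \<bullet> (?H *v v) - v \<bullet> (?H *v u)\<bar> \<le> 4 * e * s" using t by simp
      also have "\<dots> \<le> 4 * e * (s + 1)" using e by simp
      also have "\<dots> = \<epsilon>" using s by (simp add: e_def field_simps)
      finally show ?thesis by simp
    qed
    then have "\<bar>u \<bullet> (?H *v v) - v \<bullet> (?H *v u)\<bar> \<le> 0" by (rule field_le_epsilon)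
    then show ?thesis by simp
  qed
  show ?thesis
  proof (rule matrix_eqI_inner)
    fix u v
    have "u \<bullet> (transpose ?H *v v) = v \<bullet> (?H *v u)"
      using inner_matrix_vector[of u "transpose ?H" v] by (simp add: inner_commute)
    then show "u \<bullet> (transpose ?H *v v) = u \<bullet> (?H *v v)" using sym[of u v] by simp
  qed
qed

lemma jacobian_component:
  fixes c :: "real^'n \<Rightarrow> real^'m"
  assumes "\<And>i. (\<lambda>y. c y $ i) differentiable (at x)"
  shows "jacobian c (at x) = (\<chi> i. gradient (\<lambda>y. c y $ i) x)"
proof -
  have "(c has_derivative (\<lambda>h. (\<chi> i. gradient (\<lambda>y. c y $ i) x) *v h)) (at x)"
    unfolding has_derivative_componentwise_within[of c _ x UNIV]
    by (auto simp: Basis_vec_def inner_axis matrix_vector_mul_component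
        intro!: has_derivative_gradient assms)
  from frechet_derivative_at[OF this, symmetric] show ?thesis
    by (simp add: jacobian_def)
qed

lemma C2_on_differentiable: "C2_on f X \<Longrightarrow> x \<in> X \<Longrightarrow> f differentiable (at x)"
  by (elim C2_onE) (auto simp: differentiable_def)

lemma continuous_on_jacobian:
  fixes c :: "real^'n \<Rightarrow> real^'m"
  assumes "\<And>i. C2_on (\<lambda>y. c y $ i) X"
  shows "continuous_on X (\<lambda>y. jacobian c (at y))"
proof -
  have "continuous_on X (\<lambda>y. \<chi> i. gradient (\<lambda>y. c y $ i) y)"
    by (intro continuous_on_vec_lambda C2_on_continuous_gradient assms)
  moreover have "jacobian c (at y) = (\<chi> i. gradient (\<lambda>y. c y $ i) y)" if "y \<in> X" for y
    using assms that by (intro jacobian_component) (blast intro: C2_on_differentiable)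
  ultimately show ?thesis by (subst continuous_on_cong[OF refl]) auto
qed

text \<open>The Hessian is the derivative of the gradient, so the gradient of the Lagrangian has to be computed
  on a whole neighbourhood; \<open>T\<close> is one on which \<open>f\<close> and all constraints are smooth.\<close>

lemma lagrangian_hess_x_eq:
  fixes f :: "real^'n \<Rightarrow> real" and c :: "real^'n \<Rightarrow> real^'m"
  assumes f: "C2_on f X" and c: "\<And>i. C2_on (\<lambda>y. c y $ i) X" and x: "x \<in> X"
  shows "lagrangian_hess_x f c x l =
    hessian f x + (\<Sum>i\<in>UNIV. (l $ i) *\<^sub>R hessian (\<lambda>y. c y $ i) x)"
proof -
  let ?L = "\<lambda>y. lagrangian f c y l"
  obtain U where U: "open U" "X \<subseteq> U"
    "\<And>y. y \<in> U \<Longrightarrow> (f has_derivative (\<lambda>h. gradient f y \<bullet> h)) (at y)"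
    "\<And>y. y \<in> U \<Longrightarrow> (gradient f has_derivative (\<lambda>h. hessian f y *v h)) (at y)"
    using f by (rule C2_onE) blast
  have "\<exists>V. open V \<and> X \<subseteq> V \<and>
    (\<forall>y\<in>V. ((\<lambda>y. c y $ i) has_derivative (\<lambda>h. gradient (\<lambda>y. c y $ i) y \<bullet> h)) (at y)) \<and>
    (\<forall>y\<in>V. (gradient (\<lambda>y. c y $ i) has_derivative (\<lambda>h. hessian (\<lambda>y. c y $ i) y *v h)) (at y))" for i
    using c[of i] by (rule C2_onE) blast
  then obtain V where V: "\<And>i. open (V i)" "\<And>i. X \<subseteq> V i"
    "\<And>i y. y \<in> V i \<Longrightarrow> ((\<lambda>y. c y $ i) has_derivative (\<lambda>h. gradient (\<lambda>y. c y $ i) y \<bullet> h)) (at y)"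
    "\<And>i y. y \<in> V i \<Longrightarrow> (gradient (\<lambda>y. c y $ i) has_derivative (\<lambda>h. hessian (\<lambda>y. c y $ i) y *v h)) (at y)"
    by metis
  define T where "T = U \<inter> (\<Inter>i. V i)"
  have T: "open T" "x \<in> T" 
    unfolding T_def using subsetD[OF U(2) x] subsetD[OF V(2) x]
    by (auto intro!: open_Int U(1) open_INT V(1))
  let ?g = "\<lambda>y. gradient f y + (\<Sum>i\<in>UNIV. (l $ i) *\<^sub>R gradient (\<lambda>y. c y $ i) y)"
  have grad: "gradient ?L y = ?g y" if "y \<in> T" for y
  proof (rule gradientI)
    have "((\<lambda>y. f y + (\<Sum>i\<in>UNIV. l $ i * c y $ i)) has_derivative
      (\<lambda>h. gradient f y \<bullet> h + (\<Sum>i\<in>UNIV. l $ i * (gradient (\<lambda>y. c y $ i) y \<bullet> h)))) (at y)"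
      using that by (intro has_derivative_add has_derivative_sum has_derivative_mult_right U V)
        (auto simp: T_def)
    then show "(?L has_derivative (\<lambda>h. ?g y \<bullet> h)) (at y)"
      by (simp add: lagrangian_def inner_vec_def[of l] inner_add_left inner_sum_left)
  qed
  show ?thesis unfolding lagrangian_hess_x_def
  proof (rule hessianI)
    have "(?g has_derivative (\<lambda>h. hessian f x *v h + (\<Sum>i\<in>UNIV. (l $ i) *\<^sub>R (hessian (\<lambda>y. c y $ i) x *v h)))) (at x)"
      using T by (intro has_derivative_add has_derivative_sum has_derivative_scaleR_right U V)
        (auto simp: T_def)
    then have "(gradient ?L has_derivative (\<lambda>h. hessian f x *v h + (\<Sum>i\<in>UNIV. (l $ i) *\<^sub>R (hessian (\<lambda>y. c y $ i) x *v h)))) (at x)"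
      by (rule has_derivative_transform_within_open[OF _ T]) (simp add: grad)
    moreover have "(hessian f x + (\<Sum>i\<in>UNIV. (l $ i) *\<^sub>R hessian (\<lambda>y. c y $ i) x)) *v h
      = hessian f x *v h + (\<Sum>i\<in>UNIV. (l $ i) *\<^sub>R (hessian (\<lambda>y. c y $ i) x *v h))" for h
      by (simp add: bounded_bilinear.add_left[OF bounded_bilinear_matrix_vector_mult]
          bounded_bilinear.sum_left[OF bounded_bilinear_matrix_vector_mult]
          bounded_bilinear.scaleR_left[OF bounded_bilinear_matrix_vector_mult])
    ultimately show "(gradient ?L has_derivative
      (\<lambda>h. (hessian f x + (\<Sum>i\<in>UNIV. (l $ i) *\<^sub>R hessian (\<lambda>y. c y $ i) x)) *v h)) (at x)"
      by simp
  qed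
qed

section \<open>KKT matrices\<close>

lemma joint_primal_dual: "joint (primal v) (dual v) = v"
  by (auto simp: joint_def primal_def dual_def vec_eq_iff split: sum.split)

lemma primal_joint [simp]: "primal (joint y l) = y" and dual_joint [simp]: "dual (joint y l) = l"
  by (simp_all add: joint_def primal_def dual_def vec_eq_iff)

lemma sum_UNIV_Plus:
  fixes f :: "'a::finite + 'b::finite \<Rightarrow> 'c::comm_monoid_add"
  shows "(\<Sum>k\<in>UNIV. f k) = (\<Sum>i\<in>UNIV. f (Inl i)) + (\<Sum>j\<in>UNIV. f (Inr j))"
  using sum.Plus[of "UNIV :: 'a set" "UNIV :: 'b set" f] by (simp add: UNIV_Plus_UNIV comp_def)

lemma kkt_mult_joint: "kkt B G *v joint y l = joint (B *v y + transpose G *v l) (G *v y)"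
  by (auto simp: kkt_def joint_def vec_eq_iff matrix_vector_mult_def sum_UNIV_Plus transpose_def
      split: sum.split)

lemma transpose_kkt: "transpose (kkt B G) = kkt (transpose B) G"
  by (auto simp: kkt_def transpose_def vec_eq_iff split: sum.split)

text \<open>Linearity in the pair of blocks yields both continuity and measurability.\<close>

lemma bounded_linear_kkt:
  "bounded_linear (\<lambda>(B, G). kkt B G :: real^('d::finite + 'm::finite)^('d + 'm))"
  unfolding linear_conv_bounded_linear[symmetric]
  by (rule linearI) (auto simp: kkt_def vec_eq_iff split: sum.split)

lemma tendsto_kkt:
  assumes "(B \<longlongrightarrow> B0) F" "(G \<longlongrightarrow> G0) F"
  shows "((\<lambda>w. kkt (B w) (G w)) \<longlongrightarrow> kkt B0 G0) F"
  using bounded_linear.tendsto[OF bounded_linear_kkt tendsto_Pair[OF assms]] by simp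

lemma borel_measurable_kkt:
  assumes "B \<in> borel_measurable M" "G \<in> borel_measurable M"
  shows "(\<lambda>w. kkt (B w) (G w)) \<in> borel_measurable M"
proof -
  have "(\<lambda>w. (\<lambda>(B, G). kkt B G) (B w, G w)) \<in> borel_measurable M"
    by (intro measurable_compose[OF borel_measurable_Pair[OF assms]] borel_measurable_continuous_onI
        bounded_linear.continuous_on[OF bounded_linear_kkt] continuous_intros)
  then show ?thesis by simp
qed

text \<open>If the matrix annihilates \<open>(v, l)\<close>, then \<open>G v = 0\<close> and pairing the first block with \<open>v\<close> gives
  \<open>v \<bullet> (H v) = 0\<close>, so \<open>v = 0\<close>; what remains is \<open>G\<^sup>T l = 0\<close>, and \<open>G\<^sup>T\<close> is injective by the full row rank.\<close>

lemma kkt_left_inverse: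
  fixes H :: "real^'d^'d" and G :: "real^'d^'m"
  assumes rank: "rank G = CARD('m)"
    and pos: "\<And>v. v \<noteq> 0 \<Longrightarrow> G *v v = 0 \<Longrightarrow> v \<bullet> (H *v v) > 0"
  shows "\<exists>L. L ** kkt H G = mat 1"
  unfolding matrix_left_invertible_ker
proof (intro allI impI)
  fix z assume "kkt H G *v z = 0"
  then have "joint (H *v primal z + transpose G *v dual z) (G *v primal z) = 0"
    using kkt_mult_joint[of H G "primal z" "dual z"] by (simp add: joint_primal_dual)
  from this[THEN arg_cong[of _ _ primal]] this[THEN arg_cong[of _ _ dual]]
  have 1: "H *v primal z + transpose G *v dual z = 0" and 2: "G *v primal z = 0"
    by (simp_all only: primal_joint dual_joint) (simp_all add: primal_def dual_def vec_eq_iff)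
  have "primal z \<bullet> (transpose G *v dual z) = 0"
    using inner_matrix_vector[of "primal z" "transpose G" "dual z"] 2 by simp
  then have "primal z \<bullet> (H *v primal z) = 0"
    using arg_cong[OF 1, of "\<lambda>v. primal z \<bullet> v"] by (simp add: inner_add_right)
  then have p: "primal z = 0" using pos[of "primal z"] 2 by force
  then have G: "transpose G *v dual z = 0" using 1 by simp
  obtain u where u: "dual z = G *v u" using rank unfolding full_rank_surjective by (metis surjD)
  then have "G *v u = 0" using G matrix_gram_cancel[of G u] by simp
  then have "z = joint 0 0" using p u joint_primal_dual[of z] by simp
  also have "\<dots> = 0" by (auto simp: joint_def vec_eq_iff split: sum.split)
  finally show "z = 0" .
qed

section \<open>The noise covariance\<close>

lemma covariance_symmetric_psd:
  fixes Y :: "'p \<Rightarrow> real^'n"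
  shows "transpose (covariance P Y) = covariance P Y" "0 \<le> v \<bullet> (covariance P Y *v v)"
proof -
  let ?c = "\<lambda>p. Y p - (\<integral>q. Y q \<partial>P)"
  let ?f = "\<lambda>p. (\<chi> i j. ?c p $ i * ?c p $ j)"
  have "transpose (covariance P Y) = covariance P Y \<and> 0 \<le> v \<bullet> (covariance P Y *v v)"
  \<comment> \<open>without second moments the Bochner integral is \<open>0\<close> by convention, which is symmetric and positive semidefinite as well\<close>
  proof (cases "integrable P ?f")
    case True
    have tr: "transpose (?f p) = ?f p" for p by (simp add: transpose_def vec_eq_iff mult.commute)
    have sq: "v \<bullet> (?f p *v v) = (?c p \<bullet> v)\<^sup>2" for p
      by (simp add: inner_vec_def matrix_vector_mult_def power2_eq_square sum_product
          sum_distrib_left algebra_simps)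
    have "0 \<le> v \<bullet> ((\<integral>p. ?f p \<partial>P) *v v)"
      unfolding integral_quadratic(1)[OF True, symmetric] sq by simp
    then show ?thesis unfolding covariance_def using integral_transpose(1)[OF True] by (simp only: tr)
  next
    case False
    then show ?thesis unfolding covariance_def by (simp add: not_integrable_integral_eq)
  qed
  then show "transpose (covariance P Y) = covariance P Y" "0 \<le> v \<bullet> (covariance P Y *v v)" by auto
qed

lemma block_diag0_mult: "block_diag0 A *v v = joint (A *v primal v) 0"
  by (auto simp: block_diag0_def joint_def primal_def vec_eq_iff matrix_vector_mult_def
      sum_UNIV_Plus split: sum.split)

lemma transpose_block_diag0: "transpose (block_diag0 A) = block_diag0 (transpose A)"
  by (auto simp: block_diag0_def transpose_def vec_eq_iff split: sum.split)

lemma inner_joint: "v \<bullet> joint y l = primal v \<bullet> y + dual v \<bullet> l"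
  by (simp add: inner_vec_def joint_def primal_def dual_def sum_UNIV_Plus)

lemma transpose_matrix_inv:
  fixes K :: "real^'n^'n"
  assumes "transpose K = K" "L ** K = mat 1"
  shows "transpose (matrix_inv K) = matrix_inv K"
proof -
  have "K ** L = mat 1" using assms(2) by (simp add: matrix_left_right_inverse)
  then have "\<exists>J. K ** J = mat 1 \<and> J ** K = mat 1" using assms(2) by blast
  then have "K ** matrix_inv K = mat 1 \<and> matrix_inv K ** K = mat 1"
    unfolding matrix_inv_def by (rule someI_ex)
  then have inv: "K ** matrix_inv K = mat 1" "matrix_inv K ** K = mat 1" by auto
  have "transpose (matrix_inv K) ** K = mat 1"
    by (metis assms(1) inv(1) matrix_transpose_mul transpose_mat)
  then have "transpose (matrix_inv K) ** (K ** matrix_inv K) = matrix_inv K"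
    by (simp add: matrix_mul_assoc)
  then show ?thesis by (simp add: inv)
qed

lemma Omega_star_symmetric_psd:
  fixes c :: "real^'d \<Rightarrow> real^'m"
  assumes "transpose (K_star P F c xs ls) = K_star P F c xs ls" "L ** K_star P F c xs ls = mat 1"
  shows "transpose (Omega_star P F c xs ls) = Omega_star P F c xs ls"
    "0 \<le> v \<bullet> (Omega_star P F c xs ls *v v)"
proof -
  define J where "J = matrix_inv (K_star P F c xs ls)"
  define D :: "real^('d + 'm)^('d + 'm)"
    where "D = block_diag0 (covariance P (\<lambda>p. gradient (\<lambda>y. F y p) xs))"
  have J: "transpose J = J" unfolding J_def using assms by (rule transpose_matrix_inv)
  have D: "transpose D = D" "0 \<le> u \<bullet> (D *v u)" for u
    by (simp_all add: D_def transpose_block_diag0 covariance_symmetric_psd block_diag0_mult inner_joint)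
  have Om: "Omega_star P F c xs ls = J ** D ** J" by (simp add: Omega_star_def J_def D_def)
  show "transpose (Omega_star P F c xs ls) = Omega_star P F c xs ls"
    by (simp add: Om matrix_transpose_mul J D matrix_mul_assoc)
  have "v \<bullet> (J *v (D *v (J *v v))) = (J *v v) \<bullet> (D *v (J *v v))"
    using inner_matrix_vector[of v J "D *v (J *v v)"] by (simp only: J)
  then show "0 \<le> v \<bullet> (Omega_star P F c xs ls *v v)"
    using D(2)[of "J *v v"] by (simp add: Om matrix_vector_mul_assoc[symmetric])
qed

section \<open>Averages\<close>

lemma cesaro_mean:
  fixes a :: "nat \<Rightarrow> 'a::real_normed_vector"
  assumes a: "a \<longlonglongrightarrow> l"
  shows "(\<lambda>n. (1 / real n) *\<^sub>R (\<Sum>i<n. a i)) \<longlonglongrightarrow> l"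
proof (rule LIMSEQ_I)
  fix e :: real assume "0 < e"
  obtain C where C: "C > 0" "\<And>i. norm (a i - l) \<le> C"
    using convergent_imp_Bseq[of "\<lambda>i. a i - l"] a LIM_zero[OF a]
    by (auto simp: Bseq_def convergent_def)
  obtain N where N: "\<And>i. i \<ge> N \<Longrightarrow> norm (a i - l) < e / 2"
    using LIMSEQ_D[OF a, of "e / 2"] \<open>0 < e\<close> by auto
  obtain m where m: "2 * real N * C / e < real m" using reals_Archimedean2 by blast
  have "norm ((1 / real n) *\<^sub>R (\<Sum>i<n. a i) - l) < e" if n: "n \<ge> max (Suc N) m" for n
  proof -
    have n0: "real n > 0" using n by simp
    have "(1 / real n) *\<^sub>R (\<Sum>i<n. a i) - l = (1 / real n) *\<^sub>R (\<Sum>i<n. a i - l)"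
      using n0 by (simp add: sum_subtractf scaleR_diff_right sum_constant_scaleR)
    also have "norm \<dots> \<le> (1 / real n) * (\<Sum>i<n. norm (a i - l))"
      using n0 by (simp add: norm_sum divide_right_mono)
    also have "(\<Sum>i<n. norm (a i - l)) \<le> (\<Sum>i<n. (if i < N then C else 0) + e / 2)"
      using C N \<open>0 < e\<close> by (intro sum_mono) (auto simp: not_less less_imp_le intro: add_increasing2)
    also have "\<dots> = real N * C + real n * (e / 2)"
    proof -
      have "{i. i < n \<and> i < N} = {..<N}" using n by auto
      then have "{..<n} \<inter> {i. i < N} = {..<N}" by auto
      then show ?thesis by (simp add: sum.distrib sum.If_cases)
    qed
    finally have "norm ((1 / real n) *\<^sub>R (\<Sum>i<n. a i) - l) \<le> (1 / real n) * (real N * C + real n * (e / 2))"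
      using n0 by (simp add: divide_right_mono)
    also have "\<dots> = real N * C / real n + e / 2" using n0 by (simp add: field_simps)
    also have "real N * C / real n < e / 2"
    proof -
      have "2 * real N * C / e < real n" using m n by simp
      then show ?thesis using n0 \<open>0 < e\<close> by (simp add: field_simps)
    qed
    finally show ?thesis by simp
  qed
  then show "\<exists>no. \<forall>n\<ge>no. norm ((1 / real n) *\<^sub>R (\<Sum>i<n. a i) - l) < e" by blast
qed

lemma integrable_mult_of_squares:
  fixes f g :: "'a \<Rightarrow> real"
  assumes [measurable]: "f \<in> borel_measurable M" "g \<in> borel_measurable M"
    and "integrable M (\<lambda>w. (f w)\<^sup>2)" "integrable M (\<lambda>w. (g w)\<^sup>2)"
  shows "integrable M (\<lambda>w. f w * g w)"
proof (rule Bochner_Integration.integrable_bound)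
  show "integrable M (\<lambda>w. (f w)\<^sup>2 + (g w)\<^sup>2)" using assms by simp
  have "\<bar>f w * g w\<bar> \<le> (f w)\<^sup>2 + (g w)\<^sup>2" for w
    using sum_squares_bound[of "\<bar>f w\<bar>" "\<bar>g w\<bar>"] abs_ge_zero[of "f w * g w"]
    unfolding abs_mult power2_abs by linarith
  then show "AE w in M. norm (f w * g w) \<le> norm ((f w)\<^sup>2 + (g w)\<^sup>2)" by simp
qed measurable

text \<open>Each increment is orthogonal to the partial sum before it, so all cross terms vanish and the second
  moment of the sum grows linearly.\<close>

lemma orthogonal_increments_second_moment:
  fixes N :: "nat \<Rightarrow> 'a \<Rightarrow> real"
  assumes meas: "\<And>t. N t \<in> borel_measurable M" and sq: "\<And>t. integrable M (\<lambda>w. (N t w)\<^sup>2)"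
    and C: "\<And>t. (\<integral>w. (N t w)\<^sup>2 \<partial>M) \<le> C"
    and orth: "\<And>t. integrable M (\<lambda>w. (\<Sum>i<t. N i w)\<^sup>2) \<Longrightarrow> (\<integral>w. (\<Sum>i<t. N i w) * N t w \<partial>M) = 0"
  shows "integrable M (\<lambda>w. (\<Sum>i<t. N i w)\<^sup>2) \<and> (\<integral>w. (\<Sum>i<t. N i w)\<^sup>2 \<partial>M) \<le> real t * C"
proof (induction t)
  case (Suc t)
  let ?S = "\<lambda>w. \<Sum>i<t. N i w"
  have S: "?S \<in> borel_measurable M" using meas by (intro borel_measurable_sum) auto
  have cross: "integrable M (\<lambda>w. ?S w * N t w)"
    using Suc sq[of t] by (intro integrable_mult_of_squares S meas) auto
  have exp: "(\<Sum>i<Suc t. N i w)\<^sup>2 = (?S w)\<^sup>2 + 2 * (?S w * N t w) + (N t w)\<^sup>2" for w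
    by (simp add: power2_sum)
  have int: "integrable M (\<lambda>w. (\<Sum>i<Suc t. N i w)\<^sup>2)"
    unfolding exp using Suc cross sq[of t] by simp
  have "(\<integral>w. (\<Sum>i<Suc t. N i w)\<^sup>2 \<partial>M)
      = (\<integral>w. (?S w)\<^sup>2 \<partial>M) + 2 * (\<integral>w. ?S w * N t w \<partial>M) + (\<integral>w. (N t w)\<^sup>2 \<partial>M)"
    unfolding exp using Suc cross sq[of t] by simp
  then show ?case using int Suc orth[of t] C[of t] by (simp add: algebra_simps)
qed simp

section \<open>Measurability of the iterates\<close>

lemma bounded_linear_joint: "bounded_linear (\<lambda>(y, l). joint y l :: real^('d::finite + 'm::finite))"
  unfolding linear_conv_bounded_linear[symmetric]
  by (rule linearI) (auto simp: joint_def vec_eq_iff split: sum.split)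

lemma bounded_linear_primal: "bounded_linear (primal :: real^('d::finite + 'm::finite) \<Rightarrow> real^'d)"
  unfolding linear_conv_bounded_linear[symmetric]
  by (rule linearI) (auto simp: primal_def vec_eq_iff)

lemma bounded_linear_dual: "bounded_linear (dual :: real^('d::finite + 'm::finite) \<Rightarrow> real^'m)"
  unfolding linear_conv_bounded_linear[symmetric]
  by (rule linearI) (auto simp: dual_def vec_eq_iff)

lemma borel_measurable_joint:
  assumes "f \<in> borel_measurable M" "g \<in> borel_measurable M"
  shows "(\<lambda>w. joint (f w) (g w)) \<in> borel_measurable M"
proof -
  have "(\<lambda>w. (\<lambda>(y, l). joint y l) (f w, g w)) \<in> borel_measurable M"
    by (intro measurable_compose[OF borel_measurable_Pair[OF assms]] borel_measurable_continuous_onI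
        bounded_linear.continuous_on[OF bounded_linear_joint] continuous_intros)
  then show ?thesis by simp
qed

lemma borel_measurable_sketch_iter:
  assumes [measurable]: "K \<in> borel_measurable M" "g \<in> borel_measurable M"
    and S: "\<And>j. j < \<tau> \<Longrightarrow> S j \<in> borel_measurable M"
  shows "(\<lambda>w. sketch_iter (K w) (g w) (\<lambda>j. S j w) \<tau>) \<in> borel_measurable M"
proof -
  have "(\<lambda>w. sketch_iter (K w) (g w) (\<lambda>j. S j w) i) \<in> borel_measurable M" if "i \<le> \<tau>" for i
    using that
  proof (induction i)
    case (Suc i)
    then have [measurable]: "(\<lambda>w. sketch_iter (K w) (g w) (\<lambda>j. S j w) i) \<in> borel_measurable M"
      "S i \<in> borel_measurable M" using S by auto
    show ?case by simp measurable
  qed simp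
  then show ?thesis by simp
qed

lemma sets_vimage_algebra_Pow: "sets (vimage_algebra X f N) \<subseteq> Pow X"
  using sets.space_closed[of "vimage_algebra X f N"] by simp

context sketched_stosqp
begin

lemma space_past [simp]: "space (past t) = space M"
  by (simp add: past_def space_measure_of_conv)

definition past_generators :: "nat \<Rightarrow> 'w set set" where
  "past_generators i = sets (vimage_algebra (space M) (\<xi> i) P) \<union>
     (\<Union>j<\<tau>. sets (vimage_algebra (space M) (S i j) borel)) \<union>
     sets (vimage_algebra (space M) (\<alpha> i) borel)"

lemma past_generators_Pow: "past_generators i \<subseteq> Pow (space M)"
  unfolding past_generators_def by (intro Un_least UN_least sets_vimage_algebra_Pow)

lemma sets_past: "sets (past t) = sigma_sets (space M) (\<Union>i<t. past_generators i)"
proof -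
  have "(\<Union>i<t. past_generators i) \<subseteq> Pow (space M)" using past_generators_Pow by blast
  then show ?thesis unfolding past_def past_generators_def by (rule sets_measure_of)
qed

lemma past_generators_sets: "past_generators i \<subseteq> sets M"
  unfolding past_generators_def
  by (intro Un_least UN_least sets_image_in_sets[OF refl] sample_measurable stepsize_measurable
      sketch_measurable) simp

lemma subalgebra_past: "subalgebra M (past t)"
proof -
  have "(\<Union>i<t. past_generators i) \<subseteq> sets M" using past_generators_sets by blast
  then have "sets (past t) \<subseteq> sets M" unfolding sets_past by (rule sets.sigma_sets_subset)
  then show ?thesis by (simp add: subalgebra_def)
qed

lemma subalgebra_past_mono:
  assumes "s \<le> t" shows "subalgebra (past t) (past s)"
proof -
  have "(\<Union>i<s. past_generators i) \<subseteq> (\<Union>i<t. past_generators i)"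
    using assms by (intro UN_mono) auto
  then have "sets (past s) \<subseteq> sets (past t)" unfolding sets_past by (rule sigma_sets_mono')
  then show ?thesis by (simp add: subalgebra_def)
qed

lemma past_generators_subset: "i < t \<Longrightarrow> past_generators i \<subseteq> sets (past t)"
  unfolding sets_past by (intro subsetI sigma_sets.Basic) auto

lemma measurable_past:
  assumes "i < t"
  shows "\<xi> i \<in> measurable (past t) P" "\<alpha> i \<in> borel_measurable (past t)"
    "j < \<tau> \<Longrightarrow> S i j \<in> borel_measurable (past t)"
proof -
  have gen: "f \<in> measurable (past t) N"
    if "f \<in> space M \<rightarrow> space N" "sets (vimage_algebra (space M) f N) \<subseteq> past_generators i"
    for f :: "'w \<Rightarrow> 'z" and N
  proof (rule measurable_from_subalg[OF _ measurable_vimage_algebra1[OF that(1)]])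
    show "subalgebra (past t) (vimage_algebra (space M) f N)"
      using that(2) past_generators_subset[OF assms] by (auto simp: subalgebra_def)
  qed
  show "\<xi> i \<in> measurable (past t) P"
    using measurable_space[OF sample_measurable] by (intro gen) (auto simp: past_generators_def)
  show "\<alpha> i \<in> borel_measurable (past t)"
    by (intro gen) (auto simp: past_generators_def)
  show "S i j \<in> borel_measurable (past t)" if "j < \<tau>"
    using that by (intro gen) (auto simp: past_generators_def)
qed

lemma x_in: "\<omega> \<in> space M \<Longrightarrow> x t \<omega> \<in> X" and lam_in: "\<omega> \<in> space M \<Longrightarrow> lam t \<omega> \<in> \<Lambda>"
  using iterates_in[of \<omega> t] by simp_all

text \<open>The \<open>\<sigma>\<close>-algebra \<open>Q\<close> is left open because the iterate \<open>x t\<close> is evaluated both relative to \<open>past t\<close>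
  and, together with the sample \<open>\<xi> t\<close>, relative to \<open>past (Suc t)\<close>.\<close>

lemma measurable_continuous_iterate:
  assumes "continuous_on X \<phi>" "space Q = space M" "x t \<in> borel_measurable Q"
  shows "(\<lambda>\<omega>. \<phi> (x t \<omega>)) \<in> borel_measurable Q"
  by (rule measurable_compose[OF measurable_restrict_space2 borel_measurable_continuous_on_restrict[OF assms(1)]])
     (use assms x_in in auto)

lemma measurable_sample_derivative:
  assumes "(\<lambda>(y, p). \<phi> y p) \<in> borel_measurable (restrict_space borel X \<Otimes>\<^sub>M P)"
    "space Q = space M" "x t \<in> borel_measurable Q" "\<xi> t \<in> measurable Q P"
  shows "(\<lambda>\<omega>. \<phi> (x t \<omega>) (\<xi> t \<omega>)) \<in> borel_measurable Q"
proof -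
  have "x t \<in> measurable Q (restrict_space borel X)"
    by (rule measurable_restrict_space2) (use assms x_in in auto)
  from measurable_compose[OF measurable_Pair[OF this assms(4)] assms(1)]
  show ?thesis by simp
qed

lemma continuous_on_c: "continuous_on X c"
proof -
  have "continuous_on X (\<lambda>y. \<chi> i. c y $ i)"
    by (intro continuous_on_vec_lambda C2_on_continuous c_C2)
  then show ?thesis by simp
qed

lemma measurable_hess_L_est:
  assumes "space Q = space M" "x t \<in> borel_measurable Q" "lam t \<in> borel_measurable Q"
    "\<xi> t \<in> measurable Q P"
  shows "hess_L_est t \<in> borel_measurable Q"
proof -
  have [measurable]: "lam t \<in> borel_measurable Q" by fact
  have [measurable]: "H_est t \<in> borel_measurable Q"
    unfolding H_est_def by (rule measurable_sample_derivative[OF hess_F_measurable assms(1,2,4)])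
  have [measurable]: "(\<lambda>\<omega>. hessian (\<lambda>y. c y $ i) (x t \<omega>)) \<in> borel_measurable Q" for i
    by (rule measurable_continuous_iterate[OF C2_on_continuous_hessian[OF c_C2] assms(1,2)])
  show ?thesis unfolding hess_L_est_def by measurable
qed

lemma measurable_grad_L_est:
  assumes "space Q = space M" "x t \<in> borel_measurable Q" "lam t \<in> borel_measurable Q"
    "\<xi> t \<in> measurable Q P"
  shows "grad_L_est t \<in> borel_measurable Q"
proof -
  have [measurable]: "lam t \<in> borel_measurable Q" by fact
  have [measurable]: "g_est t \<in> borel_measurable Q"
    unfolding g_est_def by (rule measurable_sample_derivative[OF grad_F_measurable assms(1,2,4)])
  have [measurable]: "(\<lambda>\<omega>. jacobian c (at (x t \<omega>))) \<in> borel_measurable Q"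
    by (rule measurable_continuous_iterate[OF continuous_on_jacobian[OF c_C2] assms(1,2)])
  have "(\<lambda>\<omega>. c (x t \<omega>)) \<in> borel_measurable Q"
    by (rule measurable_continuous_iterate[OF continuous_on_c assms(1,2)])
  then show ?thesis unfolding grad_L_est_def lagrangian_grad_def
    by (intro borel_measurable_joint) measurable
qed

lemma measurable_K:
  assumes Q: "space Q = space M" "subalgebra Q (past t)"
    and xl: "\<And>i. i \<le> t \<Longrightarrow> x i \<in> borel_measurable Q" "\<And>i. i \<le> t \<Longrightarrow> lam i \<in> borel_measurable Q"
    and xi: "\<And>i. i < t \<Longrightarrow> \<xi> i \<in> measurable Q P"
  shows "K t \<in> borel_measurable Q"
proof -
  have G: "G t \<in> borel_measurable Q" unfolding G_def
    using xl by (intro measurable_continuous_iterate[OF continuous_on_jacobian[OF c_C2] Q(1)]) auto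
  have "hess_avg t \<in> borel_measurable Q" unfolding hess_avg_def
    using xl xi by (intro borel_measurable_scaleR borel_measurable_sum measurable_hess_L_est Q) auto
  moreover have "\<Delta> t \<in> borel_measurable Q"
    using regularization_measurable Q(2) by (rule measurable_from_subalg[rotated])
  ultimately have "B t \<in> borel_measurable Q" unfolding B_def[abs_def] by (cases "t = 0") simp_all
  then show ?thesis unfolding K_def[abs_def] using G by (rule borel_measurable_kkt)
qed

text \<open>Conditional expectations given \<open>past t\<close> can only be used once the iterate is known to be measurable
  there. The Hessian average in \<open>K t\<close> involves every earlier iterate, whence the course-of-values
  induction.\<close>

lemma measurable_iterates: "x t \<in> borel_measurable (past t) \<and> lam t \<in> borel_measurable (past t)"
proof (induction t rule: less_induct)
  case (less t)
  show ?case
  proof (cases t)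
    case 0
    have "x 0 \<in> borel_measurable (past 0) \<longleftrightarrow> (\<lambda>_. x0) \<in> borel_measurable (past 0)"
      by (rule measurable_cong) (simp add: init)
    moreover have "lam 0 \<in> borel_measurable (past 0) \<longleftrightarrow> (\<lambda>_. lam0) \<in> borel_measurable (past 0)"
      by (rule measurable_cong) (simp add: init)
    ultimately show ?thesis using 0 by simp
  next
    case (Suc u)
    let ?Q = "past (Suc u)"
    have xl: "x i \<in> borel_measurable ?Q" "lam i \<in> borel_measurable ?Q" if "i \<le> u" for i
      using less[of i] that Suc measurable_from_subalg[OF subalgebra_past_mono[of i "Suc u"]] by auto
    have Ku: "K u \<in> borel_measurable ?Q"
      by (intro measurable_K subalgebra_past_mono xl measurable_past) auto
    have gu: "grad_L_est u \<in> borel_measurable ?Q"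
      by (intro measurable_grad_L_est xl measurable_past) auto
    have "(\<lambda>\<omega>. sketch_iter (K u \<omega>) (grad_L_est u \<omega>) (\<lambda>j. S u j \<omega>) \<tau>) \<in> borel_measurable ?Q"
      by (intro borel_measurable_sketch_iter Ku gu measurable_past) auto
    moreover have "z u \<in> borel_measurable ?Q \<longleftrightarrow>
        (\<lambda>\<omega>. sketch_iter (K u \<omega>) (grad_L_est u \<omega>) (\<lambda>j. S u j \<omega>) \<tau>) \<in> borel_measurable ?Q"
      by (rule measurable_cong) (simp add: sketched_newton)
    ultimately have z: "z u \<in> borel_measurable ?Q" by simp
    have v: "(\<lambda>\<omega>. joint (x u \<omega>) (lam u \<omega>) + \<alpha> u \<omega> *\<^sub>R z u \<omega>) \<in> borel_measurable ?Q" (is "?v \<in> _")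
      by (intro borel_measurable_add borel_measurable_joint borel_measurable_scaleR xl z measurable_past) auto
    have "x (Suc u) \<in> borel_measurable ?Q \<longleftrightarrow> (\<lambda>\<omega>. primal (?v \<omega>)) \<in> borel_measurable ?Q"
      by (rule measurable_cong) (simp add: step[symmetric])
    moreover have "lam (Suc u) \<in> borel_measurable ?Q \<longleftrightarrow> (\<lambda>\<omega>. dual (?v \<omega>)) \<in> borel_measurable ?Q"
      by (rule measurable_cong) (simp add: step[symmetric])
    moreover have "(\<lambda>\<omega>. primal (?v \<omega>)) \<in> borel_measurable ?Q" "(\<lambda>\<omega>. dual (?v \<omega>)) \<in> borel_measurable ?Q"
      by (rule measurable_compose[OF v], intro borel_measurable_continuous_onI
          bounded_linear.continuous_on[OF bounded_linear_primal]
          bounded_linear.continuous_on[OF bounded_linear_dual] continuous_intros)+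
    ultimately show ?thesis using Suc by simp
  qed
qed

end

section \<open>Persistence of curvature on the kernel\<close>

lemma tendsto_spec_norm:
  assumes "(A \<longlongrightarrow> A0) F" shows "((\<lambda>w. spec_norm (A w)) \<longlongrightarrow> spec_norm A0) F"
proof (rule LIM_zero_cancel, rule Lim_null_comparison)
  have "\<bar>spec_norm (A w) - spec_norm A0\<bar> \<le> norm (A w - A0)" for w
    using spec_norm_triangle[of "A w - A0" A0] spec_norm_triangle[of "A0 - A w" "A w"]
      spec_norm_le_norm[of "A w - A0"] spec_norm_le_norm[of "A0 - A w"]
      norm_minus_commute[of "A w" A0] by simp
  then show "\<forall>\<^sub>F w in F. norm (spec_norm (A w) - spec_norm A0) \<le> norm (A w - A0)" by simp
  show "((\<lambda>w. norm (A w - A0)) \<longlongrightarrow> 0) F"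
    using assms by (intro tendsto_norm_zero LIM_zero)
qed

text \<open>Otherwise there would be unit vectors in the kernels of infinitely many \<open>G n\<close> that violate the bound.
  By compactness they accumulate at a unit vector in the kernel of \<open>G0\<close>, where the strict bound fails.\<close>

lemma eventually_curvature_on_kernel:
  fixes A :: "nat \<Rightarrow> real^'d^'d" and G :: "nat \<Rightarrow> real^'d^'m"
  assumes A: "A \<longlonglongrightarrow> H" and G: "G \<longlonglongrightarrow> G0"
    and pos: "\<And>v. v \<noteq> 0 \<Longrightarrow> G0 *v v = 0 \<Longrightarrow> \<gamma> * (norm v)\<^sup>2 < v \<bullet> (H *v v)"
  shows "\<forall>\<^sub>F n in sequentially. \<forall>v. G n *v v = 0 \<longrightarrow> \<gamma> * (norm v)\<^sup>2 \<le> v \<bullet> (A n *v v)"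
proof (rule ccontr)
  assume "\<not> ?thesis"
  then have "\<forall>N. \<exists>n\<ge>N. \<exists>v. G n *v v = 0 \<and> v \<bullet> (A n *v v) < \<gamma> * (norm v)\<^sup>2"
    by (auto simp: eventually_sequentially not_le)
  then obtain n v where n: "\<And>N. n N \<ge> N" "\<And>N. G (n N) *v v N = 0"
    "\<And>N. v N \<bullet> (A (n N) *v v N) < \<gamma> * (norm (v N))\<^sup>2"
    by metis
  have v0: "v N \<noteq> 0" for N using n(3)[of N] by auto
  define u where "u N = v N /\<^sub>R norm (v N)" for N
  have u: "norm (u N) = 1" "G (n N) *v u N = 0" for N
    using v0[of N] n(2)[of N] by (simp_all add: u_def matrix_vector_mult_scaleR)
  have uA: "u N \<bullet> (A (n N) *v u N) \<le> \<gamma>" for N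
  proof -
    have "u N \<bullet> (A (n N) *v u N) = v N \<bullet> (A (n N) *v v N) / (norm (v N))\<^sup>2"
      using v0[of N] by (simp add: u_def matrix_vector_mult_scaleR power2_eq_square divide_inverse)
    then show ?thesis using n(3)[of N] v0[of N] by (simp add: divide_le_eq)
  qed
  have "\<forall>N. u N \<in> sphere 0 1" by (simp add: u)
  then obtain w l where w1: "w \<in> sphere 0 1" and l: "strict_mono l" "(u \<circ> l) \<longlonglongrightarrow> w"
    using compact_sphere[of "0 :: real^'d" 1] unfolding compact_def by meson
  have w: "norm w = 1" using w1 by simp
  have n_top: "filterlim n at_top sequentially"
    by (rule filterlim_at_top_mono[OF filterlim_ident]) (simp add: n(1))
  have nl: "filterlim (\<lambda>k. n (l k)) at_top sequentially"
    by (rule filterlim_compose[OF n_top filterlim_subseq[OF l(1)]])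
  have ul: "(\<lambda>k. u (l k)) \<longlonglongrightarrow> w" using l(2) by (simp add: comp_def)
  have Al: "(\<lambda>k. A (n (l k))) \<longlonglongrightarrow> H" by (rule filterlim_compose[OF A nl])
  have Gl: "(\<lambda>k. G (n (l k))) \<longlonglongrightarrow> G0" by (rule filterlim_compose[OF G nl])
  have "(\<lambda>k. G (n (l k)) *v u (l k)) \<longlonglongrightarrow> G0 *v w" by (rule tendsto_matrix_vector_mult[OF Gl ul])
  then have "G0 *v w = 0" by (simp add: u LIMSEQ_const_iff)
  moreover have "(\<lambda>k. u (l k) \<bullet> (A (n (l k)) *v u (l k))) \<longlonglongrightarrow> w \<bullet> (H *v w)"
    by (intro tendsto_inner tendsto_matrix_vector_mult Al ul)
  then have "w \<bullet> (H *v w) \<le> \<gamma>" by (rule LIMSEQ_le_const2) (auto intro: uA)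
  moreover have "w \<noteq> 0" using w by auto
  ultimately show False using pos[of w] w by simp
qed

section \<open>The averaged Hessian estimates\<close>

context sketched_stosqp
begin

abbreviation f where "f \<equiv> objective P F"

lemma AE_point:
  assumes "AE \<omega> in M. Q \<omega>" obtains \<omega> where "\<omega> \<in> space M" "Q \<omega>"
proof -
  have "\<exists>\<omega>\<in>space M. Q \<omega>"
  proof (rule ccontr)
    assume "\<not> ?thesis"
    then have "AE \<omega> in M. Q \<omega> \<longrightarrow> False" by (intro AE_I2) auto
    with assms have "AE \<omega> in M. False" by (rule AE_mp)
    then show False by (simp add: AE_False)
  qed
  then show thesis by (elim bexE) (rule that)
qed

lemma compact_X: "compact X" and xs_in: "xs \<in> X"
proof -
  obtain \<omega> where \<omega>: "\<omega> \<in> space M" "(\<lambda>t. x t \<omega>) \<longlonglongrightarrow> xs"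
    by (rule AE_point[OF converges]) blast
  have "compact (X \<times> \<Lambda>)" using region by (simp add: compact_eq_bounded_closed)
  then have "compact (fst ` (X \<times> \<Lambda>))" by (intro compact_continuous_image continuous_intros)
  moreover have "\<Lambda> \<noteq> {}" using lam_in[OF \<omega>(1)] by auto
  ultimately show "compact X" by simp
  then have "closed X" by (rule compact_imp_closed)
  then show "xs \<in> X" by (rule closed_sequentially[OF _ x_in[OF \<omega>(1)] \<omega>(2)])
qed

lemma H_est_measurable: "H_est t \<in> borel_measurable (past (Suc t))"
proof -
  have "x t \<in> borel_measurable (past (Suc t))"
    by (rule measurable_from_subalg[OF subalgebra_past_mono conjunct1[OF measurable_iterates]]) simp
  then show ?thesis unfolding H_est_def
    by (intro measurable_sample_derivative[OF hess_F_measurable] measurable_past) auto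
qed

lemma H_est_measurable_M: "H_est t \<in> borel_measurable M"
  using H_est_measurable by (rule measurable_from_subalg[OF subalgebra_past])

text \<open>The moment assumption bounds a supremum over \<open>X\<close>. Taken over a countable dense subset of \<open>X\<close> the
  supremum is measurable in the sample, and by continuity of the Hessian it still dominates the value
  at the iterate.\<close>

lemma H_est_second_moment:
  "integrable M (\<lambda>\<omega>. (H_est t \<omega> $ p $ q)\<^sup>2)" "(\<integral>\<omega>. (H_est t \<omega> $ p $ q)\<^sup>2 \<partial>M) \<le> \<Upsilon>\<^sub>m"
proof -
  obtain Q where Q: "countable Q" "Q \<subseteq> X" "X \<subseteq> closure Q" using separable by blast
  define \<phi> where "\<phi> y s = ennreal ((hessian (\<lambda>u. F u s) y $ p $ q)\<^sup>2)" for y s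
  define h where "h s = (SUP y\<in>Q. \<phi> y s)" for s
  have "\<phi> y \<in> borel_measurable P" if "y \<in> Q" for y
  proof -
    have "(\<lambda>s. (y, s)) \<in> measurable P (restrict_space borel X \<Otimes>\<^sub>M P)"
      using that Q(2) by (intro measurable_Pair1') (auto simp: space_restrict_space)
    from measurable_compose[OF this hess_F_measurable]
    have [measurable]: "(\<lambda>s. hessian (\<lambda>u. F u s) y) \<in> borel_measurable P" by simp
    show ?thesis unfolding \<phi>_def by measurable
  qed
  then have h: "h \<in> borel_measurable P" unfolding h_def[abs_def] using Q(1) by (intro borel_measurable_SUP)
  have le_h: "\<phi> y s \<le> h s" if y: "y \<in> X" and s: "s \<in> space P" for y s
  proof -
    have "y \<in> closure Q" using y Q(3) by auto
    then obtain a where a: "\<And>n. a n \<in> Q" "a \<longlonglongrightarrow> y" unfolding closure_sequential by auto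
    have "(\<lambda>n. hessian (\<lambda>u. F u s) (a n)) \<longlonglongrightarrow> hessian (\<lambda>u. F u s) y"
      using a Q(2) by (intro continuous_on_tendsto_compose[OF C2_on_continuous_hessian[OF F_C2[OF s]] a(2) y] always_eventually) auto
    then have "(\<lambda>n. \<phi> (a n) s) \<longlonglongrightarrow> \<phi> y s"
      unfolding \<phi>_def by (intro tendsto_ennrealI tendsto_power tendsto_vec_nth)
    moreover have "\<phi> (a n) s \<le> h s" for n unfolding h_def using a(1) by (intro SUP_upper)
    ultimately show ?thesis by (intro LIMSEQ_le_const2) auto
  qed
  have "(\<integral>\<^sup>+\<omega>. ennreal ((H_est t \<omega> $ p $ q)\<^sup>2) \<partial>M) \<le> (\<integral>\<^sup>+\<omega>. h (\<xi> t \<omega>) \<partial>M)"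
  proof (rule nn_integral_mono)
    fix \<omega> assume \<omega>: "\<omega> \<in> space M"
    show "ennreal ((H_est t \<omega> $ p $ q)\<^sup>2) \<le> h (\<xi> t \<omega>)"
      using le_h[OF x_in[OF \<omega>] measurable_space[OF sample_measurable \<omega>]]
      by (simp add: H_est_def \<phi>_def)
  qed
  also have "\<dots> = (\<integral>\<^sup>+s. h s \<partial>distr M P (\<xi> t))"
    using h sample_measurable by (subst nn_integral_distr) auto
  also have "\<dots> = (\<integral>\<^sup>+s. h s \<partial>P)" by (simp only: sample_law)
  also have "\<dots> \<le> (\<integral>\<^sup>+s. (SUP y\<in>X. ennreal ((spec_norm (hessian (\<lambda>u. F u s) y))\<^sup>2)) \<partial>P)"
    unfolding h_def \<phi>_def
    by (intro nn_integral_mono SUP_subset_mono Q(2) ennreal_leI power2_le_iff_abs_le[THEN iffD2]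
        abs_component_le_spec_norm spec_norm_nonneg)
  finally have nn: "(\<integral>\<^sup>+\<omega>. ennreal ((H_est t \<omega> $ p $ q)\<^sup>2) \<partial>M) \<le> ennreal \<Upsilon>\<^sub>m"
    using H_moment by (rule order_trans)
  have [measurable]: "H_est t \<in> borel_measurable M" by (rule H_est_measurable_M)
  show *: "integrable M (\<lambda>\<omega>. (H_est t \<omega> $ p $ q)\<^sup>2)"
    by (rule integrableI_bounded) (use nn in \<open>auto intro: le_less_trans\<close>)
  show "(\<integral>\<omega>. (H_est t \<omega> $ p $ q)\<^sup>2 \<partial>M) \<le> \<Upsilon>\<^sub>m"
  proof -
    have "ennreal (\<integral>\<omega>. (H_est t \<omega> $ p $ q)\<^sup>2 \<partial>M) = (\<integral>\<^sup>+\<omega>. ennreal ((H_est t \<omega> $ p $ q)\<^sup>2) \<partial>M)"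
      by (rule nn_integral_eq_integral[OF *, symmetric]) simp
    also have "\<dots> \<le> ennreal \<Upsilon>\<^sub>m" by (rule nn)
    finally show ?thesis using constants_pos(4) by (simp add: ennreal_le_iff)
  qed
qed

definition noise :: "nat \<Rightarrow> 'w \<Rightarrow> real^'d^'d" where
  "noise t \<omega> = H_est t \<omega> - hessian f (x t \<omega>)"

lemma true_hessian_measurable: "(\<lambda>\<omega>. hessian f (x t \<omega>)) \<in> borel_measurable (past t)"
  by (rule measurable_continuous_iterate[OF C2_on_continuous_hessian[OF f_C2] space_past
        conjunct1[OF measurable_iterates]])

lemma noise_measurable: "noise t \<in> borel_measurable (past (Suc t))"
  unfolding noise_def[abs_def]
  by (intro borel_measurable_diff H_est_measurable
      measurable_from_subalg[OF subalgebra_past_mono true_hessian_measurable]) simp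

lemma noise_second_moment:
  "\<exists>C. \<forall>t p q. integrable M (\<lambda>\<omega>. (noise t \<omega> $ p $ q)\<^sup>2) \<and> (\<integral>\<omega>. (noise t \<omega> $ p $ q)\<^sup>2 \<partial>M) \<le> C"
proof -
  have "compact (hessian f ` X)"
    by (rule compact_continuous_image[OF C2_on_continuous_hessian[OF f_C2] compact_X])
  then obtain b where b: "\<And>y. y \<in> X \<Longrightarrow> norm (hessian f y) \<le> b"
    using compact_imp_bounded by (force simp: bounded_iff)
  have "integrable M (\<lambda>\<omega>. (noise t \<omega> $ p $ q)\<^sup>2) \<and> (\<integral>\<omega>. (noise t \<omega> $ p $ q)\<^sup>2 \<partial>M) \<le> 2 * \<Upsilon>\<^sub>m + 2 * b\<^sup>2" for t p q
  proof -
    have [measurable]: "noise t \<in> borel_measurable M"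
      by (rule measurable_from_subalg[OF subalgebra_past noise_measurable])
    have pt: "(noise t \<omega> $ p $ q)\<^sup>2 \<le> 2 * (H_est t \<omega> $ p $ q)\<^sup>2 + 2 * b\<^sup>2" if "\<omega> \<in> space M" for \<omega>
    proof -
      have "\<bar>hessian f (x t \<omega>) $ p $ q\<bar> \<le> b"
      proof -
        have "norm (hessian f (x t \<omega>) $ p $ q) \<le> norm (hessian f (x t \<omega>) $ p)" by (rule Finite_Cartesian_Product.norm_nth_le)
        also have "\<dots> \<le> norm (hessian f (x t \<omega>))" by (rule Finite_Cartesian_Product.norm_nth_le)
        also have "\<dots> \<le> b" by (rule b[OF x_in[OF that]])
        finally show ?thesis by simp
      qed
      then have "(hessian f (x t \<omega>) $ p $ q)\<^sup>2 \<le> b\<^sup>2" by (simp add: abs_le_square_iff[symmetric])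
      moreover have "(u - v)\<^sup>2 \<le> 2 * u\<^sup>2 + 2 * v\<^sup>2" for u v :: real
        using zero_le_power2[of "u + v"] by (simp add: power2_eq_square algebra_simps)
      from this[of "H_est t \<omega> $ p $ q" "hessian f (x t \<omega>) $ p $ q"]
      have "(noise t \<omega> $ p $ q)\<^sup>2 \<le> 2 * (H_est t \<omega> $ p $ q)\<^sup>2 + 2 * (hessian f (x t \<omega>) $ p $ q)\<^sup>2"
        by (simp add: noise_def)
      ultimately show ?thesis by linarith
    qed
    have int: "integrable M (\<lambda>\<omega>. 2 * (H_est t \<omega> $ p $ q)\<^sup>2 + 2 * b\<^sup>2)"
      using H_est_second_moment(1) by simp
    have i: "integrable M (\<lambda>\<omega>. (noise t \<omega> $ p $ q)\<^sup>2)"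
    proof (rule Bochner_Integration.integrable_bound[OF int])
      show "AE \<omega> in M. norm ((noise t \<omega> $ p $ q)\<^sup>2) \<le> norm (2 * (H_est t \<omega> $ p $ q)\<^sup>2 + 2 * b\<^sup>2)"
        using pt by (intro AE_I2) simp
    qed measurable
    have "(\<integral>\<omega>. (noise t \<omega> $ p $ q)\<^sup>2 \<partial>M) \<le> (\<integral>\<omega>. 2 * (H_est t \<omega> $ p $ q)\<^sup>2 + 2 * b\<^sup>2 \<partial>M)"
      by (intro integral_mono_AE i int AE_I2 pt)
    also have "\<dots> = 2 * (\<integral>\<omega>. (H_est t \<omega> $ p $ q)\<^sup>2 \<partial>M) + 2 * b\<^sup>2"
      using H_est_second_moment(1) by (simp add: prob_space)
    also have "\<dots> \<le> 2 * \<Upsilon>\<^sub>m + 2 * b\<^sup>2"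
      by (intro add_mono mult_left_mono H_est_second_moment(2)) auto
    finally show ?thesis using i by simp
  qed
  then show ?thesis by (intro exI[of _ "2 * \<Upsilon>\<^sub>m + 2 * b\<^sup>2"] allI)
qed

text \<open>The partial sum is determined by the past, so the new Hessian estimate may be replaced by its
  conditional expectation, which is the true Hessian.\<close>

lemma noise_orthogonal:
  assumes sq: "integrable M (\<lambda>\<omega>. (\<Sum>i<t. noise i \<omega> $ p $ q)\<^sup>2)"
  shows "(\<integral>\<omega>. (\<Sum>i<t. noise i \<omega> $ p $ q) * noise t \<omega> $ p $ q \<partial>M) = 0"
proof -
  interpret sub: sigma_finite_subalgebra M "past t"
    by (rule finite_measure_subalgebra_is_sigma_finite)
       (simp add: finite_measure_subalgebra_def finite_measure_subalgebra_axioms_def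
          finite_measure_axioms subalgebra_past)
  let ?S = "\<lambda>\<omega>. \<Sum>i<t. noise i \<omega> $ p $ q"
  have "noise i \<in> borel_measurable (past t)" if "i < t" for i
    using that by (intro measurable_from_subalg[OF subalgebra_past_mono noise_measurable]) simp
  then have S: "?S \<in> borel_measurable (past t)"
    by (intro borel_measurable_sum borel_measurable_vec_nth_comp) auto
  have SM: "?S \<in> borel_measurable M" by (rule measurable_from_subalg[OF subalgebra_past S])
  have H: "(\<lambda>\<omega>. H_est t \<omega> $ p $ q) \<in> borel_measurable M"
    by (intro borel_measurable_vec_nth_comp H_est_measurable_M)
  have m: "(\<lambda>\<omega>. hessian f (x t \<omega>) $ p $ q) \<in> borel_measurable M"
    by (intro borel_measurable_vec_nth_comp measurable_from_subalg[OF subalgebra_past true_hessian_measurable])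
  have i: "integrable M (\<lambda>\<omega>. ?S \<omega> * H_est t \<omega> $ p $ q)"
    by (intro integrable_mult_of_squares SM H sq H_est_second_moment)
  have ae: "AE \<omega> in M. ?S \<omega> * real_cond_exp M (past t) (\<lambda>\<omega>. H_est t \<omega> $ p $ q) \<omega>
      = ?S \<omega> * hessian f (x t \<omega>) $ p $ q"
    using H_unbiased[of t p q] by eventually_elim simp
  have ci: "integrable M (\<lambda>\<omega>. ?S \<omega> * real_cond_exp M (past t) (\<lambda>\<omega>. H_est t \<omega> $ p $ q) \<omega>)"
    by (rule sub.real_cond_exp_intg(1)[OF i S H])
  have mi: "integrable M (\<lambda>\<omega>. ?S \<omega> * hessian f (x t \<omega>) $ p $ q)"
  proof (rule integrable_cong_AE_imp[OF ci])
    show "(\<lambda>\<omega>. ?S \<omega> * hessian f (x t \<omega>) $ p $ q) \<in> borel_measurable M"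
      by (intro borel_measurable_times SM m)
    show "AE \<omega> in M. ?S \<omega> * real_cond_exp M (past t) (\<lambda>\<omega>. H_est t \<omega> $ p $ q) \<omega>
        = ?S \<omega> * hessian f (x t \<omega>) $ p $ q" by (rule ae)
  qed
  have "(\<integral>\<omega>. ?S \<omega> * H_est t \<omega> $ p $ q \<partial>M) = (\<integral>\<omega>. ?S \<omega> * real_cond_exp M (past t) (\<lambda>\<omega>. H_est t \<omega> $ p $ q) \<omega> \<partial>M)"
    by (rule sub.real_cond_exp_intg(2)[OF i S H, symmetric])
  also have "\<dots> = (\<integral>\<omega>. ?S \<omega> * hessian f (x t \<omega>) $ p $ q \<partial>M)"
    by (rule integral_cong_AE[OF borel_measurable_integrable[OF ci] borel_measurable_integrable[OF mi] ae])
  finally show ?thesis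
    using i mi by (simp add: noise_def right_diff_distrib)
qed

text \<open>The second moment of the average over \<open>n\<close> terms is of order \<open>1 / n\<close>. Convergence in the mean is
  enough here: only one sample path and one subsequence along it are needed later.\<close>

lemma noise_average_tendsto_0:
  "\<exists>r :: nat \<Rightarrow> nat. strict_mono r \<and>
    (AE \<omega> in M. (\<lambda>n. (1 / real (r n)) *\<^sub>R (\<Sum>i<r n. noise i \<omega>)) \<longlonglongrightarrow> 0)"
proof -
  obtain C where C: "\<And>t p q. integrable M (\<lambda>\<omega>. (noise t \<omega> $ p $ q)\<^sup>2)"
    "\<And>t p q. (\<integral>\<omega>. (noise t \<omega> $ p $ q)\<^sup>2 \<partial>M) \<le> C"
    using noise_second_moment by blast
  have meas: "(\<lambda>\<omega>. noise t \<omega> $ p $ q) \<in> borel_measurable M" for t p q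
    by (intro borel_measurable_vec_nth_comp measurable_from_subalg[OF subalgebra_past noise_measurable])
  have S: "integrable M (\<lambda>\<omega>. (\<Sum>i<t. noise i \<omega> $ p $ q)\<^sup>2) \<and>
      (\<integral>\<omega>. (\<Sum>i<t. noise i \<omega> $ p $ q)\<^sup>2 \<partial>M) \<le> real t * C" for t p q
    by (rule orthogonal_increments_second_moment) (use meas C noise_orthogonal in auto)
  define v where "v n \<omega> p q = ((1 / real n) * (\<Sum>i<n. noise i \<omega> $ p $ q))\<^sup>2" for n \<omega> p q
  define u where "u n \<omega> = (\<Sum>p\<in>UNIV. \<Sum>q\<in>UNIV. v n \<omega> p q)" for n \<omega>
  have v0: "0 \<le> v n \<omega> p q" for n \<omega> p q by (simp add: v_def)
  have u_nonneg: "0 \<le> u n \<omega>" for n \<omega> unfolding u_def by (intro sum_nonneg v0)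
  have vi: "integrable M (\<lambda>\<omega>. v n \<omega> p q)" for n p q
    unfolding v_def power_mult_distrib
    by (intro Bochner_Integration.integrable_mult_right conjunct1[OF S])
  have vle: "(\<integral>\<omega>. v n \<omega> p q \<partial>M) \<le> C / real n" for n p q
  proof -
    have "(\<integral>\<omega>. v n \<omega> p q \<partial>M) = (1 / real n)\<^sup>2 * (\<integral>\<omega>. (\<Sum>i<n. noise i \<omega> $ p $ q)\<^sup>2 \<partial>M)"
      unfolding v_def power_mult_distrib by simp
    also have "\<dots> \<le> (1 / real n)\<^sup>2 * (real n * C)"
      by (intro mult_left_mono conjunct2[OF S]) simp
    also have "\<dots> = C / real n" by (simp add: power2_eq_square)
    finally show ?thesis .
  qed
  have ui: "integrable M (u n)" for n
    unfolding u_def[abs_def] by (intro Bochner_Integration.integrable_sum vi)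
  have un: "norm (u n \<omega>) = u n \<omega>" for n \<omega>
    using u_nonneg by simp
  have ule: "(\<integral>\<omega>. u n \<omega> \<partial>M) \<le> real CARD('d) * (real CARD('d) * C) / real n" for n
  proof -
    have "(\<integral>\<omega>. u n \<omega> \<partial>M) = (\<Sum>p\<in>UNIV. \<Sum>q\<in>UNIV. \<integral>\<omega>. v n \<omega> p q \<partial>M)"
      unfolding u_def[abs_def] by (simp add: vi Bochner_Integration.integrable_sum)
    also have "\<dots> \<le> (\<Sum>p\<in>(UNIV :: 'd set). \<Sum>q\<in>(UNIV :: 'd set). C / real n)"
      by (intro sum_mono vle)
    finally show ?thesis by simp
  qed
  have u0: "(\<lambda>n. \<integral>\<omega>. norm (u n \<omega>) \<partial>M) \<longlonglongrightarrow> 0"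
    unfolding un
  proof (rule tendsto_sandwich[OF _ _ tendsto_const])
    show "\<forall>\<^sub>F n in sequentially. 0 \<le> (\<integral>\<omega>. u n \<omega> \<partial>M)"
      by (intro always_eventually allI integral_nonneg_AE AE_I2 u_nonneg)
    show "\<forall>\<^sub>F n in sequentially. (\<integral>\<omega>. u n \<omega> \<partial>M) \<le> real CARD('d) * (real CARD('d) * C) / real n"
      using ule by simp
    show "(\<lambda>n. real CARD('d) * (real CARD('d) * C) / real n) \<longlonglongrightarrow> 0"
      by (rule lim_const_over_n)
  qed
  obtain r :: "nat \<Rightarrow> nat" where r: "strict_mono r" "AE \<omega> in M. (\<lambda>n. u (r n) \<omega>) \<longlonglongrightarrow> 0"
    using tendsto_L1_AE_subseq[OF ui u0] by blast
  have main: "(\<lambda>n. (1 / real (r n)) *\<^sub>R (\<Sum>i<r n. noise i \<omega>)) \<longlonglongrightarrow> 0" if lim: "(\<lambda>n. u (r n) \<omega>) \<longlonglongrightarrow> 0" for \<omega>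
  proof (intro vec_tendstoI)
    fix p q
    have "v n \<omega> p q \<le> u n \<omega>" for n
    proof -
      have "v n \<omega> p q \<le> (\<Sum>q\<in>UNIV. v n \<omega> p q)" by (intro member_le_sum v0) auto
      also have "\<dots> \<le> u n \<omega>" unfolding u_def
        by (intro member_le_sum[where f = "\<lambda>p. \<Sum>q\<in>UNIV. v n \<omega> p q"] sum_nonneg v0) auto
      finally show ?thesis .
    qed
    then have "(\<lambda>n. v (r n) \<omega> p q) \<longlonglongrightarrow> 0"
      using v0 by (intro tendsto_sandwich[OF _ _ tendsto_const lim] always_eventually) auto
    then have "(\<lambda>n. sqrt (v (r n) \<omega> p q)) \<longlonglongrightarrow> sqrt 0" by (rule tendsto_real_sqrt)
    then have "(\<lambda>n. \<bar>(1 / real (r n)) * (\<Sum>i<r n. noise i \<omega> $ p $ q)\<bar>) \<longlonglongrightarrow> 0"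
      unfolding v_def real_sqrt_abs real_sqrt_zero .
    then have "(\<lambda>n. (1 / real (r n)) * (\<Sum>i<r n. noise i \<omega> $ p $ q)) \<longlonglongrightarrow> 0"
      by (rule tendsto_rabs_zero_cancel)
    then show "(\<lambda>n. ((1 / real (r n)) *\<^sub>R (\<Sum>i<r n. noise i \<omega>)) $ p $ q) \<longlonglongrightarrow> 0 $ p $ q"
      by (simp add: sum_component)
  qed
  have "AE \<omega> in M. (\<lambda>n. (1 / real (r n)) *\<^sub>R (\<Sum>i<r n. noise i \<omega>)) \<longlonglongrightarrow> 0"
    using r(2) by (rule eventually_mono) (rule main)
  with r(1) show ?thesis by (intro exI[of _ r] conjI)
qed

lemma transpose_hess_avg:
  assumes "\<omega> \<in> space M" shows "transpose (hess_avg t \<omega>) = hess_avg t \<omega>"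
proof -
  note lin = linear_sum[OF bounded_linear.linear[OF bounded_linear_transpose]]
    linear_cmul[OF bounded_linear.linear[OF bounded_linear_transpose]]
  have "transpose (H_est i \<omega>) = H_est i \<omega>" for i
    unfolding H_est_def using F_C2[OF measurable_space[OF sample_measurable assms]] x_in[OF assms]
    by (rule transpose_hessian)
  moreover have "transpose (hessian (\<lambda>y. c y $ k) (x i \<omega>)) = hessian (\<lambda>y. c y $ k) (x i \<omega>)" for i k
    using c_C2 x_in[OF assms] by (rule transpose_hessian)
  ultimately show ?thesis
    by (simp add: hess_avg_def hess_L_est_def lin transpose_add)
qed

lemma hess_avg_tendsto:
  assumes \<omega>: "\<omega> \<in> space M" and x: "(\<lambda>t. x t \<omega>) \<longlonglongrightarrow> xs" and lam: "(\<lambda>t. lam t \<omega>) \<longlonglongrightarrow> ls"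
    and r: "strict_mono r" and noise: "(\<lambda>n. (1 / real (r n)) *\<^sub>R (\<Sum>i<r n. noise i \<omega>)) \<longlonglongrightarrow> 0"
  shows "(\<lambda>n. hess_avg (r n) \<omega>) \<longlonglongrightarrow> lagrangian_hess_x f c xs ls"
proof -
  define D where "D t = hessian f (x t \<omega>) + (\<Sum>i\<in>UNIV. (lam t \<omega> $ i) *\<^sub>R hessian (\<lambda>y. c y $ i) (x t \<omega>))" for t
  have "D \<longlonglongrightarrow> lagrangian_hess_x f c xs ls"
    unfolding D_def lagrangian_hess_x_eq[OF f_C2 c_C2 xs_in]
    by (intro tendsto_add tendsto_sum tendsto_scaleR tendsto_vec_nth lam
        continuous_on_tendsto_compose[OF C2_on_continuous_hessian[OF f_C2] x xs_in]
        continuous_on_tendsto_compose[OF C2_on_continuous_hessian[OF c_C2] x xs_in]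
        always_eventually allI x_in \<omega>)
  then have "(\<lambda>n. (1 / real n) *\<^sub>R (\<Sum>i<n. D i)) \<longlonglongrightarrow> lagrangian_hess_x f c xs ls"
    by (rule cesaro_mean)
  then have "(\<lambda>n. (1 / real (r n)) *\<^sub>R (\<Sum>i<r n. D i)) \<longlonglongrightarrow> lagrangian_hess_x f c xs ls"
    by (rule filterlim_compose[OF _ filterlim_subseq[OF r]])
  from tendsto_add[OF noise this]
  have "(\<lambda>n. (1 / real (r n)) *\<^sub>R (\<Sum>i<r n. noise i \<omega>) + (1 / real (r n)) *\<^sub>R (\<Sum>i<r n. D i))
      \<longlonglongrightarrow> lagrangian_hess_x f c xs ls" by simp
  moreover have "hess_L_est i \<omega> = noise i \<omega> + D i" for i
    by (simp add: hess_L_est_def noise_def D_def)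
  ultimately show ?thesis
    by (simp add: hess_avg_def sum.distrib scaleR_add_right)
qed

section \<open>The KKT matrix at the solution\<close>

abbreviation K_limit :: "real^('d + 'm)^('d + 'm)" where "K_limit \<equiv> K_star P F c xs ls"

text \<open>Along a sample path and a subsequence on which the averaged noise vanishes, the unregularized Hessian
  averages converge to the Hessian of the Lagrangian at the solution. The two bounds required of \<open>B t\<close>
  hold strictly there, so they hold for the averages from some index on; then the regularization is
  zero and the matrices \<open>K t\<close> converge.\<close>

lemma K_tendsto:
  "\<exists>\<kappa>. \<kappa> \<longlonglongrightarrow> K_limit \<and>
     (\<forall>n. transpose (\<kappa> n) = \<kappa> n \<and> \<gamma>\<^sub>S *\<^sub>R mat 1 \<preceq> (\<integral>s. sketch_proj (\<kappa> n) s \<partial>D))"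
proof -
  obtain r :: "nat \<Rightarrow> nat" where r: "strict_mono r"
    "AE \<omega> in M. (\<lambda>n. (1 / real (r n)) *\<^sub>R (\<Sum>i<r n. noise i \<omega>)) \<longlonglongrightarrow> 0"
    using noise_average_tendsto_0 by blast
  have "AE \<omega> in M. \<forall>t. \<gamma>\<^sub>S *\<^sub>R mat 1 \<preceq> (\<integral>s. sketch_proj (K t \<omega>) s \<partial>D)"
    using sketch_contraction by (simp add: AE_all_countable)
  with r(2) converges
  have "AE \<omega> in M. (\<lambda>n. (1 / real (r n)) *\<^sub>R (\<Sum>i<r n. noise i \<omega>)) \<longlonglongrightarrow> 0 \<and>
      ((\<lambda>t. x t \<omega>) \<longlonglongrightarrow> xs \<and> (\<lambda>t. lam t \<omega>) \<longlonglongrightarrow> ls) \<and>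
      (\<forall>t. \<gamma>\<^sub>S *\<^sub>R mat 1 \<preceq> (\<integral>s. sketch_proj (K t \<omega>) s \<partial>D))"
    by eventually_elim simp
  then obtain \<omega> where \<omega>: "\<omega> \<in> space M" and
    lim: "(\<lambda>n. (1 / real (r n)) *\<^sub>R (\<Sum>i<r n. noise i \<omega>)) \<longlonglongrightarrow> 0"
      "(\<lambda>t. x t \<omega>) \<longlonglongrightarrow> xs" "(\<lambda>t. lam t \<omega>) \<longlonglongrightarrow> ls"
    and contr: "\<And>t. \<gamma>\<^sub>S *\<^sub>R mat 1 \<preceq> (\<integral>s. sketch_proj (K t \<omega>) s \<partial>D)"
    using AE_point by blast
  let ?H = "lagrangian_hess_x f c xs ls" and ?A = "\<lambda>n. hess_avg (r n) \<omega>"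
  have A: "?A \<longlonglongrightarrow> ?H" by (rule hess_avg_tendsto[OF \<omega> lim(2,3) r(1) lim(1)])
  have "(\<lambda>t. G t \<omega>) \<longlonglongrightarrow> jacobian c (at xs)" unfolding G_def
    by (rule continuous_on_tendsto_compose[OF continuous_on_jacobian[OF c_C2] lim(2) xs_in])
      (simp add: x_in \<omega>)
  then have G: "(\<lambda>n. G (r n) \<omega>) \<longlonglongrightarrow> jacobian c (at xs)"
    by (rule filterlim_compose[OF _ filterlim_subseq[OF r(1)]])
  have e1: "\<forall>\<^sub>F n in sequentially. spec_norm (?A n) < \<Upsilon>\<^sub>B"
    by (rule order_tendstoD(2)[OF tendsto_spec_norm[OF A] Upsilon_B_large])
  have e2: "\<forall>\<^sub>F n in sequentially. \<forall>v. G (r n) \<omega> *v v = 0 \<longrightarrow> \<gamma>\<^sub>R\<^sub>H * (norm v)\<^sup>2 \<le> v \<bullet> (?A n *v v)"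
    by (rule eventually_curvature_on_kernel[OF A G gamma_RH_small])
  have e3: "\<forall>\<^sub>F n in sequentially. 1 \<le> r n"
    using filterlim_subseq[OF r(1)] by (simp add: filterlim_at_top)
  from e1 e2 e3 have "\<forall>\<^sub>F n in sequentially. K (r n) \<omega> = kkt (?A n) (G (r n) \<omega>)"
  proof eventually_elim
    case (elim n)
    then have "\<Delta> (r n) \<omega> = 0" by (intro no_regularization \<omega>) auto
    then show ?case using elim by (simp add: K_def B_def)
  qed
  then obtain N where N: "\<And>n. n \<ge> N \<Longrightarrow> K (r n) \<omega> = kkt (?A n) (G (r n) \<omega>)"
    by (auto simp: eventually_sequentially)
  let ?\<kappa> = "\<lambda>n. kkt (?A (n + N)) (G (r (n + N)) \<omega>)"
  have "(\<lambda>n. kkt (?A n) (G (r n) \<omega>)) \<longlonglongrightarrow> K_limit"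
    unfolding K_star_def by (rule tendsto_kkt[OF A G])
  then have "?\<kappa> \<longlonglongrightarrow> K_limit" by (rule LIMSEQ_ignore_initial_segment)
  moreover have "transpose (?\<kappa> n) = ?\<kappa> n" for n
    by (simp add: transpose_kkt transpose_hess_avg[OF \<omega>])
  moreover have "\<gamma>\<^sub>S *\<^sub>R mat 1 \<preceq> (\<integral>s. sketch_proj (?\<kappa> n) s \<partial>D)" for n
    using contr[of "r (n + N)"] N[of "n + N"] by simp
  ultimately show ?thesis by (intro exI[of _ ?\<kappa>] conjI allI)
qed

text \<open>The KKT matrix at the solution is a limit of symmetric matrices.\<close>

lemma transpose_K_limit: "transpose K_limit = K_limit"
proof -
  obtain \<kappa> where K: "\<kappa> \<longlonglongrightarrow> K_limit \<and>
     (\<forall>n. transpose (\<kappa> n) = \<kappa> n \<and> \<gamma>\<^sub>S *\<^sub>R mat 1 \<preceq> (\<integral>s. sketch_proj (\<kappa> n) s \<partial>D))"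
    using K_tendsto by (rule exE)
  then have \<kappa>: "\<kappa> \<longlonglongrightarrow> K_limit" "\<And>n. transpose (\<kappa> n) = \<kappa> n" by simp_all
  have "(\<lambda>n. transpose (\<kappa> n)) \<longlonglongrightarrow> transpose K_limit" by (rule tendsto_transpose[OF \<kappa>(1)])
  then have "\<kappa> \<longlonglongrightarrow> transpose K_limit" unfolding \<kappa>(2) .
  then show ?thesis using \<kappa>(1) by (rule LIMSEQ_unique)
qed

lemma K_limit_left_inverse: "\<exists>L. L ** K_limit = mat 1"
  unfolding K_star_def using licq sosc by (rule kkt_left_inverse)

text \<open>The contraction is assumed along the run. Replacing \<open>K t\<close> by its limit changes the expected
  projection by an error that tends to zero, because the estimate is uniform in the sketching matrix.\<close>

lemma sketch_contraction_limit:
  "\<gamma>\<^sub>S * (norm v)\<^sup>2 \<le> v \<bullet> ((\<integral>s. sketch_proj K_limit s \<partial>D) *v v)"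
proof (rule field_le_epsilon)
  fix e :: real assume "0 < e"
  obtain L where L: "L ** K_limit = mat 1" using K_limit_left_inverse by blast
  obtain \<kappa> where K: "\<kappa> \<longlonglongrightarrow> K_limit \<and>
     (\<forall>n. transpose (\<kappa> n) = \<kappa> n \<and> \<gamma>\<^sub>S *\<^sub>R mat 1 \<preceq> (\<integral>s. sketch_proj (\<kappa> n) s \<partial>D))"
    using K_tendsto by (rule exE)
  then have \<kappa>: "\<kappa> \<longlonglongrightarrow> K_limit" "\<And>n. transpose (\<kappa> n) = \<kappa> n"
    "\<And>n. \<gamma>\<^sub>S *\<^sub>R mat 1 \<preceq> (\<integral>s. sketch_proj (\<kappa> n) s \<partial>D)" by simp_all
  have "(\<lambda>n. norm L * norm (\<kappa> n - K_limit)) \<longlonglongrightarrow> norm L * 0"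
    by (intro tendsto_mult tendsto_const tendsto_norm_zero LIM_zero \<kappa>)
  then have l: "(\<lambda>n. norm L * norm (\<kappa> n - K_limit)) \<longlonglongrightarrow> 0" by simp
  then have "(\<lambda>n. 4 * (norm L * norm (\<kappa> n - K_limit)) * (norm v)\<^sup>2) \<longlonglongrightarrow> 4 * 0 * (norm v)\<^sup>2"
    by (intro tendsto_mult tendsto_const)
  then have "\<forall>\<^sub>F n in sequentially. 4 * (norm L * norm (\<kappa> n - K_limit)) * (norm v)\<^sup>2 < e"
    using \<open>0 < e\<close> by (intro order_tendstoD(2)) auto
  moreover have "\<forall>\<^sub>F n in sequentially. norm L * norm (\<kappa> n - K_limit) < 1 / 2"
    by (rule order_tendstoD(2)[OF l]) simp
  ultimately have "\<forall>\<^sub>F n in sequentially. 4 * (norm L * norm (\<kappa> n - K_limit)) * (norm v)\<^sup>2 < e \<and>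
      norm L * norm (\<kappa> n - K_limit) < 1 / 2" by (rule eventually_conj)
  then obtain n where n: "4 * (norm L * norm (\<kappa> n - K_limit)) * (norm v)\<^sup>2 < e"
    "norm L * norm (\<kappa> n - K_limit) \<le> 1 / 2"
    using eventually_happens by fastforce
  interpret D: prob_space D by (rule D_prob)
  note q = integral_quadratic[OF integrable_sketch_proj_of_law[OF D_prob D_sets]]
  have "\<gamma>\<^sub>S * (norm v)\<^sup>2 \<le> v \<bullet> ((\<integral>s. sketch_proj (\<kappa> n) s \<partial>D) *v v)"
    using \<kappa>(3)[of n] unfolding loewner_le_def
    by (auto simp: matrix_vector_mult_diff_rdistrib inner_diff_right dot_square_norm scaleR_matrix_vector_assoc[symmetric])
  also have "\<dots> = (\<integral>s. v \<bullet> (sketch_proj (\<kappa> n) s *v v) \<partial>D)"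
    by (rule q(1)[OF \<kappa>(2), symmetric])
  also have "\<dots> \<le> (\<integral>s. v \<bullet> (sketch_proj K_limit s *v v) + 4 * norm L * norm (\<kappa> n - K_limit) * (norm v)\<^sup>2 \<partial>D)"
    using q(2)[OF \<kappa>(2)] q(2)[OF transpose_K_limit]
    by (intro integral_mono sketch_proj_stable transpose_K_limit \<kappa>(2) L n(2)) auto
  also have "\<dots> = v \<bullet> ((\<integral>s. sketch_proj K_limit s \<partial>D) *v v) + 4 * norm L * norm (\<kappa> n - K_limit) * (norm v)\<^sup>2"
    using q[OF transpose_K_limit] by (simp add: D.prob_space)
  finally show "\<gamma>\<^sub>S * (norm v)\<^sup>2 \<le> v \<bullet> ((\<integral>s. sketch_proj K_limit s \<partial>D) *v v) + e"
    using n(1) by (simp add: mult.assoc)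
qed

lemma sketch_distribution_limit: "sketch_distribution D K_limit (1 - \<gamma>\<^sub>S)"
proof (intro sketch_distribution.intro sketch_distribution_axioms.intro D_prob D_sets transpose_K_limit)
  show "(1 - (1 - \<gamma>\<^sub>S)) * (norm v)\<^sup>2 \<le> v \<bullet> ((\<integral>s. sketch_proj K_limit s \<partial>D) *v v)" for v
    using sketch_contraction_limit[of v] by simp
qed

end

section \<open>The limiting covariance for harmonic stepsizes\<close>

text \<open>Here \<open>b = - 1\<close> and \<open>b' = 1\<close>, so the coefficient \<open>1 + b / (2 * b')\<close> of the identity is one half.\<close>

lemma Xi_star_harmonic:
  assumes beta: "\<And>t. t \<ge> 1 \<Longrightarrow> \<beta> t = 1 / real t"
  shows "Xi_star \<beta> N Ct Om =
    (let A = (1 / 2) *\<^sub>R mat 1 + (\<integral>w. Ct w \<partial>N) in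
      THE X. A ** X + X ** A = (\<integral>w. (mat 1 + Ct w) ** Om ** transpose (mat 1 + Ct w) \<partial>N))"
proof -
  have "(\<lambda>t. - 1 - inverse (real (Suc t))) \<longlonglongrightarrow> - 1 - 0"
    by (intro tendsto_diff tendsto_const LIMSEQ_inverse_real_of_nat)
  moreover have "real (t + 2) * (1 - \<beta> (t + 2 - 1) / \<beta> (t + 2)) = - 1 - inverse (real (Suc t))" for t
  proof -
    have b1: "\<beta> (t + 2 - 1) = 1 / (real t + 1)" and b2: "\<beta> (t + 2) = 1 / (real t + 2)"
      using beta[of "t + 1"] beta[of "t + 2"] by (simp_all add: add.commute)
    show ?thesis unfolding b1 b2 by (simp add: field_simps)
  qed
  ultimately have "(\<lambda>t. real (t + 2) * (1 - \<beta> (t + 2 - 1) / \<beta> (t + 2))) \<longlonglongrightarrow> - 1" by simp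
  then have "(\<lambda>t. real t * (1 - \<beta> (t - 1) / \<beta> t)) \<longlonglongrightarrow> - 1" by (rule LIMSEQ_offset)
  then have b: "lim (\<lambda>t. real t * (1 - \<beta> (t - 1) / \<beta> t)) = - 1" by (rule limI)
  have "(\<lambda>t. real (t + 1) * \<beta> (t + 1)) \<longlonglongrightarrow> 1"
    using beta by simp
  then have "(\<lambda>t. real t * \<beta> t) \<longlonglongrightarrow> 1" by (rule LIMSEQ_offset)
  then have b': "lim (\<lambda>t. real t * \<beta> t) = 1" by (rule limI)
  show ?thesis unfolding Xi_star_def b b' Let_def by simp
qed

theorem corollary14:
  fixes M :: "'w measure" and P :: "'p measure"
    and F :: "real^'d \<Rightarrow> 'p \<Rightarrow> real" and c :: "real^'d \<Rightarrow> real^'m"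
    and \<xi> :: "nat \<Rightarrow> 'w \<Rightarrow> 'p" and \<alpha> :: "nat \<Rightarrow> 'w \<Rightarrow> real"
    and \<Delta> :: "nat \<Rightarrow> 'w \<Rightarrow> real^'d^'d"
    and x :: "nat \<Rightarrow> 'w \<Rightarrow> real^'d" and lam :: "nat \<Rightarrow> 'w \<Rightarrow> real^'m"
    and z :: "nat \<Rightarrow> 'w \<Rightarrow> real^('d + 'm)" and \<beta> chi :: "nat \<Rightarrow> real"
    and x0 xs :: "real^'d" and lam0 ls :: "real^'m"
    and X :: "(real^'d) set" and \<Lambda> :: "(real^'m) set"
    and \<gamma>\<^sub>G \<gamma>\<^sub>R\<^sub>H \<Upsilon>\<^sub>B \<Upsilon>\<^sub>m \<gamma>\<^sub>S \<Upsilon>\<^sub>S :: real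
    and \<tau> :: nat and S :: "nat \<Rightarrow> nat \<Rightarrow> 'w \<Rightarrow> real^'s^('d + 'm)"
    and D :: "(real^'s^('d + 'm)) measure"
  assumes beta: "\<And>t. t \<ge> 1 \<Longrightarrow> \<beta> t = 1 / real t"
    and chi: "chi \<in> o(\<lambda>t. \<beta> t powr (3 / 2))"
  shows "(exact_stosqp M P F c \<xi> \<alpha> \<Delta> x lam z \<beta> chi x0 lam0 X \<Lambda> \<gamma>\<^sub>G \<gamma>\<^sub>R\<^sub>H \<Upsilon>\<^sub>B \<Upsilon>\<^sub>m xs ls \<longrightarrow>
      Xi_star \<beta> M (\<lambda>_. 0) (Omega_star P F c xs ls) = Omega_star P F c xs ls) \<and>
    (sketched_stosqp M P F c \<xi> \<alpha> \<Delta> x lam z \<beta> chi x0 lam0 X \<Lambda> \<gamma>\<^sub>G \<gamma>\<^sub>R\<^sub>H \<Upsilon>\<^sub>B \<Upsilon>\<^sub>m xs ls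
        \<tau> S D \<gamma>\<^sub>S \<Upsilon>\<^sub>S \<and> (1 - \<gamma>\<^sub>S) ^ \<tau> < 1 / 3 \<longrightarrow>
      Omega_star P F c xs ls \<preceq>
        Xi_star \<beta> (sketch_law D \<tau>) (C_tilde (K_star P F c xs ls) \<tau>) (Omega_star P F c xs ls) \<and>
      spec_norm (Xi_star \<beta> (sketch_law D \<tau>) (C_tilde (K_star P F c xs ls) \<tau>)
          (Omega_star P F c xs ls) - Omega_star P F c xs ls)
        \<le> 3 * (1 - \<gamma>\<^sub>S) ^ \<tau> * spec_norm (Omega_star P F c xs ls))"
proof -
  have Xi: "Xi_star \<beta> N Ct Om =
    (let A = (1 / 2) *\<^sub>R mat 1 + (\<integral>w. Ct w \<partial>N) in
      THE X. A ** X + X ** A = (\<integral>w. (mat 1 + Ct w) ** Om ** transpose (mat 1 + Ct w) \<partial>N))"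
    for N :: "'v measure" and Ct and Om :: "real^('d + 'm)^('d + 'm)"
    by (rule Xi_star_harmonic) (rule beta)
  show ?thesis
proof (intro conjI impI)
  let ?Om = "Omega_star P F c xs ls"
  assume "exact_stosqp M P F c \<xi> \<alpha> \<Delta> x lam z \<beta> chi x0 lam0 X \<Lambda> \<gamma>\<^sub>G \<gamma>\<^sub>R\<^sub>H \<Upsilon>\<^sub>B \<Upsilon>\<^sub>m xs ls"
  then interpret exact_stosqp M P F c \<xi> \<alpha> \<Delta> x lam z \<beta> chi x0 lam0 X \<Lambda> \<gamma>\<^sub>G \<gamma>\<^sub>R\<^sub>H \<Upsilon>\<^sub>B \<Upsilon>\<^sub>m xs ls .
  have half: "((1 / 2) *\<^sub>R mat 1) ** X + X ** ((1 / 2) *\<^sub>R mat 1) = X" for X :: "real^('d + 'm)^('d + 'm)"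
    by (simp add: bounded_bilinear.scaleR_left[OF bounded_bilinear_matrix_mult]
        bounded_bilinear.scaleR_right[OF bounded_bilinear_matrix_mult])
  have "Xi_star \<beta> M (\<lambda>_. 0) ?Om =
    (THE X. ((1 / 2) *\<^sub>R mat 1) ** X + X ** ((1 / 2) *\<^sub>R mat 1) = ?Om)"
    unfolding Xi Let_def
    by (simp add: prob_space transpose_mat)
  then show "Xi_star \<beta> M (\<lambda>_. 0) ?Om = ?Om" by (simp add: half)
next
  let ?Om = "Omega_star P F c xs ls" and ?K = "K_star P F c xs ls"
  assume "sketched_stosqp M P F c \<xi> \<alpha> \<Delta> x lam z \<beta> chi x0 lam0 X \<Lambda> \<gamma>\<^sub>G \<gamma>\<^sub>R\<^sub>H \<Upsilon>\<^sub>B \<Upsilon>\<^sub>m xs ls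
        \<tau> S D \<gamma>\<^sub>S \<Upsilon>\<^sub>S \<and> (1 - \<gamma>\<^sub>S) ^ \<tau> < 1 / 3"
  then have run: "sketched_stosqp M P F c \<xi> \<alpha> \<Delta> x lam z \<beta> chi x0 lam0 X \<Lambda> \<gamma>\<^sub>G \<gamma>\<^sub>R\<^sub>H \<Upsilon>\<^sub>B \<Upsilon>\<^sub>m xs ls
        \<tau> S D \<gamma>\<^sub>S \<Upsilon>\<^sub>S" and small: "(1 - \<gamma>\<^sub>S) ^ \<tau> < 1 / 3" by auto
  interpret sketched_stosqp M P F c \<xi> \<alpha> \<Delta> x lam z \<beta> chi x0 lam0 X \<Lambda> \<gamma>\<^sub>G \<gamma>\<^sub>R\<^sub>H \<Upsilon>\<^sub>B \<Upsilon>\<^sub>m xs ls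
        \<tau> S D \<gamma>\<^sub>S \<Upsilon>\<^sub>S by (rule run)
  obtain L where L: "L ** ?K = mat 1" using K_limit_left_inverse by (rule exE)
  note Om = Omega_star_symmetric_psd[OF transpose_K_limit L]
  note bounds = sketch_distribution.limiting_covariance_bounds[OF sketch_distribution_limit Om small refl]
  let ?A = "(1 / 2) *\<^sub>R mat 1 + (\<integral>S. C_tilde ?K \<tau> S \<partial>sketch_law D \<tau>)"
  let ?Xi = "Xi_star \<beta> (sketch_law D \<tau>) (C_tilde ?K \<tau>) ?Om"
  have "?A ** ?Xi + ?Xi ** ?A =
      (\<integral>S. (mat 1 + C_tilde ?K \<tau> S) ** ?Om ** transpose (mat 1 + C_tilde ?K \<tau> S) \<partial>sketch_law D \<tau>)"
    unfolding Xi Let_def by (rule theI'[OF bounds(1)])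
  from bounds(2)[OF this]
  show "?Om \<preceq> ?Xi" "spec_norm (?Xi - ?Om) \<le> 3 * (1 - \<gamma>\<^sub>S) ^ \<tau> * spec_norm ?Om" by auto
qed
qed

end
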